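(* Let $C$ and $D$ be doubly-even binary codes of length $n$. Then $\mathcal{L}^+(C)\cong\mathcal{L}^+(D)$ if and only if one of the following holds. (1) $C$ and $D$ are equivalent. (2) $C$ and $D$ are doubly-even self-dual binary codes of length $16$.
   Context: A binary code $C$ of length $n$ is a linear subspace of $\mathbb{F}_2^n$. The weight of a vector is its number of nonzero coordinates. $C$ is doubly-even if all its elements have weight divisible by $4$, and self-dual if $C=C^\perp$, where $C^\perp=\{x\in\mathbb{F}_2^n\mid\langle x,C\rangle=0\}$ and $\langle x,y\rangle=\sum_i x_iy_i$. Two binary codes are equivalent if one is obtained from the other by a permutation of the coordinates. Let $\alpha_1,\dots,\alpha_n$ be an orthogonal basis of $\mathbb{R}^n$ consisting of vectors of norm $(\alpha_i,\alpha_i)=2$. For $c=(c_i)\in\mathbb{F}_2^n$ put $\alpha_c=\sum_{i=1}^nc_i\alpha_i$, with $c_i$ regarded as the integers $0,1$. For a binary code $C$ of length $n$, $$\mathcal{L}^+(C)=\sum_{1\le i,j\le n}\mathbb{Z}(\alpha_i+\alpha_j)+\sum_{c\in C}\mathbb{Z}\tfrac12\alpha_c .$$ Two lattices in $\mathbb{R}^n$ are isomorphic ($\cong$) if one is obtained from the other by an orthogonal transformation of $\mathbb{R}^n$. *)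

theory Defs
  imports "HOL-Analysis.Analysis" "HOL-Library.Z2"
begin

text \<open>Binary codes of length \<open>CARD('n)\<close> are the sets \<open>C :: (bit ^ 'n) set\<close> with
  \<^const>\<open>vec.subspace\<close> \<open>C\<close>, linearity being over the two-element field \<^typ>\<open>bit\<close>.\<close>

definition weight :: "bit ^ 'n \<Rightarrow> nat" where
  "weight c = card {i. c $ i \<noteq> 0}"

definition doubly_even :: "(bit ^ 'n) set \<Rightarrow> bool" where
  "doubly_even C \<longleftrightarrow> (\<forall>c\<in>C. 4 dvd weight c)"

definition code_inner :: "bit ^ 'n \<Rightarrow> bit ^ 'n \<Rightarrow> bit" where
  "code_inner x y = (\<Sum>i\<in>UNIV. x $ i * y $ i)"

definition dual_code :: "(bit ^ 'n) set \<Rightarrow> (bit ^ 'n) set" where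
  "dual_code C = {x. \<forall>c\<in>C. code_inner x c = 0}"

definition self_dual :: "(bit ^ 'n) set \<Rightarrow> bool" where
  "self_dual C \<longleftrightarrow> C = dual_code C"

definition equivalent_codes :: "(bit ^ 'n) set \<Rightarrow> (bit ^ 'n) set \<Rightarrow> bool" where
  "equivalent_codes C D \<longleftrightarrow> (\<exists>\<pi>. \<pi> permutes UNIV \<and> D = (\<lambda>c. \<chi> i. c $ \<pi> i) ` C)"

definition orthogonal_basis_norm2 :: "('n \<Rightarrow> real ^ 'n) \<Rightarrow> bool" where
  "orthogonal_basis_norm2 \<alpha> \<longleftrightarrow>
     inj \<alpha> \<and> independent (range \<alpha>) \<and> span (range \<alpha>) = UNIV \<and>
     pairwise orthogonal (range \<alpha>) \<and> (\<forall>i. \<alpha> i \<bullet> \<alpha> i = 2)"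

definition code_vec :: "('n \<Rightarrow> real ^ 'n) \<Rightarrow> bit ^ 'n \<Rightarrow> real ^ 'n" where
  "code_vec \<alpha> c = (\<Sum>i\<in>UNIV. of_bit (c $ i) *\<^sub>R \<alpha> i)"

text \<open>Real vector spaces as \<open>\<int>\<close>-modules; \<open>int_span S\<close> is the set of all finite
  integral linear combinations of elements of \<open>S\<close>.\<close>

global_interpretation int_module:
  module "\<lambda>(k::int) (v::'a::real_vector). real_of_int k *\<^sub>R v"
  defines int_span = int_module.span
  by unfold_locales (simp_all add: algebra_simps)

definition Lplus :: "('n \<Rightarrow> real ^ 'n) \<Rightarrow> (bit ^ 'n) set \<Rightarrow> (real ^ 'n) set" where
  "Lplus \<alpha> C =
     int_span ({\<alpha> i + \<alpha> j | i j. True} \<union> {(1/2) *\<^sub>R code_vec \<alpha> c | c. c \<in> C})"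

definition lattice_iso :: "(real ^ 'n) set \<Rightarrow> (real ^ 'n) set \<Rightarrow> bool" where
  "lattice_iso L M \<longleftrightarrow> (\<exists>f. orthogonal_transformation f \<and> f ` L = M)"

end

theory Submission
  imports Defs
begin

text \<open>For a family \<open>\<alpha>\<close> of orthogonal vectors of norm 2, membership of \<open>x\<close> in \<open>\<L>\<^sup>+(C)\<close> can be
  read off the integers \<open>x \<bullet> \<alpha> i\<close>: their parities form a word of \<open>C\<close> and their sum is divisible
  by 4. An isometry \<open>\<L>\<^sup>+(C) \<cong> \<L>\<^sup>+(D)\<close> therefore amounts to two frames \<open>\<alpha>\<close>, \<open>\<beta>\<close> describing the
  same lattice \<open>L\<close> with codes \<open>C\<close>, \<open>D\<close>. Each frame lies in a single coset of \<open>L\<close>.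

  If both frames lie in the same coset, reflections in norm 2 vectors of \<open>L\<close> move \<open>\<beta>\<close> onto \<open>\<plusminus>\<alpha>\<close>,
  so \<open>C\<close> and \<open>D\<close> are equivalent. The products \<open>\<alpha> i \<bullet> \<beta> j\<close> are either all integers or all in \<open>\<int> +
  1/2\<close>. In the integral case, if the cosets differ, a partition of the coordinates into words of
  weight 4 from one coset of \<open>C\<close> gives an automorphism of \<open>L\<close> carrying the coset of \<open>\<alpha>\<close> to that
  of \<open>\<beta>\<close>. In the other case some product is \<open>\<plusminus>3/2\<close>, and a reflection in a norm 1 vector maps one
  frame vector to the other up to sign, or the length is 16 and all products are \<open>\<plusminus>1/2\<close>; if \<open>C\<close>
  is not self-dual, another frame for \<open>L\<close> with code \<open>C\<close> has integral products with \<open>\<beta>\<close>; it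
  exists by a Gauss sum and a moment count of words of weight 4.

  Conversely, for a self-dual code of length 16 the lattice does not depend on the code: in a
  suitable orthonormal basis it is the lattice \<open>D\<^sub>8 \<oplus> D\<^sub>8\<close> glued along \<open>((1/2)\<^sup>8, (1/2)\<^sup>8)\<close>. The
  basis is built from the seven words of weight 4 through a coordinate, which either share a
  second coordinate or span a set of eight coordinates.\<close>

section \<open>Binary codes\<close>

text \<open>The lattice does not determine a frame: \<open>2 *\<^sub>R \<alpha> i\<close> and all
  \<open>\<alpha> i - \<alpha> j\<close> lie in \<open>L\<close> but \<open>\<alpha> i\<close> does
  not, so a frame picks out one class of order 2 modulo \<open>L\<close>. The work is to move one
  frame, by isometries that preserve \<open>L\<close> and keep the code, until both frames pick the
  same class. Reflections in norm 2 vectors of \<open>L\<close> stay inside the class; the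
  reflection in a norm 1 vector and switching along blocks can change it. Switching turns
  half-integral products into integral ones when some dual word meets every block in an odd number
  of points. Such blocks lie in the dual code but not in \<open>C\<close>, which cannot happen for a
  self-dual code. This is the source of the exceptional case.\<close>

definition ind :: "'n set \<Rightarrow> bit ^ 'n" where
  "ind A = (\<chi> i. of_bool (i \<in> A))"

definition supp :: "bit ^ 'n \<Rightarrow> 'n set" where
  "supp c = {i. c $ i = 1}"

definition word :: "('n \<Rightarrow> int) \<Rightarrow> bit ^ 'n" where
  "word z = (\<chi> i. of_int (z i))"

text \<open>The nontrivial additive character of the two-element field. Its values lie in an
  arbitrary ring because it is summed over \<open>int\<close>, \<open>real\<close> and
  \<open>complex\<close>.\<close>

definition sg :: "bit \<Rightarrow> 'a::comm_ring_1" where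
  "sg b = (if b = 0 then 1 else -1)"

lemma ind_nth [simp]: "ind A $ i = of_bool (i \<in> A)"
  by (simp add: ind_def)

lemma supp_ind [simp]: "supp (ind A) = A"
  by (auto simp: supp_def)

lemma ind_supp [simp]: "ind (supp c) = c"
  by (simp add: vec_eq_iff supp_def)

lemma ind_inject [simp]: "ind A = ind B \<longleftrightarrow> A = B"
  by (metis supp_ind)

lemma supp_inject: "supp c = supp d \<longleftrightarrow> c = d"
  by (metis ind_supp)

lemma mem_supp: "i \<in> supp c \<longleftrightarrow> c $ i = 1"
  by (simp add: supp_def)

lemma bij_ind: "bij ind"
  by (rule bijI') (auto intro: ind_supp[symmetric])

lemma supp_0 [simp]: "supp 0 = {}"
  by (simp add: supp_def)

lemma weight_supp: "weight c = card (supp c)"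
  by (simp add: weight_def supp_def)

lemma weight_ind [simp]: "weight (ind A) = card A"
  by (simp add: weight_supp)

lemma finite_code [simp]: "finite (C :: (bit ^ 'n::finite) set)"
proof -
  have "(UNIV :: (bit ^ 'n) set) = range ind"
    using bij_ind by (metis bij_def)
  then show ?thesis
    by (metis finite finite_imageI finite_subset subset_UNIV)
qed

lemma bit_add_self [simp]: "(b::bit) + b = 0"
  by (cases b) simp_all

lemma bit_vec_add_self [simp]: "(c :: bit ^ 'n) + c = 0"
  by (simp add: vec_eq_iff)

lemma bit_vec_add_left [simp]: "(c :: bit ^ 'n) + (c + d) = d"
  by (simp add: vec_eq_iff flip: add.assoc)

lemma bit_add_eq_0_iff: "(a::bit) + b = 0 \<longleftrightarrow> a = b"
  by (cases a; cases b) simp_all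

lemma bit_vec_add_eq_0_iff: "(c :: bit ^ 'n) + d = 0 \<longleftrightarrow> c = d"
  by (simp only: vec_eq_iff vector_add_component zero_index bit_add_eq_0_iff)

lemma supp_add: "supp (c + d) = (supp c - supp d) \<union> (supp d - supp c)"
  by (auto simp: supp_def)

lemma supp_add_one: "supp (ind UNIV + c) = - supp c"
  by (auto simp: supp_add)

lemma bit_of_int: "(of_int k :: bit) = of_bool (odd k)"
  by (cases "even k") (auto elim!: evenE oddE)

lemma word_nth [simp]: "word z $ i = of_bool (odd (z i))"
  by (simp add: word_def bit_of_int)

lemma word_add: "word (\<lambda>i. z i + w i) = word z + word w"
  by (simp add: word_def vec_eq_iff)

lemma word_eq_iff: "word z = word w \<longleftrightarrow> (\<forall>i. even (z i - w i))"
  by (auto simp: vec_eq_iff)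

lemma sg_add: "sg (a + b) = sg a * sg b"
  by (cases a; cases b) (simp_all add: sg_def)

lemma sg_simps [simp]: "sg 0 = 1" "sg 1 = -1"
  by (simp_all add: sg_def)

lemma sg_mult_self [simp]: "sg b * sg b = 1"
  by (cases b) simp_all

lemma sg_of_bool: "sg b = 1 - 2 * of_bool (b = 1)"
  by (cases b) simp_all

lemma code_subspace_add: "vec.subspace C \<Longrightarrow> c \<in> C \<Longrightarrow> d \<in> C \<Longrightarrow> c + d \<in> C"
  by (rule vec.subspace_add)

lemma code_subspace_0: "vec.subspace C \<Longrightarrow> 0 \<in> C"
  by (rule vec.subspace_0)

lemma subspace_codeI:
  fixes C :: "(bit ^ 'n) set"
  assumes "0 \<in> C" "\<And>c d. c \<in> C \<Longrightarrow> d \<in> C \<Longrightarrow> c + d \<in> C"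
  shows "vec.subspace C"
proof (rule vec.subspaceI)
  fix k :: bit and c assume "c \<in> C" then show "k *s c \<in> C"
    using assms(1) by (cases k) simp_all
qed (use assms in auto)

lemma code_subspace_add_iff:
  fixes C :: "(bit ^ 'n) set"
  assumes "vec.subspace C" "c \<in> C"
  shows "c + d \<in> C \<longleftrightarrow> d \<in> C"
  using assms code_subspace_add[of C c] by (metis bit_vec_add_left)

lemma code_inner_commute: "code_inner x y = code_inner y x"
  by (simp only: code_inner_def mult.commute)

lemma code_inner_add_left: "code_inner (x + y) c = code_inner x c + code_inner y c"
  by (simp only: code_inner_def vector_add_component distrib_left distrib_right sum.distrib)

lemma code_inner_add_right: "code_inner c (x + y) = code_inner c x + code_inner c y"
  by (simp only: code_inner_def vector_add_component distrib_left distrib_right sum.distrib)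

lemma code_inner_0 [simp]: "code_inner 0 c = 0" "code_inner c 0 = 0"
  by (simp_all add: code_inner_def)

lemma code_inner_word: "code_inner (word z) (word w) = of_int (\<Sum>i\<in>UNIV. z i * w i)"
  by (simp add: code_inner_def word_def)

lemma code_inner_card: "code_inner x y = of_bool (odd (card (supp x \<inter> supp y)))"
proof -
  have "code_inner x y = (\<Sum>i\<in>UNIV. of_bool (i \<in> supp x \<inter> supp y))"
    unfolding code_inner_def
    by (intro sum.cong refl) (auto simp: mem_supp)
  also have "\<dots> = of_nat (card (supp x \<inter> supp y))"
    by (simp add: Int_def flip: sum.inter_filter)
  also have "\<dots> = of_bool (odd (card (supp x \<inter> supp y)))"
    using bit_of_int[of "int (card (supp x \<inter> supp y))"] by simp
  finally show ?thesis .
qed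

lemma code_inner_ind_word: "code_inner (ind A) (word z) = of_bool (odd (\<Sum>i\<in>A. z i))"
proof -
  have "code_inner (ind A) (word z) = (\<Sum>i\<in>UNIV. if i \<in> A then of_int (z i) else 0)"
    unfolding code_inner_def by (intro sum.cong) (auto simp: bit_of_int)
  also have "\<dots> = of_int (\<Sum>i\<in>A. z i)"
    by (simp flip: sum.inter_filter)
  finally show ?thesis by (simp only: bit_of_int)
qed

lemma dual_codeD: "x \<in> dual_code C \<Longrightarrow> c \<in> C \<Longrightarrow> code_inner x c = 0"
  by (simp add: dual_code_def)

lemma dual_code_even: "ind A \<in> dual_code C \<Longrightarrow> word z \<in> C \<Longrightarrow> even (\<Sum>i\<in>A. z i)"
  by (drule (1) dual_codeD) (simp add: code_inner_ind_word split: if_splits)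

lemma subspace_dual_code: "vec.subspace (dual_code C)"
  by (rule subspace_codeI) (auto simp: dual_code_def code_inner_add_left)

text \<open>An even square is 0 and an odd square is 1 modulo 4, so the sum of squares is congruent
  to the weight of the reduction modulo 2.\<close>

lemma doubly_even_word_sq:
  assumes "doubly_even C" "word z \<in> C"
  shows "4 dvd (\<Sum>i\<in>UNIV. (z i)\<^sup>2)"
proof -
  have "weight (word z) = card {i. odd (z i)}"
    by (simp add: weight_def)
  then have "4 dvd card {i. odd (z i)}"
    using assms unfolding doubly_even_def by metis
  then have 1: "4 dvd (\<Sum>i\<in>UNIV. of_bool (odd (z i)) :: int)"
    by (simp flip: sum.inter_filter) presburger
  have "4 dvd (\<Sum>i\<in>UNIV. (z i)\<^sup>2 - of_bool (odd (z i)) :: int)"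
    by (intro dvd_sum) (auto elim!: evenE oddE simp: power2_eq_square algebra_simps)
  with 1 show ?thesis
    by (simp add: sum_subtractf dvd_diff_left_iff)
qed

text \<open>Polarisation of the previous congruence. It makes the lattice integral, since the inner
  product in frame coordinates carries a factor 1/2.\<close>

lemma doubly_even_word_mult:
  assumes C: "vec.subspace C" "doubly_even C" and z: "word z \<in> C" and w: "word w \<in> C"
  shows "even (\<Sum>i\<in>UNIV. z i * w i)"
proof -
  have "word (\<lambda>i. z i + w i) \<in> C"
    unfolding word_add using C z w by (rule_tac code_subspace_add)
  then have "4 dvd (\<Sum>i\<in>UNIV. (z i + w i)\<^sup>2)"
    using C(2) by (rule_tac doubly_even_word_sq)
  moreover have "(\<Sum>i\<in>UNIV. (z i + w i)\<^sup>2) =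
      (\<Sum>i\<in>UNIV. (z i)\<^sup>2) + (\<Sum>i\<in>UNIV. (w i)\<^sup>2) + 2 * (\<Sum>i\<in>UNIV. z i * w i)"
    by (simp add: power2_sum sum.distrib sum_distrib_left mult.assoc)
  ultimately have "4 dvd 2 * (\<Sum>i\<in>UNIV. z i * w i)"
    using doubly_even_word_sq[OF C(2) z] doubly_even_word_sq[OF C(2) w]
    by (simp add: dvd_add_right_iff)
  then show ?thesis by presburger
qed

lemma word_of_bool: "word (\<lambda>i. of_bool (i \<in> A)) = ind A"
  by (auto simp: vec_eq_iff)

lemma doubly_even_subset_dual:
  assumes "vec.subspace C" "doubly_even C"
  shows "C \<subseteq> dual_code C"
proof
  fix x assume x: "x \<in> C"
  have "code_inner x c = 0" if c: "c \<in> C" for c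
    using doubly_even_word_mult[OF assms, of "\<lambda>i. of_bool (i \<in> supp x)" "\<lambda>i. of_bool (i \<in> supp c)"] x c
    by (simp add: word_of_bool code_inner_card Collect_conj_eq flip: of_bool_conj)
  then show "x \<in> dual_code C" by (simp add: dual_code_def)
qed

section \<open>Character sums and duality\<close>

lemma char_sum_zero:
  fixes g :: "bit ^ 'n::finite \<Rightarrow> bit"
  assumes C: "vec.subspace C" and g: "\<And>x y. g (x + y) = g x + g y" and c0: "c0 \<in> C" "g c0 = 1"
  shows "(\<Sum>c\<in>C. sg (g c) :: 'a::{idom,ring_char_0}) = 0"
proof -
  \<comment> \<open>Translation by \<open>c0\<close> permutes \<open>C\<close> and reverses every
    sign, so the sum equals its own negative.\<close>
  have "bij_betw ((+) c0) C C"
    by (rule bij_betwI[of _ _ _ "(+) c0"]) (use C c0 in \<open>auto intro: code_subspace_add\<close>)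
  then have "(\<Sum>c\<in>C. sg (g c) :: 'a) = (\<Sum>c\<in>C. sg (g (c0 + c)))"
    by (rule sum.reindex_bij_betw[symmetric])
  also have "\<dots> = - (\<Sum>c\<in>C. sg (g c))"
    by (simp only: g c0 sg_add sum_negf sg_simps mult_minus1)
  finally have "2 * (\<Sum>c\<in>C. sg (g c) :: 'a) = 0"
    by (metis add.right_inverse mult_2)
  then show ?thesis by simp
qed

lemma char_sum_code:
  assumes "vec.subspace (C :: (bit ^ 'n::finite) set)"
  shows "(\<Sum>c\<in>C. sg (code_inner x c) :: 'a::{idom,ring_char_0}) = (if x \<in> dual_code C then of_nat (card C) else 0)"
proof (cases "x \<in> dual_code C")
  case True
  then have "(\<Sum>c\<in>C. sg (code_inner x c) :: 'a) = (\<Sum>c\<in>C. 1)"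
    by (intro sum.cong) (auto dest: dual_codeD)
  then show ?thesis using True by simp
next
  case False
  then obtain c0 where "c0 \<in> C" "code_inner x c0 = 1"
    by (auto simp: dual_code_def)
  then show ?thesis
    using False char_sum_zero[OF assms, of "code_inner x"] by (simp add: code_inner_add_right)
qed

lemma code_inner_axis: "code_inner (ind {i}) c = c $ i"
proof -
  have "code_inner (ind {i}) c = (\<Sum>j\<in>UNIV. if j = i then c $ i else 0)"
    unfolding code_inner_def by (intro sum.cong) auto
  then show ?thesis by simp
qed

lemma dual_code_UNIV: "dual_code UNIV = {0}"
proof -
  have "x = 0" if "x \<in> dual_code UNIV" for x
    using that by (auto simp: dual_code_def vec_eq_iff code_inner_commute[of x]
        simp flip: code_inner_axis)
  then show ?thesis by (auto simp: dual_code_def)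
qed

text \<open>Double summation of \<open>sg (code_inner x c)\<close>: for fixed \<open>x\<close> only
  dual words contribute, for fixed \<open>c\<close> only \<open>c = 0\<close> does.\<close>

lemma card_code_dual:
  assumes C: "vec.subspace (C :: (bit ^ 'n::finite) set)"
  shows "card C * card (dual_code C) = card (UNIV :: (bit ^ 'n) set)"
proof -
  have "(\<Sum>x\<in>UNIV. \<Sum>c\<in>C. sg (code_inner x c) :: int) = int (card C * card (dual_code C))"
    by (simp add: char_sum_code[OF C] flip: sum.inter_filter)
  moreover have "(\<Sum>c\<in>C. \<Sum>x\<in>UNIV. sg (code_inner c x) :: int) = int (card (UNIV :: (bit ^ 'n) set))"
    using code_subspace_0[OF C]
    by (simp add: char_sum_code dual_code_UNIV if_distrib sum.delta
        cong: if_cong)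
  ultimately show ?thesis
    by (subst (asm) sum.swap) (simp add: code_inner_commute del: of_nat_mult)
qed

text \<open>Adjoining \<open>S\<close> doubles the code and so halves its dual; any dual word lost
  on the way has product 1 with \<open>S\<close>.\<close>

lemma dual_separates:
  assumes C: "vec.subspace (C :: (bit ^ 'n::finite) set)" and S: "S \<notin> C"
  obtains J where "J \<in> dual_code C" "code_inner J S = 1"
proof -
  let ?C' = "C \<union> (+) S ` C"
  have sub: "vec.subspace ?C'"
    by (rule subspace_codeI)
      (use C in \<open>auto simp: code_subspace_0 code_subspace_add add_ac intro!: imageI\<close>)
  have "C \<inter> (+) S ` C = {}"
  proof -
    have "S \<in> C" if "S + c \<in> C" "c \<in> C" for c
      using code_subspace_add[OF C that] by (simp add: add_ac)
    then show ?thesis using S by auto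
  qed
  then have "card ?C' = 2 * card C"
    by (subst card_Un_disjoint) (auto simp: card_image)
  then have "card C * (2 * card (dual_code ?C')) = card C * card (dual_code C)"
    using card_code_dual[OF C] card_code_dual[OF sub] by simp
  moreover have "card C > 0" "card (dual_code ?C') > 0"
    using code_subspace_0[OF C] code_subspace_0[OF subspace_dual_code[of ?C']]
    by (auto simp: card_gt_0_iff)
  ultimately have "card (dual_code ?C') < card (dual_code C)"
    by auto
  then obtain J where J: "J \<in> dual_code C" "J \<notin> dual_code ?C'"
    by (metis card_mono finite_code leD subsetI)
  then have "code_inner J S = 1"
    by (auto simp: dual_code_def code_inner_add_right)
  with J show thesis by (rule_tac that)
qed

section \<open>Frames and lattices\<close>

text \<open>Only the Gram matrix is kept. Independence and spanning follow from it by dimension, and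
  in this form the notion is visibly preserved by isometries.\<close>

definition frame :: "('n \<Rightarrow> real ^ 'n) \<Rightarrow> bool" where
  "frame \<alpha> \<longleftrightarrow> (\<forall>i j. \<alpha> i \<bullet> \<alpha> j = (if i = j then 2 else 0))"

lemma frame_inner: "frame \<alpha> \<Longrightarrow> \<alpha> i \<bullet> \<alpha> j = (if i = j then 2 else 0)"
  by (simp add: frame_def)

lemma frame_of_basis:
  assumes "orthogonal_basis_norm2 \<alpha>"
  shows "frame \<alpha>"
  unfolding frame_def
proof (intro allI)
  fix i j
  show "\<alpha> i \<bullet> \<alpha> j = (if i = j then 2 else 0)"
    using assms unfolding orthogonal_basis_norm2_def pairwise_def orthogonal_def inj_def
    by (metis rangeI)
qed

lemma frame_neg_inner:
  assumes "frame \<alpha>" "i \<noteq> j"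
  shows "\<alpha> i \<noteq> \<alpha> j" "\<alpha> i \<noteq> - \<alpha> j"
  using frame_inner[OF assms(1), of i j] frame_inner[OF assms(1), of j j] assms(2)
  by auto

lemma frame_span:
  fixes \<alpha> :: "'n::finite \<Rightarrow> real ^ 'n"
  assumes "frame \<alpha>"
  shows "span (range \<alpha>) = UNIV"
proof -
  have "0 \<notin> range \<alpha>"
    using frame_inner[OF assms] by (metis (full_types) imageE inner_zero_left zero_neq_numeral)
  moreover have "pairwise orthogonal (range \<alpha>)"
    using frame_inner[OF assms] by (auto simp: pairwise_def orthogonal_def)
  ultimately have "independent (range \<alpha>)"
    by (rule_tac pairwise_orthogonal_independent)
  moreover have "inj \<alpha>"
    using frame_neg_inner[OF assms] by (meson injI)
  then have "card (range \<alpha>) = DIM(real ^ 'n)"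
    by (simp add: card_image)
  ultimately show ?thesis
    by (metis UNIV_eq_I card_ge_dim_independent dim_UNIV order_refl subset_UNIV subsetD UNIV_I)
qed

lemma frame_eqI:
  fixes \<alpha> :: "'n::finite \<Rightarrow> real ^ 'n"
  assumes "frame \<alpha>" "\<And>i. x \<bullet> \<alpha> i = y \<bullet> \<alpha> i"
  shows "x = y"
proof (rule vector_eq_dot_span)
  show "x \<in> span (range \<alpha>)" "y \<in> span (range \<alpha>)"
    by (simp_all add: frame_span[OF assms(1)])
qed (use assms(2) in \<open>auto simp: inner_commute\<close>)

lemma frame_sum_inner:
  fixes \<alpha> :: "'n::finite \<Rightarrow> real ^ 'n"
  assumes "frame \<alpha>"
  shows "(\<Sum>j\<in>A. c j *\<^sub>R \<alpha> j) \<bullet> \<alpha> i = (if i \<in> A then 2 * c i else 0)"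
proof -
  have "(\<Sum>j\<in>A. c j *\<^sub>R \<alpha> j) \<bullet> \<alpha> i = (\<Sum>j\<in>A. if j = i then 2 * c i else 0)"
    unfolding inner_sum_left by (intro sum.cong) (auto simp: frame_inner[OF assms])
  then show ?thesis by simp
qed

lemma frame_expand:
  fixes \<alpha> :: "'n::finite \<Rightarrow> real ^ 'n"
  assumes "frame \<alpha>"
  shows "x = (\<Sum>i\<in>UNIV. ((x \<bullet> \<alpha> i) / 2) *\<^sub>R \<alpha> i)"
  by (rule frame_eqI[OF assms]) (simp add: frame_sum_inner[OF assms])

lemma frame_inner_eq:
  fixes \<alpha> :: "'n::finite \<Rightarrow> real ^ 'n"
  assumes "frame \<alpha>"
  shows "x \<bullet> y = (\<Sum>i\<in>UNIV. (x \<bullet> \<alpha> i) * (y \<bullet> \<alpha> i)) / 2"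
proof -
  have "x \<bullet> y = (\<Sum>i\<in>UNIV. ((x \<bullet> \<alpha> i) / 2) *\<^sub>R \<alpha> i) \<bullet> y"
    by (simp flip: frame_expand[OF assms])
  also have "\<dots> = (\<Sum>i\<in>UNIV. (x \<bullet> \<alpha> i) * (y \<bullet> \<alpha> i)) / 2"
    by (simp add: inner_sum_left inner_commute[of "\<alpha> _" y] sum_divide_distrib)
  finally show ?thesis .
qed

lemma frame_iso:
  fixes \<alpha> \<beta> :: "'n::finite \<Rightarrow> real ^ 'n"
  assumes \<alpha>: "frame \<alpha>" and \<beta>: "frame \<beta>"
  obtains f where "orthogonal_transformation f" "\<And>i. f (\<alpha> i) = \<beta> i"
proof
  define f where "f x = (\<Sum>i\<in>UNIV. ((x \<bullet> \<alpha> i) / 2) *\<^sub>R \<beta> i)" for x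
  have f: "f x \<bullet> \<beta> i = x \<bullet> \<alpha> i" for x i
    by (simp add: f_def frame_sum_inner[OF \<beta>])
  show "f (\<alpha> i) = \<beta> i" for i
    by (rule frame_eqI[OF \<beta>]) (simp add: f frame_inner[OF \<alpha>] frame_inner[OF \<beta>])
  show "orthogonal_transformation f"
    unfolding orthogonal_transformation_def
  proof (intro conjI allI)
    show "linear f"
      by (rule linearI; rule frame_eqI[OF \<beta>]) (simp_all add: f inner_add_left)
    show "f v \<bullet> f w = v \<bullet> w" for v w
      unfolding frame_inner_eq[OF \<beta>, of "f v"] f frame_inner_eq[OF \<alpha>, of v w] ..
  qed
qed

lemma frame_orthogonal_transformation:
  "frame \<alpha> \<Longrightarrow> orthogonal_transformation f \<Longrightarrow> frame (\<lambda>i. f (\<alpha> i))"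
  by (simp add: frame_def orthogonal_transformation_def)

lemma word_even: "(\<And>i. even (z i)) \<Longrightarrow> word z = 0"
  by (simp add: vec_eq_iff)

text \<open>As frame vectors have norm 2, \<open>x\<close> is the sum of the
  \<open>(z i / 2) *\<^sub>R \<alpha> i\<close>. A generator \<open>\<alpha> i + \<alpha> j\<close>
  has coordinate sum 4, and half a code word has its weight as coordinate sum; hence the condition
  modulo 4.\<close>

definition Lat :: "('n \<Rightarrow> real ^ 'n) \<Rightarrow> (bit ^ 'n) set \<Rightarrow> (real ^ 'n) set" where
  "Lat \<alpha> C = {x. \<exists>z. (\<forall>i. x \<bullet> \<alpha> i = of_int (z i)) \<and> word z \<in> C \<and> 4 dvd sum z UNIV}"

lemma LatI: "(\<And>i. x \<bullet> \<alpha> i = of_int (z i)) \<Longrightarrow> word z \<in> C \<Longrightarrow> 4 dvd sum z UNIV \<Longrightarrow> x \<in> Lat \<alpha> C"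
  by (auto simp: Lat_def)

lemma LatE:
  assumes "x \<in> Lat \<alpha> C"
  obtains z where "\<And>i. x \<bullet> \<alpha> i = of_int (z i)" "word z \<in> C" "4 dvd sum z UNIV"
  using assms by (auto simp: Lat_def)

lemma Lat_orthogonal_transformation:
  fixes f :: "real ^ 'n::finite \<Rightarrow> real ^ 'n"
  assumes "orthogonal_transformation f"
  shows "f ` Lat \<alpha> C = Lat (\<lambda>i. f (\<alpha> i)) C"
proof -
  have f: "f x \<bullet> f y = x \<bullet> y" for x y
    using assms by (simp add: orthogonal_transformation_def)
  have "x \<in> f ` Lat \<alpha> C" if "x \<in> Lat (\<lambda>i. f (\<alpha> i)) C" for x
  proof -
    obtain y where y: "x = f y"
      using orthogonal_transformation_surj[OF assms] by (metis surjD)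
    then have "y \<in> Lat \<alpha> C"
      using that by (simp add: Lat_def f)
    then show ?thesis using y by simp
  qed
  moreover have "f x \<in> Lat (\<lambda>i. f (\<alpha> i)) C" if "x \<in> Lat \<alpha> C" for x
    using that by (simp add: Lat_def f)
  ultimately show ?thesis by auto
qed

locale framed_code =
  fixes \<alpha> :: "'n::finite \<Rightarrow> real ^ 'n" and C :: "(bit ^ 'n) set"
  assumes frame: "frame \<alpha>"
    and subspace: "vec.subspace C"
    and doubly_even: "doubly_even C"
begin

abbreviation L where "L \<equiv> Lat \<alpha> C"

lemma Lat_0 [simp]: "0 \<in> L"
  by (rule LatI[where z = "\<lambda>_. 0"]) (simp_all add: word_def code_subspace_0[OF subspace] flip: zero_vec_def)

lemma Lat_add:
  assumes "x \<in> L" "y \<in> L"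
  shows "x + y \<in> L"
proof -
  from assms obtain z w where z: "\<And>i. x \<bullet> \<alpha> i = of_int (z i)" "word z \<in> C" "4 dvd sum z UNIV"
    and w: "\<And>i. y \<bullet> \<alpha> i = of_int (w i)" "word w \<in> C" "4 dvd sum w UNIV"
    by (metis LatE)
  show ?thesis
    by (rule LatI[where z = "\<lambda>i. z i + w i"])
      (use z w code_subspace_add[OF subspace] in \<open>simp_all add: inner_add_left word_add sum.distrib\<close>)
qed

lemma Lat_uminus:
  assumes "x \<in> L"
  shows "- x \<in> L"
proof -
  from assms obtain z where z: "\<And>i. x \<bullet> \<alpha> i = of_int (z i)" "word z \<in> C" "4 dvd sum z UNIV"
    by (metis LatE)
  have "word (\<lambda>i. - z i) = word z"
    by (simp add: word_eq_iff)
  then show ?thesis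
    by (intro LatI[where z = "\<lambda>i. - z i"]) (use z in \<open>simp_all add: sum_negf\<close>)
qed

lemma Lat_diff: "x \<in> L \<Longrightarrow> y \<in> L \<Longrightarrow> x - y \<in> L"
  using Lat_add[of x "- y"] Lat_uminus[of y] by simp

lemma Lat_uminus_iff [simp]: "- x \<in> L \<longleftrightarrow> x \<in> L"
  using Lat_uminus[of x] Lat_uminus[of "- x"] by auto

lemma Lat_diff_commute: "x - y \<in> L \<longleftrightarrow> y - x \<in> L"
  using Lat_uminus_iff[of "x - y"] by simp

lemma Lat_diff_trans: "x - y \<in> L \<Longrightarrow> y - w \<in> L \<Longrightarrow> x - w \<in> L"
  using Lat_add[of "x - y" "y - w"] by simp

lemma Lat_scale_nat: "x \<in> L \<Longrightarrow> real n *\<^sub>R x \<in> L"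
  by (induction n) (auto simp: algebra_simps intro: Lat_add)

lemma Lat_scale:
  assumes "x \<in> L"
  shows "real_of_int k *\<^sub>R x \<in> L"
proof (cases "k \<ge> 0")
  case True
  then show ?thesis using Lat_scale_nat[OF assms, of "nat k"] by simp
next
  case False
  then show ?thesis using Lat_scale_nat[OF assms, of "nat (- k)"] Lat_uminus_iff by simp
qed

lemma Lat_scale_Ints: "x \<in> L \<Longrightarrow> k \<in> \<int> \<Longrightarrow> k *\<^sub>R x \<in> L"
  by (auto elim!: Ints_cases intro: Lat_scale)

lemma Lat_frame_add: "\<alpha> i + \<alpha> j \<in> L"
proof (rule LatI[where z = "\<lambda>k. 2 * of_bool (k = i) + 2 * of_bool (k = j)"])
  show "word (\<lambda>k. 2 * of_bool (k = i) + 2 * of_bool (k = j)) \<in> C"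
    using code_subspace_0[OF subspace] by (simp add: word_even)
qed (auto simp: inner_add_left frame_inner[OF frame] sum.distrib simp flip: sum_distrib_left)

lemma Lat_frame_double: "2 *\<^sub>R \<alpha> i \<in> L"
  using Lat_frame_add[of i i] by (simp add: scaleR_2)

lemma Lat_frame_diff: "\<alpha> i - \<alpha> j \<in> L"
  using Lat_diff[OF Lat_frame_add[of i j] Lat_frame_double[of j]] by (simp add: scaleR_2)

text \<open>The coordinates of a frame vector sum to 2, which is not a multiple of 4.\<close>

lemma frame_notin_Lat: "\<alpha> i \<notin> L"
proof
  assume "\<alpha> i \<in> L"
  then obtain z where z: "\<And>j. \<alpha> i \<bullet> \<alpha> j = of_int (z j)" "4 dvd sum z UNIV"
    by (metis LatE)
  have "z j = (if j = i then 2 else 0)" for j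
    using z(1)[of j] frame_inner[OF frame, of i j] by (auto split: if_splits)
  then have "sum z UNIV = 2"
    by simp
  then show False using z(2) by simp
qed

lemma Lat_frame_Ints: "x \<in> L \<Longrightarrow> x \<bullet> \<alpha> i \<in> \<int>"
  by (auto elim!: LatE)

lemma Lat_inner_Ints:
  assumes "x \<in> L" "y \<in> L"
  shows "x \<bullet> y \<in> \<int>"
proof -
  from assms obtain z w where z: "\<And>i. x \<bullet> \<alpha> i = of_int (z i)" "word z \<in> C"
    and w: "\<And>i. y \<bullet> \<alpha> i = of_int (w i)" "word w \<in> C"
    by (metis LatE)
  have "even (\<Sum>i\<in>UNIV. z i * w i)"
    using doubly_even_word_mult[OF subspace doubly_even] z w by blast
  then obtain k where "(\<Sum>i\<in>UNIV. z i * w i) = 2 * k" ..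
  then have "x \<bullet> y = of_int k"
    unfolding frame_inner_eq[OF frame, of x y] z w by (simp flip: of_int_mult of_int_sum)
  then show ?thesis by simp
qed

lemma half_inner: "((1/2) *\<^sub>R (\<Sum>i\<in>A. \<alpha> i)) \<bullet> \<alpha> j = of_bool (j \<in> A)"
  using frame_sum_inner[OF frame, of "\<lambda>_. 1" A j] by simp

lemma half_in_Lat:
  assumes "ind A \<in> C"
  shows "(1/2) *\<^sub>R (\<Sum>i\<in>A. \<alpha> i) \<in> L"
proof (rule LatI[where z = "\<lambda>i. of_bool (i \<in> A)"])
  have "4 dvd card A"
    using doubly_even assms by (metis doubly_even_def weight_ind)
  then show "4 dvd (\<Sum>i\<in>UNIV. of_bool (i \<in> A) :: int)"
    by (simp flip: sum.inter_filter) presburger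
  show "((1/2) *\<^sub>R (\<Sum>i\<in>A. \<alpha> i)) \<bullet> \<alpha> i = of_int (of_bool (i \<in> A))" for i
    unfolding half_inner by simp
qed (simp_all add: word_of_bool assms)

lemma Lat_word:
  assumes "c \<in> C"
  obtains x where "x \<in> L" "\<And>i. x \<bullet> \<alpha> i = of_bool (i \<in> supp c)"
  using half_in_Lat[of "supp c"] half_inner[of "supp c"] assms by simp

lemma code_vec_half: "(1/2) *\<^sub>R code_vec \<alpha> c = (1/2) *\<^sub>R (\<Sum>i\<in>supp c. \<alpha> i)"
proof -
  have "code_vec \<alpha> c = (\<Sum>i\<in>UNIV. if i \<in> supp c then \<alpha> i else 0)"
    unfolding code_vec_def by (intro sum.cong) (auto simp: mem_supp)
  then show ?thesis by (simp flip: sum.inter_filter)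
qed

lemma Lplus_eq_Lat: "Lplus \<alpha> C = L"
proof
  have gen: "int_module.subspace L"
    by (rule int_module.subspaceI) (auto intro: Lat_add Lat_scale)
  show "Lplus \<alpha> C \<subseteq> L"
    unfolding Lplus_def
  proof (rule int_module.span_minimal[OF _ gen])
    show "{\<alpha> i + \<alpha> j |i j. True} \<union> {(1/2) *\<^sub>R code_vec \<alpha> c |c. c \<in> C} \<subseteq> L"
      unfolding code_vec_half by (auto simp: Lat_frame_add intro!: half_in_Lat)
  qed
next
  let ?G = "{\<alpha> i + \<alpha> j |i j. True} \<union> {(1/2) *\<^sub>R code_vec \<alpha> c |c. c \<in> C}"
  show "L \<subseteq> Lplus \<alpha> C"
  proof
    fix x assume "x \<in> L"
    then obtain z where z: "\<And>i. x \<bullet> \<alpha> i = of_int (z i)" "word z \<in> C" "4 dvd sum z UNIV"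
      by (metis LatE)
    define m where "m i = z i div 2" for i
    have zm: "z i = of_bool (i \<in> supp (word z)) + 2 * m i" for i
      by (simp add: m_def mem_supp) presburger
    have "4 dvd weight (word z)"
      using doubly_even z(2) by (simp add: doubly_even_def)
    then have "4 dvd (\<Sum>i\<in>UNIV. of_bool (i \<in> supp (word z)) :: int)"
      by (simp add: weight_supp flip: sum.inter_filter) presburger
    moreover have "sum z UNIV = (\<Sum>i\<in>UNIV. of_bool (i \<in> supp (word z))) + 2 * sum m UNIV"
      by (simp add: zm sum.distrib sum_distrib_left)
    ultimately have "4 dvd 2 * sum m UNIV"
      using z(3) by (metis dvd_add_right_iff)
    then obtain k where k: "sum m UNIV = 2 * k" by auto
    obtain i0 :: 'n where True by simp
    \<comment> \<open>Pairing each \<open>\<alpha> i\<close> with \<open>\<alpha> i0\<close> adds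
      \<open>sum m UNIV\<close> copies of \<open>\<alpha> i0\<close>. That number is
      \<open>2 * k\<close>, so the surplus is removed by \<open>k\<close> copies of the generator
      \<open>\<alpha> i0 + \<alpha> i0\<close>.\<close>
    have "x = (1/2) *\<^sub>R code_vec \<alpha> (word z)
      + ((\<Sum>i\<in>UNIV. of_int (m i) *\<^sub>R (\<alpha> i + \<alpha> i0)) - of_int k *\<^sub>R (\<alpha> i0 + \<alpha> i0))"
    proof (rule frame_eqI[OF frame])
      fix j
      have "(\<Sum>i\<in>UNIV. of_int (m i) *\<^sub>R (\<alpha> i + \<alpha> i0)) =
          (\<Sum>i\<in>UNIV. of_int (m i) *\<^sub>R \<alpha> i) + of_int (sum m UNIV) *\<^sub>R \<alpha> i0"
        by (simp add: scaleR_add_right sum.distrib scaleR_left.sum)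
      then have "(\<Sum>i\<in>UNIV. of_int (m i) *\<^sub>R (\<alpha> i + \<alpha> i0)) - of_int k *\<^sub>R (\<alpha> i0 + \<alpha> i0) =
          (\<Sum>i\<in>UNIV. of_int (m i) *\<^sub>R \<alpha> i)"
        by (simp add: k algebra_simps flip: scaleR_2)
      then show "x \<bullet> \<alpha> j = ((1/2) *\<^sub>R code_vec \<alpha> (word z)
          + ((\<Sum>i\<in>UNIV. of_int (m i) *\<^sub>R (\<alpha> i + \<alpha> i0)) - of_int k *\<^sub>R (\<alpha> i0 + \<alpha> i0))) \<bullet> \<alpha> j"
        by (simp only: inner_add_left code_vec_half half_inner frame_sum_inner[OF frame] z(1) zm[of j])
          simp
    qed
    moreover have "(1/2) *\<^sub>R code_vec \<alpha> (word z) \<in> int_span ?G"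
      by (rule int_module.span_base) (use z in blast)
    moreover have g: "\<alpha> i + \<alpha> i0 \<in> int_span ?G" for i
      by (rule int_module.span_base) blast
    ultimately show "x \<in> Lplus \<alpha> C"
      unfolding Lplus_def
      by (metis (no_types, lifting) int_module.span_add int_module.span_diff int_module.span_sum
          int_module.span_scale)
  qed
qed

end

section \<open>Equivalent codes and isomorphic lattices\<close>

lemma equivalent_codes_sym:
  assumes "equivalent_codes C D"
  shows "equivalent_codes D C"
proof -
  obtain \<pi> where \<pi>: "\<pi> permutes UNIV" "D = (\<lambda>c. \<chi> i. c $ \<pi> i) ` C"
    using assms by (auto simp: equivalent_codes_def)
  have "(\<lambda>c. \<chi> i. c $ inv \<pi> i) ` D = C"
    unfolding \<pi>(2) image_image using permutes_inverses[OF \<pi>(1)] by simp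
  then show ?thesis
    using permutes_inv[OF \<pi>(1)] unfolding equivalent_codes_def by metis
qed

text \<open>Changing the sign of a frame vector keeps the parity of the coordinate, so the
  permutation matching the frames up to sign also matches the codes.\<close>

lemma equivalent_of_signed_frames:
  assumes A: "framed_code \<alpha> C" and B: "framed_code \<beta> D" and eq: "Lat \<alpha> C = Lat \<beta> D"
    and sgn: "\<And>i. \<exists>j. \<alpha> i = \<beta> j \<or> \<alpha> i = - \<beta> j"
  shows "equivalent_codes D C"
proof -
  interpret A: framed_code \<alpha> C by fact
  interpret B: framed_code \<beta> D by fact
  obtain \<pi> where \<pi>: "\<And>i. \<alpha> i = \<beta> (\<pi> i) \<or> \<alpha> i = - \<beta> (\<pi> i)"
    using sgn by metis
  have "inj \<pi>"
  proof (rule injI, rule ccontr)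
    fix i j assume "\<pi> i = \<pi> j" "i \<noteq> j"
    then show False
      using \<pi>[of i] \<pi>[of j] frame_neg_inner[OF A.frame \<open>i \<noteq> j\<close>] by auto
  qed
  then have perm: "\<pi> permutes UNIV"
    by (intro bij_imp_permutes) (auto simp: bij_def finite_UNIV_inj_surj)
  have key: "word z = (\<chi> i. word w $ \<pi> i)"
    if "\<And>i. x \<bullet> \<alpha> i = of_int (z i)" "\<And>i. x \<bullet> \<beta> i = of_int (w i)" for x z w
  proof -
    have "z i = w (\<pi> i) \<or> z i = - w (\<pi> i)" for i
      using \<pi>[of i] that(1)[of i] that(2)[of "\<pi> i"]
      by (metis inner_minus_right of_int_eq_iff of_int_minus)
    then have "even (z i) = even (w (\<pi> i))" for i
      by (metis even_minus)
    then show ?thesis by (simp add: vec_eq_iff)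
  qed
  have "C = (\<lambda>c. \<chi> i. c $ \<pi> i) ` D"
  proof (intro equalityI subsetI)
    fix c assume "c \<in> C"
    then obtain x where x: "x \<in> Lat \<alpha> C" "\<And>i. x \<bullet> \<alpha> i = of_bool (i \<in> supp c)"
      using A.Lat_word by metis
    then obtain w where w: "\<And>i. x \<bullet> \<beta> i = of_int (w i)" "word w \<in> D"
      using eq by (metis LatE)
    have "c = word (\<lambda>i. of_bool (i \<in> supp c))"
      by (simp add: word_of_bool)
    also have "\<dots> = (\<chi> i. word w $ \<pi> i)"
      by (rule key) (use x w in auto)
    finally show "c \<in> (\<lambda>c. \<chi> i. c $ \<pi> i) ` D"
      using w(2) by blast
  next
    fix c assume "c \<in> (\<lambda>c. \<chi> i. c $ \<pi> i) ` D"
    then obtain d where d: "d \<in> D" "c = (\<chi> i. d $ \<pi> i)" by blast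
    then obtain x where x: "x \<in> Lat \<alpha> C" "\<And>i. x \<bullet> \<beta> i = of_bool (i \<in> supp d)"
      using B.Lat_word eq by metis
    then obtain z where z: "\<And>i. x \<bullet> \<alpha> i = of_int (z i)" "word z \<in> C"
      by (metis LatE)
    have "word z = (\<chi> i. word (\<lambda>i. of_bool (i \<in> supp d)) $ \<pi> i)"
      by (rule key) (use x z in auto)
    then show "c \<in> C"
      using z(2) d by (simp add: word_of_bool del: word_nth)
  qed
  then show ?thesis
    using perm by (auto simp: equivalent_codes_def)
qed

lemma Lat_iso_of_equivalent:
  fixes \<alpha> :: "'n::finite \<Rightarrow> real ^ 'n"
  assumes \<alpha>: "frame \<alpha>" and "equivalent_codes C D"
  shows "lattice_iso (Lat \<alpha> C) (Lat \<alpha> D)"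
proof -
  obtain \<pi> where \<pi>: "\<pi> permutes UNIV" "D = (\<lambda>c. \<chi> i. c $ \<pi> i) ` C"
    using assms by (auto simp: equivalent_codes_def)
  \<comment> \<open>With the inverse permutation, coordinate \<open>\<pi> i\<close> with respect to
    \<open>\<beta>\<close> is coordinate \<open>i\<close> with respect to
    \<open>\<alpha>\<close>.\<close>
  define \<beta> where "\<beta> i = \<alpha> (inv \<pi> i)" for i
  have "frame \<beta>"
    using \<alpha> permutes_inj[OF permutes_inv[OF \<pi>(1)]] by (simp add: frame_def \<beta>_def inj_eq)
  then obtain f where f: "orthogonal_transformation f" "\<And>i. f (\<alpha> i) = \<beta> i"
    using frame_iso[OF \<alpha>] by metis
  have word: "word (\<lambda>i. z (\<pi> i)) \<in> D \<longleftrightarrow> word z \<in> C" for z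
  proof -
    have inj: "inj (\<lambda>c :: bit ^ 'n. \<chi> i. c $ \<pi> i)"
      by (rule injI) (simp add: vec_eq_iff, metis permutes_inverses(1)[OF \<pi>(1)])
    have "word (\<lambda>i. z (\<pi> i)) = (\<chi> i. word z $ \<pi> i)"
      by (simp add: vec_eq_iff)
    then show ?thesis
      unfolding \<pi>(2) using inj_image_mem_iff[OF inj, of "word z" C] by simp
  qed
  have sum: "(\<Sum>i\<in>UNIV. z (\<pi> i)) = sum z UNIV" for z :: "'n \<Rightarrow> int"
    using sum.permute[OF \<pi>(1), of z] by (simp add: o_def)
  have "Lat \<beta> C = Lat \<alpha> D"
  proof (intro equalityI subsetI)
    fix x assume "x \<in> Lat \<beta> C"
    then obtain z where z: "\<And>i. x \<bullet> \<beta> i = of_int (z i)" "word z \<in> C" "4 dvd sum z UNIV"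
      by (metis LatE)
    show "x \<in> Lat \<alpha> D"
    proof (rule LatI)
      show "x \<bullet> \<alpha> i = of_int (z (\<pi> i))" for i
        using z(1)[of "\<pi> i"] by (simp add: \<beta>_def permutes_inverses[OF \<pi>(1)])
    qed (use z word sum in auto)
  next
    fix x assume "x \<in> Lat \<alpha> D"
    then obtain z where z: "\<And>i. x \<bullet> \<alpha> i = of_int (z i)" "word z \<in> D" "4 dvd sum z UNIV"
      by (metis LatE)
    show "x \<in> Lat \<beta> C"
    proof (rule LatI)
      show "x \<bullet> \<beta> i = of_int (z (inv \<pi> i))" for i
        using z(1) by (simp add: \<beta>_def)
      show "word (\<lambda>i. z (inv \<pi> i)) \<in> C" "4 dvd (\<Sum>i\<in>UNIV. z (inv \<pi> i))"
        using z word[of "\<lambda>i. z (inv \<pi> i)"] sum[of "\<lambda>i. z (inv \<pi> i)"]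
        by (simp_all add: permutes_inverses[OF \<pi>(1)])
    qed
  qed
  then show ?thesis
    unfolding lattice_iso_def using f Lat_orthogonal_transformation[OF f(1), of \<alpha> C] by auto
qed

text \<open>The frame coordinates of a norm 2 vector have square sum 4. If integral, they describe
  plus or minus a frame vector or half a signed sum of four of them.\<close>

lemma sum_squares_eq_4:
  fixes z :: "'n::finite \<Rightarrow> int"
  assumes "(\<Sum>i\<in>UNIV. (z i)\<^sup>2) = 4"
  obtains (two) i where "\<bar>z i\<bar> = 2" | (one) "\<And>i. \<bar>z i\<bar> \<le> 1" "card {i. z i \<noteq> 0} = 4"
proof (cases "\<exists>i. \<bar>z i\<bar> = 2")
  case True
  then show thesis using two by blast
next
  case False
  have "\<bar>z i\<bar> \<le> 1" for i
  proof -
    have "(z i)\<^sup>2 \<le> 4"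
      unfolding assms[symmetric] by (rule member_le_sum) auto
    then have "\<bar>z i\<bar> \<le> 2"
      by (intro power2_le_imp_le[of "\<bar>z i\<bar>" 2]) auto
    then show ?thesis using False by (metis int_one_le_iff_zero_less le_less not_le zle_add1_eq_le one_add_one)
  qed
  note le = this
  have "(z i)\<^sup>2 = of_bool (z i \<noteq> 0)" for i
  proof -
    have "z i = 0 \<or> z i = 1 \<or> z i = -1" using le[of i] by linarith
    then show ?thesis by auto
  qed
  then have "int (card {i. z i \<noteq> 0}) = 4"
    using assms by (simp flip: sum.inter_filter)
  then show thesis using one le by auto
qed

section \<open>Reflections and frames in one coset\<close>

definition reflection :: "'a::real_inner \<Rightarrow> 'a \<Rightarrow> 'a" where
  "reflection g x = x - (2 * (x \<bullet> g) / (g \<bullet> g)) *\<^sub>R g"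

lemma orthogonal_transformation_reflection:
  fixes g :: "'a::real_inner"
  assumes "g \<bullet> g \<noteq> 0"
  shows "orthogonal_transformation (reflection g)"
  unfolding orthogonal_transformation_def
proof (intro conjI allI)
  show "linear (reflection g)"
    by (rule linearI) (simp_all add: reflection_def inner_add_left algebra_simps add_divide_distrib)
  show "reflection g v \<bullet> reflection g w = v \<bullet> w" for v w
    using assms by (simp add: reflection_def inner_diff_left inner_diff_right inner_commute field_simps)
qed

lemma reflection_involution: "g \<bullet> g \<noteq> 0 \<Longrightarrow> reflection g (reflection g x) = x"
  by (simp add: reflection_def inner_diff_left field_simps flip: scaleR_add_left)

lemma framed_code_orthogonal_transformation:
  "framed_code \<alpha> C \<Longrightarrow> orthogonal_transformation f \<Longrightarrow> framed_code (\<lambda>i. f (\<alpha> i)) C"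
  by (simp add: framed_code_def frame_orthogonal_transformation)

context framed_code
begin

text \<open>Asking only that the displacements lie in \<open>L\<close> covers both norm 2 vectors of
  \<open>L\<close> and norm 1 vectors \<open>g\<close> with \<open>2 *\<^sub>R g\<close> in
  \<open>L\<close>.\<close>

lemma reflection_Lat:
  assumes g: "g \<bullet> g \<noteq> 0" and inv: "\<And>x. x \<in> L \<Longrightarrow> (2 * (x \<bullet> g) / (g \<bullet> g)) *\<^sub>R g \<in> L"
  shows "framed_code (\<lambda>i. reflection g (\<alpha> i)) C" "Lat (\<lambda>i. reflection g (\<alpha> i)) C = L"
proof -
  show "framed_code (\<lambda>i. reflection g (\<alpha> i)) C"
    by (rule framed_code_orthogonal_transformation[OF framed_code_axioms orthogonal_transformation_reflection[OF g]])
  have "reflection g x \<in> L" if "x \<in> L" for x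
    using that inv[OF that] by (simp add: reflection_def Lat_diff)
  then have "reflection g ` L = L"
    using reflection_involution[OF g] by (metis image_iff image_subsetI subsetI subset_antisym)
  then show "Lat (\<lambda>i. reflection g (\<alpha> i)) C = L"
    using Lat_orthogonal_transformation[OF orthogonal_transformation_reflection[OF g]] by metis
qed

lemma coset_frame_Ints:
  assumes "p - \<alpha> j \<in> L"
  shows "p \<bullet> \<alpha> i \<in> \<int>"
proof -
  have "(p - \<alpha> j) \<bullet> \<alpha> i + \<alpha> j \<bullet> \<alpha> i \<in> \<int>"
    using Lat_frame_Ints[OF assms] by (intro Ints_add) (auto simp: frame_inner[OF frame])
  then show ?thesis by (simp add: inner_diff_left)
qed

lemma Ints_coords:
  assumes "\<And>i. p \<bullet> \<alpha> i \<in> \<int>"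
  obtains z where "\<And>i. p \<bullet> \<alpha> i = of_int (z i)"
proof -
  have "\<forall>i. \<exists>k. p \<bullet> \<alpha> i = of_int k"
    using assms by (auto elim: Ints_cases)
  then show thesis
    using that by (auto dest: choice)
qed

lemma coords_norm:
  assumes "\<And>i. p \<bullet> \<alpha> i = of_int (z i)" "p \<bullet> p = 2"
  shows "(\<Sum>i\<in>UNIV. (z i)\<^sup>2) = 4"
proof -
  have "(\<Sum>i\<in>UNIV. (of_int (z i))\<^sup>2) = (4::real)"
    using frame_inner_eq[OF frame, of p p] assms by (simp add: power2_eq_square)
  then have "real_of_int (\<Sum>i\<in>UNIV. (z i)\<^sup>2) = real_of_int 4"
    by simp
  then show ?thesis
    by (simp only: of_int_eq_iff)
qed

text \<open>Equality case of Cauchy-Schwarz for two vectors of norm 2.\<close>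

lemma coord_two:
  assumes "p \<bullet> p = 2" "\<bar>p \<bullet> \<alpha> i\<bar> = 2"
  shows "p = \<alpha> i \<or> p = - \<alpha> i"
proof -
  have "(p - \<alpha> i) \<bullet> (p - \<alpha> i) = 4 - 2 * (p \<bullet> \<alpha> i)" "(p + \<alpha> i) \<bullet> (p + \<alpha> i) = 4 + 2 * (p \<bullet> \<alpha> i)"
    using assms(1) frame_inner[OF frame, of i i]
    by (simp_all add: inner_diff_left inner_diff_right inner_add_left inner_add_right inner_commute)
  then have "(p - \<alpha> i) \<bullet> (p - \<alpha> i) = 0 \<or> (p + \<alpha> i) \<bullet> (p + \<alpha> i) = 0"
    using assms(2) by linarith
  then show ?thesis by (auto simp: add_eq_0_iff2 add_eq_0_iff)
qed

text \<open>If \<open>p\<close> lies in the coset of the frame but not in the frame itself, then \<open>p \<bullet> \<beta> j = \<plusminus>1\<close> for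
  some \<open>j\<close>, and the root \<open>p \<mp> \<beta> j\<close> belongs to the lattice. Its reflection brings \<open>\<plusminus>p\<close> into the
  frame and fixes every frame vector orthogonal to \<open>p\<close>.\<close>

lemma frame_through:
  assumes "finite P" "\<And>p. p \<in> P \<Longrightarrow> p \<bullet> p = 2 \<and> p - \<alpha> j0 \<in> L"
    and "\<And>p q. p \<in> P \<Longrightarrow> q \<in> P \<Longrightarrow> p \<noteq> q \<Longrightarrow> p \<bullet> q = 0"
  shows "\<exists>\<beta>. framed_code \<beta> C \<and> Lat \<beta> C = L \<and> (\<forall>j. \<beta> j - \<alpha> j0 \<in> L) \<and>
    (\<forall>p\<in>P. \<exists>j. p = \<beta> j \<or> p = - \<beta> j)"
  using assms
proof (induction P)
  case empty
  show ?case
    using framed_code_axioms Lat_frame_diff by blast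
next
  case (insert p P)
  then obtain \<beta> where \<beta>: "framed_code \<beta> C" "Lat \<beta> C = L" "\<And>j. \<beta> j - \<alpha> j0 \<in> L"
    and P: "\<And>p. p \<in> P \<Longrightarrow> \<exists>j. p = \<beta> j \<or> p = - \<beta> j"
    by (metis insertI2)
  interpret B: framed_code \<beta> C by fact
  have p: "p \<bullet> p = 2" "p - \<alpha> j0 \<in> L"
    using insert.prems(1) by auto
  have p\<beta>: "p - \<beta> j \<in> L" for j
    using Lat_diff_trans[OF p(2), of "\<beta> j"] \<beta>(3)[of j] by (metis Lat_diff_commute)
  obtain z where z: "\<And>i. p \<bullet> \<beta> i = of_int (z i)"
    using B.Ints_coords B.coset_frame_Ints p\<beta> \<beta>(2) by metis
  have sum4: "(\<Sum>i\<in>UNIV. (z i)\<^sup>2) = 4"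
    by (rule B.coords_norm[OF z p(1)])
  then show ?case
  proof (cases rule: sum_squares_eq_4)
    case (two i)
    then have "\<bar>p \<bullet> \<beta> i\<bar> = 2"
      by (simp add: z)
    then show ?thesis
      using B.coord_two[OF p(1)] P \<beta> by (metis insertE)
  next
    case one
    obtain j where "z j \<noteq> 0"
      using one(2) by (metis (mono_tags, lifting) card.empty empty_Collect_eq zero_neq_numeral)
    then have e: "z j = 1 \<or> z j = -1"
      using one(1)[of j] by linarith
    define e :: real where "e = of_int (z j)"
    have e: "e = 1 \<or> e = -1" "e * e = 1"
      using e by (auto simp: e_def)
    have pj: "p \<bullet> \<beta> j = e"
      by (simp add: z e_def)
    have jj: "\<beta> j \<bullet> \<beta> j = 2"
      by (simp add: frame_inner[OF B.frame])
    define g where "g = p - e *\<^sub>R \<beta> j"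
    have gg: "g \<bullet> g = 2"
      using e p(1) pj jj by (auto simp: g_def inner_diff_left inner_diff_right inner_commute)
    have "g \<in> L"
    proof (cases "e = 1")
      case False
      have "(p - \<beta> j) + 2 *\<^sub>R \<beta> j \<in> L"
        using p\<beta> B.Lat_frame_double \<beta>(2) by (auto intro: Lat_add)
      then show ?thesis using False e by (simp add: g_def scaleR_2 add.commute)
    qed (use p\<beta> in \<open>simp add: g_def\<close>)
    have inv: "(2 * (x \<bullet> g) / (g \<bullet> g)) *\<^sub>R g \<in> Lat \<beta> C" if "x \<in> Lat \<beta> C" for x
      using that \<open>g \<in> L\<close> by (simp add: gg \<beta>(2) Lat_scale_Ints Lat_inner_Ints)
    note new = B.reflection_Lat[OF _ inv]
    show ?thesis
    proof (intro exI[of _ "\<lambda>i. reflection g (\<beta> i)"] conjI allI ballI)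
      show "framed_code (\<lambda>i. reflection g (\<beta> i)) C" "Lat (\<lambda>i. reflection g (\<beta> i)) C = L"
        using new \<beta>(2) gg by auto
      fix k
      have "g \<bullet> \<beta> k \<in> \<int>"
        using \<open>g \<in> L\<close> B.Lat_frame_Ints \<beta>(2) by simp
      then have "(\<beta> k \<bullet> g) *\<^sub>R g \<in> L"
        using \<open>g \<in> L\<close> by (simp add: Lat_scale_Ints inner_commute)
      then have "(\<beta> k - \<alpha> j0) - (\<beta> k \<bullet> g) *\<^sub>R g \<in> L"
        using Lat_diff[OF \<beta>(3)] by blast
      then show "reflection g (\<beta> k) - \<alpha> j0 \<in> L"
        by (simp add: reflection_def gg algebra_simps)
    next
      fix q assume "q \<in> insert p P"
      then consider "q = p" | "q \<in> P" "q \<noteq> p" using insert.hyps by auto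
      then show "\<exists>i. q = reflection g (\<beta> i) \<or> q = - reflection g (\<beta> i)"
      proof cases
        case 1
        have "reflection g (\<beta> j) = e *\<^sub>R p"
        proof -
          have "\<beta> j \<bullet> g = - e"
            using pj jj by (simp add: g_def inner_diff_right inner_commute)
          then have "reflection g (\<beta> j) = \<beta> j + e *\<^sub>R g"
            by (simp add: reflection_def gg)
          then show ?thesis
            by (simp add: g_def scaleR_diff_right e(2))
        qed
        then show ?thesis
          using 1 e by (intro exI[of _ j]) auto
      next
        case 2
        then obtain k where k: "q = \<beta> k \<or> q = - \<beta> k" using P by blast
        have pq: "q \<bullet> p = 0"
          using 2 insert.prems(2) by blast
        have "j \<noteq> k"
          using pq pj k e by (auto simp: inner_commute)
        then have "\<beta> k \<bullet> g = 0"
          using pq k by (auto simp: g_def inner_diff_right frame_inner[OF B.frame])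
        then have "reflection g (\<beta> k) = \<beta> k"
          by (simp add: reflection_def)
        then show ?thesis using k by metis
      qed
    qed
  qed
qed

end

lemma equivalent_of_same_coset:
  assumes A: "framed_code \<alpha> C" and B: "framed_code \<beta> D" and eq: "Lat \<alpha> C = Lat \<beta> D"
    and coset: "\<alpha> i - \<beta> j \<in> Lat \<alpha> C"
  shows "equivalent_codes C D"
proof -
  interpret A: framed_code \<alpha> C by fact
  interpret B: framed_code \<beta> D by fact
  have "\<exists>\<beta>'. framed_code \<beta>' D \<and> Lat \<beta>' D = Lat \<beta> D \<and> (\<forall>k. \<beta>' k - \<beta> j \<in> Lat \<beta> D) \<and>
    (\<forall>p\<in>range \<alpha>. \<exists>k. p = \<beta>' k \<or> p = - \<beta>' k)"
  proof (rule B.frame_through)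
    show "p \<bullet> p = 2 \<and> p - \<beta> j \<in> Lat \<beta> D" if "p \<in> range \<alpha>" for p
      using that A.Lat_diff_trans[OF A.Lat_frame_diff coset] by (auto simp: frame_inner[OF A.frame] eq)
  qed (auto simp: frame_inner[OF A.frame])
  then obtain \<beta>' where "framed_code \<beta>' D" "Lat \<alpha> C = Lat \<beta>' D" "\<And>i. \<exists>k. \<alpha> i = \<beta>' k \<or> \<alpha> i = - \<beta>' k"
    using eq by (metis rangeI)
  from equivalent_of_signed_frames[OF A this] show ?thesis
    by (rule equivalent_codes_sym)
qed

section \<open>Switching along blocks of four coordinates\<close>

lemma sum_sg: "(\<Sum>k\<in>A. sg (c $ k)) = int (card A) - 2 * int (card (A \<inter> supp c))" for c :: "bit ^ 'n::finite"
proof -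
  have "(\<Sum>k\<in>A. sg (c $ k)) = (\<Sum>k\<in>A. 1 - 2 * (if k \<in> supp c then 1 else 0) :: int)"
    by (intro sum.cong) (auto simp: mem_supp sg_of_bool)
  also have "\<dots> = int (card A) - 2 * int (card (A \<inter> supp c))"
    unfolding sum_subtractf sum_distrib_left[symmetric]
    by (simp add: Int_def flip: sum.inter_filter)
  finally show ?thesis .
qed

text \<open>\<open>s\<close> assigns to each coordinate its block. All blocks lie in one coset of
  \<open>C\<close> inside the dual code: duality makes the products of lattice vectors with
  \<open>glue\<close> integral, and since two blocks sum to a word of \<open>C\<close>, blocks may
  be altered in pairs. The dual word \<open>J\<close> supplies the signs.\<close>

locale block_system = framed_code \<alpha> C
  for \<alpha> :: "'n::finite \<Rightarrow> real ^ 'n" and C :: "(bit ^ 'n) set" +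
  fixes s :: "'n \<Rightarrow> 'n set" and J :: "bit ^ 'n"
  assumes block_self: "i \<in> s i"
    and block_eq: "j \<in> s i \<Longrightarrow> s j = s i"
    and block_card: "card (s i) = 4"
    and block_dual: "ind (s i) \<in> dual_code C"
    and block_add: "ind (s i) + ind (s j) \<in> C"
    and sign_dual: "J \<in> dual_code C"
begin

definition glue :: "'n \<Rightarrow> real ^ 'n" where
  "glue i = (\<Sum>k\<in>s i. (sg (J $ k) / 2) *\<^sub>R \<alpha> k)"

text \<open>\<open>switch\<close> is the image of \<open>\<alpha>\<close> under the product of the reflections in the pairwise orthogonal
  norm 2 vectors \<open>glue i\<close>, one for each block.\<close>

definition switch :: "'n \<Rightarrow> real ^ 'n" where
  "switch i = \<alpha> i - sg (J $ i) *\<^sub>R glue i"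

lemma mem_block_iff: "j \<in> s i \<longleftrightarrow> s j = s i"
  using block_self block_eq by metis

lemma glue_inner_frame: "glue i \<bullet> \<alpha> k = (if k \<in> s i then sg (J $ k) else 0)"
  unfolding glue_def frame_sum_inner[OF frame] by simp

lemma inner_glue: "x \<bullet> glue i = (\<Sum>k\<in>s i. sg (J $ k) * (x \<bullet> \<alpha> k)) / 2"
  by (simp add: glue_def inner_sum_right sum_divide_distrib)

lemma glue_inner_glue: "glue i \<bullet> glue j = (if s i = s j then 2 else 0)"
proof -
  have "glue i \<bullet> glue j = (\<Sum>k\<in>s j. if s i = s j then 1 else 0) / 2"
    unfolding inner_glue
    by (intro arg_cong[where f = "\<lambda>x. x / 2"] sum.cong refl) (auto simp: glue_inner_frame mem_block_iff)
  then show ?thesis by (simp add: block_card)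
qed

lemma glue_block: "s i = s j \<Longrightarrow> glue i = glue j"
  by (simp add: glue_def)

lemma switch_inner: "x \<bullet> switch i = x \<bullet> \<alpha> i - sg (J $ i) * (x \<bullet> glue i)"
  by (simp add: switch_def inner_diff_right)

lemma frame_switch: "frame switch"
  unfolding frame_def
proof (intro allI)
  fix i j
  show "switch i \<bullet> switch j = (if i = j then 2 else 0)"
    unfolding switch_inner
    using mem_block_iff[of i j] mem_block_iff[of j i]
    by (auto simp: inner_commute[of "switch i"] switch_inner frame_inner[OF frame]
        glue_inner_frame glue_inner_glue inner_commute[of "\<alpha> _" "glue _"] algebra_simps)
qed

lemma framed_switch: "framed_code switch C"
  using frame_switch subspace doubly_even by unfold_locales

lemma block_system_switch: "block_system switch C s J"
  by (intro block_system.intro framed_switch block_system_axioms.intro)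
    (use block_self block_eq block_card block_dual block_add sign_dual in auto)

text \<open>A reflection negates its own root. Switching twice thus restores the frame, so a single
  inclusion between the lattices yields equality.\<close>

lemma glue_switch: "block_system.glue switch s J i = - glue i"
proof -
  interpret S: block_system switch C s J by (rule block_system_switch)
  have "S.glue i = (\<Sum>k\<in>s i. (sg (J $ k) / 2) *\<^sub>R \<alpha> k - (1/2) *\<^sub>R glue i)"
    unfolding S.glue_def
  proof (intro sum.cong refl)
    fix k assume "k \<in> s i"
    then have "glue k = glue i" by (intro glue_block block_eq)
    then show "(sg (J $ k) / 2) *\<^sub>R switch k = (sg (J $ k) / 2) *\<^sub>R \<alpha> k - (1/2) *\<^sub>R glue i"
      by (simp add: switch_def scaleR_diff_right)
  qed
  also have "\<dots> = glue i - (\<Sum>k\<in>s i. (1/2) *\<^sub>R glue i)"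
    unfolding sum_subtractf by (simp only: glue_def)
  also have "(\<Sum>k\<in>s i. (1/2) *\<^sub>R glue i) = 2 *\<^sub>R glue i"
    unfolding sum_constant_scaleR block_card by simp
  finally show ?thesis by (simp add: scaleR_2)
qed

lemma switch_switch: "block_system.switch switch s J i = \<alpha> i"
proof -
  interpret S: block_system switch C s J by (rule block_system_switch)
  show ?thesis
    unfolding S.switch_def glue_switch by (simp add: switch_def)
qed

lemma sum_blocks:
  fixes f :: "'n \<Rightarrow> 'a::comm_monoid_add"
  shows "sum f UNIV = (\<Sum>B\<in>range s. sum f B)"
proof -
  have "sum f UNIV = (\<Sum>B\<in>range s. sum f {i \<in> UNIV. s i = B})"
    by (rule sum.image_gen) simp
  also have "\<dots> = (\<Sum>B\<in>range s. sum f B)"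
  proof (intro sum.cong[OF refl])
    fix B assume "B \<in> range s"
    then obtain j where "B = s j" by blast
    then have "{i \<in> UNIV. s i = B} = B" using mem_block_iff by blast
    then show "sum f {i \<in> UNIV. s i = B} = sum f B" by simp
  qed
  finally show ?thesis .
qed

text \<open>The product of \<open>x\<close> with the glue vector of a block is the integer
  \<open>M\<close>, so the new coordinates are \<open>z i - t i * M (s i)\<close>. The total of
  \<open>M\<close> over the blocks is even because \<open>J\<close> is dual to \<open>C\<close> and
  4 divides \<open>sum z UNIV\<close>. Hence the blocks with odd \<open>M\<close> are even in number
  and together form a word of \<open>C\<close>; the same evenness controls the new coordinate
  sum.\<close>

lemma Lat_subset_switch: "L \<subseteq> Lat switch C"
proof
  fix x assume "x \<in> L"
  then obtain z where z: "\<And>i. x \<bullet> \<alpha> i = of_int (z i)" "word z \<in> C" "4 dvd sum z UNIV"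
    by (metis LatE)
  define t :: "'n \<Rightarrow> int" where "t k = sg (J $ k)" for k
  define M where "M B = (\<Sum>k\<in>B. t k * z k) div 2" for B
  define e where "e B = sum t B" for B
  have t: "t k = 1 \<or> t k = -1" for k
    by (simp add: t_def sg_def)
  have rt: "sg (J $ k) = real_of_int (t k)" for k
    by (simp add: t_def sg_def)
  have oddt: "odd (t k)" for k
    using t[of k] by auto
  have "even (\<Sum>k\<in>s i. z k)" for i
    using dual_code_even[OF block_dual z(2)] by blast
  then have "even (\<Sum>k\<in>s i. t k * z k)" for i
    using oddt by (simp add: even_sum_iff)
  then have M: "(\<Sum>k\<in>s i. t k * z k) = 2 * M (s i)" for i
    by (simp add: M_def)
  have coord: "x \<bullet> switch i = of_int (z i - t i * M (s i))" for i
  proof -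
    have "(\<Sum>k\<in>s i. t k * (x \<bullet> \<alpha> k)) = real_of_int (\<Sum>k\<in>s i. t k * z k)"
      by (simp add: z(1))
    then show ?thesis
      unfolding switch_inner inner_glue rt M by (simp add: z(1))
  qed
  have "2 * sum M (range s) = (\<Sum>k\<in>UNIV. t k * z k)"
    unfolding sum_blocks[of "\<lambda>k. t k * z k"] sum_distrib_left
    by (intro sum.cong refl) (auto simp: M)
  also have "\<dots> = (\<Sum>k\<in>UNIV. z k - 2 * (if k \<in> supp J then z k else 0))"
    by (intro sum.cong) (auto simp: t_def sg_of_bool mem_supp)
  also have "\<dots> = sum z UNIV - 2 * sum z (supp J)"
    unfolding sum_subtractf sum_distrib_left[symmetric] by (simp flip: sum.inter_filter)
  finally have "2 * sum M (range s) = sum z UNIV - 2 * sum z (supp J)" .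
  moreover have "even (sum z (supp J))"
    using dual_code_even[of "supp J" C z] sign_dual z(2) by simp
  ultimately have evM: "even (sum M (range s))"
    using z(3) by presburger
  obtain i0 :: 'n where True by simp
  \<comment> \<open>Adding \<open>ind (s i0)\<close> to every block changes nothing, as the total of
    \<open>M\<close> is even, and turns each summand into a word of \<open>C\<close>.\<close>
  have word: "word (\<lambda>i. M (s i)) = (\<Sum>B\<in>range s. of_int (M B) *s (ind B + ind (s i0)))"
  proof -
    have "(\<Sum>B\<in>range s. of_int (M B) * (of_bool (j \<in> B) + of_bool (j \<in> s i0))) = (of_int (M (s j)) :: bit)" for j
    proof -
      have "(\<Sum>B\<in>range s. of_int (M B) * (of_bool (j \<in> B) :: bit)) = (\<Sum>B\<in>range s. if B = s j then of_int (M (s j)) else 0)"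
        by (intro sum.cong refl) (auto simp: mem_block_iff)
      moreover have "(\<Sum>B\<in>range s. of_int (M B) * (of_bool (j \<in> s i0) :: bit)) = of_int (sum M (range s)) * of_bool (j \<in> s i0)"
        by (simp only: of_int_sum sum_distrib_right)
      ultimately show ?thesis
        using evM by (simp only: distrib_left sum.distrib bit_of_int) simp
    qed
    then show ?thesis
      by (simp only: vec_eq_iff sum_component vector_smult_component vector_add_component ind_nth) (simp add: word_def)
  qed
  have "word (\<lambda>i. M (s i)) \<in> C"
    unfolding word by (intro vec.subspace_sum[OF subspace] vec.subspace_scale[OF subspace]) (auto intro: block_add)
  moreover have "word (\<lambda>i. z i - t i * M (s i)) = word z + word (\<lambda>i. M (s i))"
    unfolding word_add[symmetric] word_eq_iff using oddt by simp
  ultimately have C: "word (\<lambda>i. z i - t i * M (s i)) \<in> C"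
    using code_subspace_add[OF subspace z(2)] by simp
  have e: "e (s i) = 4 - 2 * int (card (s i \<inter> supp J))" for i
    by (simp add: e_def t_def sum_sg block_card)
  \<comment> \<open>All block sign sums agree modulo 4, so the change of the coordinate sum reduces
    to \<open>sum M (range s) * e (s i0)\<close>, a product of two even numbers.\<close>
  have "4 dvd e (s i) - e (s i0)" for i
  proof -
    have "code_inner (ind (s i)) J + code_inner (ind (s i0)) J = 0"
      using dual_codeD[OF sign_dual block_add[of i i0]] by (simp only: code_inner_commute[of J] code_inner_add_left)
    then have "even (card (s i \<inter> supp J)) = even (card (s i0 \<inter> supp J))"
      by (simp add: code_inner_card bit_add_eq_0_iff split: if_splits)
    then show ?thesis unfolding e by presburger
  qed
  then have "4 dvd (\<Sum>B\<in>range s. M B * (e B - e (s i0)))"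
    by (intro dvd_sum) auto
  moreover have "4 dvd sum M (range s) * e (s i0)"
    using evM e[of i0] mult_dvd_mono[of 2 "sum M (range s)" 2 "e (s i0)"] by simp
  ultimately have "4 dvd (\<Sum>B\<in>range s. M B * e B)"
    by (simp add: right_diff_distrib sum_subtractf sum_distrib_right dvd_diff_left_iff)
  also have "(\<Sum>B\<in>range s. M B * e B) = (\<Sum>i\<in>UNIV. t i * M (s i))"
    unfolding sum_blocks[of "\<lambda>i. t i * M (s i)"] e_def sum_distrib_left
    by (intro sum.cong refl) (auto simp: mem_block_iff)
  finally have "4 dvd (\<Sum>i\<in>UNIV. z i - t i * M (s i))"
    using z(3) by (simp add: sum_subtractf)
  with coord C show "x \<in> Lat switch C"
    by (rule LatI)
qed

lemma Lat_switch: "Lat switch C = L"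
proof
  interpret S: block_system switch C s J by (rule block_system_switch)
  have "S.switch = \<alpha>"
    using switch_switch by blast
  then show "Lat switch C \<subseteq> L"
    using S.Lat_subset_switch by simp
qed (rule Lat_subset_switch)

end

section \<open>Frames with integral inner products\<close>

lemma card_4_elements:
  assumes "card B = 4"
  obtains a b c d where "B = {a, b, c, d}" "distinct [a, b, c, d]"
proof -
  have "finite B" using assms by (simp add: card_ge_0_finite)
  then obtain xs where xs: "set xs = B" "distinct xs"
    using finite_distinct_list by blast
  then have "length xs = 4"
    using assms distinct_card by metis
  then obtain a b c d where "xs = [a, b, c, d]"
    by (auto simp: numeral_eq_Suc length_Suc_conv)
  then show thesis using that xs by (metis list.set(1,2))
qed

context framed_code
begin

text \<open>The sign patterns of \<open>p1\<close> to \<open>p4\<close> are the rows of a Hadamard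
  matrix of order 4. So these vectors span the same space as the frame vectors over
  \<open>B\<close>, and each differs from \<open>y\<close> by a sum of two signed frame vectors,
  which lies in \<open>L\<close>.\<close>

lemma four_orthogonal:
  assumes y: "\<And>i. i \<in> B \<Longrightarrow> \<bar>y \<bullet> \<alpha> i\<bar> = 1" "\<And>i. i \<notin> B \<Longrightarrow> y \<bullet> \<alpha> i = 0" and B: "card B = 4"
  shows "\<exists>P. finite P \<and> (\<forall>p\<in>P. p \<bullet> p = 2 \<and> p - y \<in> L \<and> (\<forall>i. i \<notin> B \<longrightarrow> p \<bullet> \<alpha> i = 0)) \<and>
    (\<forall>p\<in>P. \<forall>q\<in>P. p \<noteq> q \<longrightarrow> p \<bullet> q = 0) \<and> (\<forall>w. (\<forall>p\<in>P. w \<bullet> p = 0) \<longrightarrow> (\<forall>i\<in>B. w \<bullet> \<alpha> i = 0))"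
proof -
  obtain a b c d where abcd: "B = {a, b, c, d}" "distinct [a, b, c, d]"
    using card_4_elements[OF B] .
  define e where "e k = (y \<bullet> \<alpha> k) *\<^sub>R \<alpha> k" for k
  have pm: "y \<bullet> \<alpha> k = 1 \<or> y \<bullet> \<alpha> k = -1" if "k \<in> B" for k
    using y(1)[OF that] by linarith
  have sign_vec: "e k \<bullet> e l = (if k = l then 2 else 0)" if "k \<in> B" "l \<in> B" for k l
    using pm[OF that(1)] by (auto simp: e_def frame_inner[OF frame])
  have e\<alpha>: "e k \<bullet> \<alpha> i = 0" if "k \<in> B" "i \<notin> B" for k i
    using that by (auto simp: e_def frame_inner[OF frame])
  have eL: "e k + e l \<in> L" "e k - e l \<in> L" if "k \<in> B" "l \<in> B" for k l
    using pm[OF that(1)] pm[OF that(2)] Lat_frame_add[of k l] Lat_frame_diff[of k l] Lat_frame_diff[of l k]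
      Lat_uminus_iff[of "\<alpha> k + \<alpha> l"]
    by (auto simp: e_def algebra_simps simp del: Lat_uminus_iff)
  define p1 p2 p3 p4 where p: "p1 = (1/2) *\<^sub>R (e a + e b + e c + e d)" "p2 = (1/2) *\<^sub>R (e a + e b - e c - e d)"
    "p3 = (1/2) *\<^sub>R (e a - e b + e c - e d)" "p4 = (1/2) *\<^sub>R (e a - e b - e c + e d)"
  have yp: "y = p1"
    by (rule frame_eqI[OF frame])
      (use abcd y(2) in \<open>auto simp: p e_def frame_inner[OF frame] inner_add_left\<close>)
  have *: "p2 - y = - (e c + e d)" "p3 - y = - (e b + e d)" "p4 - y = - (e b + e c)"
    by (simp_all add: yp p vec_eq_iff field_simps)
  have in_L: "p2 - y \<in> L" "p3 - y \<in> L" "p4 - y \<in> L"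
    unfolding * Lat_uminus_iff using eL abcd(1) by auto
  note expand = p inner_add_left inner_add_right inner_diff_left inner_diff_right sign_vec
  show ?thesis
  proof (intro exI[of _ "{p1, p2, p3, p4}"] conjI ballI allI impI)
    show "finite {p1, p2, p3, p4}" by simp
    show "q \<bullet> q = 2" "q - y \<in> L" if "q \<in> {p1, p2, p3, p4}" for q
      using that in_L yp abcd by (auto simp: expand)
    show "q \<bullet> \<alpha> i = 0" if "q \<in> {p1, p2, p3, p4}" "i \<notin> B" for q i
      using that abcd by (auto simp: expand e\<alpha>)
    show "q \<bullet> r = 0" if "q \<in> {p1, p2, p3, p4}" "r \<in> {p1, p2, p3, p4}" "q \<noteq> r" for q r
      using that abcd by (auto simp: expand)
    show "w \<bullet> \<alpha> i = 0" if w: "\<forall>p\<in>{p1, p2, p3, p4}. w \<bullet> p = 0" and i: "i \<in> B" for w i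
    proof -
      have "w \<bullet> p1 = 0" "w \<bullet> p2 = 0" "w \<bullet> p3 = 0" "w \<bullet> p4 = 0"
        using w by auto
      then have "w \<bullet> e a = 0" "w \<bullet> e b = 0" "w \<bullet> e c = 0" "w \<bullet> e d = 0"
        unfolding p by (simp_all add: inner_add_right inner_diff_right)
      then have "w \<bullet> e i = 0"
        using i abcd by auto
      then show ?thesis
        using pm[OF i] by (auto simp: e_def)
    qed
  qed
qed

end

text \<open>If the two frames lie in different cosets, every norm 2
  vector of the coset of \<open>\<beta>\<close> is half a signed sum of four frame vectors \<open>\<alpha> i\<close>, and the index set can
  be partitioned into supports of such vectors. Switching \<open>\<alpha>\<close> along this partition yields a frame
  in the coset of \<open>\<beta>\<close> with the same code.\<close>

lemma equivalent_of_integral: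
  fixes \<alpha> \<beta> :: "'n::finite \<Rightarrow> real ^ 'n"
  assumes A: "framed_code \<alpha> C" and B: "framed_code \<beta> D" and eq: "Lat \<alpha> C = Lat \<beta> D"
    and int: "\<And>i j. \<alpha> i \<bullet> \<beta> j \<in> \<int>"
  shows "equivalent_codes C D"
\<comment> \<open>\<open>undefined\<close> is an arbitrary coordinate; the vectors of
  \<open>\<beta>\<close> share a coset, so the choice is immaterial.\<close>
proof (cases "\<exists>i. \<alpha> i - \<beta> undefined \<in> Lat \<alpha> C")
  case True
  then show ?thesis
    using equivalent_of_same_coset[OF A B eq] by blast
next
  case False
  define b where "b = \<beta> undefined"
  interpret A: framed_code \<alpha> C by fact
  interpret B: framed_code \<beta> D by fact
  have notin: "\<alpha> i - b \<notin> A.L" for i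
    using False by (simp add: b_def)
  have notin': "- \<alpha> i - b \<notin> A.L" for i
    using notin[of i] A.Lat_add[of "- \<alpha> i - b" "2 *\<^sub>R \<alpha> i"] A.Lat_frame_double[of i] by (auto simp: scaleR_2)
  define V where "V = {y. y - b \<in> A.L \<and> y \<bullet> y = 2}"
  define S where "S y = {i. y \<bullet> \<alpha> i \<noteq> 0}" for y
  have V: "card (S y) = 4 \<and> (\<forall>i\<in>S y. \<bar>y \<bullet> \<alpha> i\<bar> = 1)" if y: "y \<in> V" for y
  proof -
    have "y \<bullet> \<alpha> i \<in> \<int>" for i
    proof -
      have "(y - b) \<bullet> \<alpha> i + \<alpha> i \<bullet> b \<in> \<int>"
        using y int A.Lat_frame_Ints by (intro Ints_add) (auto simp: V_def b_def)
      then show ?thesis by (simp add: inner_diff_left inner_commute[of b])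
    qed
    then obtain z where z: "\<And>i. y \<bullet> \<alpha> i = of_int (z i)"
      using A.Ints_coords by blast
    have yy: "y \<bullet> y = 2" using y by (simp add: V_def)
    from A.coords_norm[OF z yy] show ?thesis
    proof (cases rule: sum_squares_eq_4)
      \<comment> \<open>A coordinate \<open>\<plusminus>2\<close> would make \<open>y\<close> equal
        to \<open>\<plusminus>\<alpha> i\<close> and put the two frames into one coset.\<close>
      case (two i)
      then have "\<bar>y \<bullet> \<alpha> i\<bar> = 2" by (simp add: z)
      then show ?thesis
        using A.coord_two[OF yy] y notin notin' by (auto simp: V_def)
    next
      case one
      have "\<bar>real_of_int (z i)\<bar> = 1" if "z i \<noteq> 0" for i
        using one(1)[of i] that by linarith
      then show ?thesis using one(2) by (auto simp: S_def z)
    qed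
  qed
  have S0: "y \<bullet> \<alpha> i = 0" if "i \<notin> S y" for y i
    using that by (simp add: S_def)
  \<comment> \<open>The partition is obtained as a maximal disjoint family of such supports.\<close>
  obtain M where M: "M \<subseteq> S ` V" "disjoint M"
    and max: "\<And>M'. M' \<subseteq> S ` V \<Longrightarrow> disjoint M' \<Longrightarrow> M \<subseteq> M' \<Longrightarrow> M' = M"
  proof -
    have "finite {M. M \<subseteq> S ` V \<and> disjoint M}" "{M. M \<subseteq> S ` V \<and> disjoint M} \<noteq> {}"
      by (auto intro!: exI[of _ "{}"])
    from finite_has_maximal[OF this] show thesis
      using that by (metis (mono_tags, lifting) mem_Collect_eq)
  qed
  define Q where "Q K P \<longleftrightarrow> finite P \<and> (\<forall>p\<in>P. p \<bullet> p = 2 \<and> p - b \<in> A.L \<and> (\<forall>i. i \<notin> K \<longrightarrow> p \<bullet> \<alpha> i = 0)) \<and>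
      (\<forall>p\<in>P. \<forall>q\<in>P. p \<noteq> q \<longrightarrow> p \<bullet> q = 0) \<and> (\<forall>w. (\<forall>p\<in>P. w \<bullet> p = 0) \<longrightarrow> (\<forall>i\<in>K. w \<bullet> \<alpha> i = 0))"
    for K P
  have "\<exists>P. Q K P"
    if K: "K \<in> M" for K
  proof -
    obtain y where y: "y \<in> V" "K = S y" using M(1) K by blast
    have h: "\<bar>y \<bullet> \<alpha> i\<bar> = 1" if "i \<in> K" for i
      using V[OF y(1)] y(2) that by blast
    have yb: "p - b \<in> A.L" if "p - y \<in> A.L" for p
      using A.Lat_diff_trans[OF that] y(1) by (simp add: V_def)
    have "\<exists>P. finite P \<and> (\<forall>p\<in>P. p \<bullet> p = 2 \<and> p - y \<in> A.L \<and> (\<forall>i. i \<notin> K \<longrightarrow> p \<bullet> \<alpha> i = 0)) \<and>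
        (\<forall>p\<in>P. \<forall>q\<in>P. p \<noteq> q \<longrightarrow> p \<bullet> q = 0) \<and> (\<forall>w. (\<forall>p\<in>P. w \<bullet> p = 0) \<longrightarrow> (\<forall>i\<in>K. w \<bullet> \<alpha> i = 0))"
      by (rule A.four_orthogonal[OF h]) (use V[OF y(1)] y(2) S0 in auto)
    then show ?thesis
      unfolding Q_def by (elim ex_forward conj_forward) (use yb in auto)
  qed
  then obtain P where "\<And>K. K \<in> M \<Longrightarrow> Q K (P K)"
    by metis
  then have P: "\<And>K. K \<in> M \<Longrightarrow> finite (P K)"
      "\<And>K p. K \<in> M \<Longrightarrow> p \<in> P K \<Longrightarrow> p \<bullet> p = 2 \<and> p - b \<in> A.L"
      "\<And>K p i. K \<in> M \<Longrightarrow> p \<in> P K \<Longrightarrow> i \<notin> K \<Longrightarrow> p \<bullet> \<alpha> i = 0"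
      "\<And>K p q. K \<in> M \<Longrightarrow> p \<in> P K \<Longrightarrow> q \<in> P K \<Longrightarrow> p \<noteq> q \<Longrightarrow> p \<bullet> q = 0"
      "\<And>K w i. K \<in> M \<Longrightarrow> (\<And>p. p \<in> P K \<Longrightarrow> w \<bullet> p = 0) \<Longrightarrow> i \<in> K \<Longrightarrow> w \<bullet> \<alpha> i = 0"
    unfolding Q_def by blast+
  have disj: "K = K'" if "K \<in> M" "K' \<in> M" "i \<in> K" "i \<in> K'" for K K' i
    using M(2) that by (auto simp: disjoint_def)
  \<comment> \<open>Suppose \<open>k\<close> is uncovered. The orthogonal quadruples over the
    members of \<open>M\<close> extend to a frame \<open>\<beta>'\<close> in the coset of
    \<open>\<beta>\<close>, and some \<open>\<beta>' j\<close> is not orthogonal to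
    \<open>\<alpha> k\<close>. It is then not among the quadruples up to sign, so it is orthogonal
    to all of them; its support contains \<open>k\<close> and avoids every member of
    \<open>M\<close>, contradicting maximality.\<close>
  have cover: "\<Union>M = UNIV"
  proof (rule ccontr)
    assume "\<Union>M \<noteq> UNIV"
    then obtain k where k: "k \<notin> \<Union>M" by auto
    have "\<exists>\<beta>'. framed_code \<beta>' D \<and> Lat \<beta>' D = B.L \<and> (\<forall>j. \<beta>' j - \<beta> undefined \<in> B.L) \<and>
      (\<forall>p\<in>\<Union>(P ` M). \<exists>j. p = \<beta>' j \<or> p = - \<beta>' j)"
    proof (rule B.frame_through)
      show "finite (\<Union>(P ` M))"
        using P(1) by simp
      show "p \<bullet> p = 2 \<and> p - \<beta> undefined \<in> B.L" if "p \<in> \<Union>(P ` M)" for p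
        using that P(2) by (auto simp: eq b_def)
      fix p q assume "p \<in> \<Union>(P ` M)" "q \<in> \<Union>(P ` M)" and neq: "p \<noteq> q"
      then obtain K K' where K: "K \<in> M" "p \<in> P K" "K' \<in> M" "q \<in> P K'" by blast
      show "p \<bullet> q = 0"
      proof (cases "K = K'")
        case False
        then have "(p \<bullet> \<alpha> i) * (q \<bullet> \<alpha> i) = 0" for i
          using P(3)[OF K(1,2), of i] P(3)[OF K(3,4), of i] disj[OF K(1,3)] by auto
        then show ?thesis
          unfolding frame_inner_eq[OF A.frame, of p q] by (simp only: sum.neutral_const div_0)
      qed (use K neq P(4) in blast)
    qed
    then obtain \<beta>' where \<beta>': "framed_code \<beta>' D" "\<And>j. \<beta>' j - b \<in> A.L"
      and P\<beta>: "\<And>p. p \<in> \<Union>(P ` M) \<Longrightarrow> \<exists>j. p = \<beta>' j \<or> p = - \<beta>' j"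
      unfolding b_def eq by blast
    interpret B': framed_code \<beta>' D by fact
    have "\<exists>j. \<alpha> k \<bullet> \<beta>' j \<noteq> 0"
    proof (rule ccontr)
      assume "\<not> ?thesis"
      then have "\<alpha> k \<bullet> \<alpha> k = 0"
        by (simp add: frame_inner_eq[OF B'.frame, of "\<alpha> k" "\<alpha> k"])
      then show False by (simp add: frame_inner[OF A.frame])
    qed
    then obtain j where j: "\<alpha> k \<bullet> \<beta>' j \<noteq> 0" by blast
    have bV: "\<beta>' j \<in> V"
      using \<beta>'(2) by (simp add: V_def frame_inner[OF B'.frame])
    have orth: "\<beta>' j \<bullet> p = 0" if p: "K \<in> M" "p \<in> P K" for K p
    proof -
      obtain l where l: "p = \<beta>' l \<or> p = - \<beta>' l" using P\<beta> p by blast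
      have "p \<bullet> \<alpha> k = 0" using P(3)[OF p] k p(1) by blast
      then have "l \<noteq> j" using l j by (auto simp: inner_commute)
      then show ?thesis using l by (auto simp: frame_inner[OF B'.frame])
    qed
    have "S (\<beta>' j) \<inter> K = {}" if "K \<in> M" for K
      using P(5)[OF that orth[OF that]] by (auto simp: S_def)
    then have "disjoint (insert (S (\<beta>' j)) M)"
      using M(2) by (auto simp: disjoint_def)
    moreover have "insert (S (\<beta>' j)) M \<subseteq> S ` V"
      using M(1) bV by blast
    ultimately have "S (\<beta>' j) \<in> M"
      using max[of "insert (S (\<beta>' j)) M"] by auto
    moreover have "k \<in> S (\<beta>' j)"
      using j by (simp add: S_def inner_commute)
    ultimately show False using k by blast
  qed
  have "\<exists>K. K \<in> M \<and> i \<in> K" for i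
  proof -
    have "i \<in> \<Union>M" unfolding cover by (rule UNIV_I)
    then show ?thesis by (elim UnionE) (intro exI conjI)
  qed
  then obtain s where s: "\<And>i. s i \<in> M" "\<And>i. i \<in> s i"
    by metis
  have "\<exists>y. y \<in> V \<and> s i = S y" for i
    using s(1)[of i] M(1) by blast
  then obtain Y where Y: "\<And>i. Y i \<in> V" "\<And>i. s i = S (Y i)"
    by metis
  have Yz: "\<exists>z. (\<forall>k. Y i \<bullet> \<alpha> k = of_int (z k)) \<and> (\<forall>k. k \<in> s i \<longrightarrow> \<bar>z k\<bar> = 1) \<and> (\<forall>k. k \<notin> s i \<longrightarrow> z k = 0)" for i
  proof -
    have "\<exists>z::int. Y i \<bullet> \<alpha> k = of_int z \<and> (k \<in> s i \<longrightarrow> \<bar>z\<bar> = 1) \<and> (k \<notin> s i \<longrightarrow> z = 0)" for k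
    proof (cases "k \<in> s i")
      case True
      then have "Y i \<bullet> \<alpha> k = 1 \<or> Y i \<bullet> \<alpha> k = -1"
        using V[OF Y(1)[of i]] Y(2)[of i] by (auto simp: abs_if split: if_splits)
      then show ?thesis
        using True by (metis abs_1 abs_minus_cancel of_int_1 of_int_minus)
    qed (use S0 Y(2) in auto)
    then show ?thesis by metis
  qed
  then obtain z where z: "\<And>i k. Y i \<bullet> \<alpha> k = of_int (z i k)" "\<And>i k. k \<in> s i \<Longrightarrow> \<bar>z i k\<bar> = 1"
    "\<And>i k. k \<notin> s i \<Longrightarrow> z i k = 0"
    by metis
  have oddz: "odd (z i k) \<longleftrightarrow> k \<in> s i" for i k
    using z(2,3)[of k i] by (metis abs_1 dvd_0_right even_abs_add_iff odd_one dvd_abs_iff)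
  have word_z: "word (z i) = ind (s i)" for i
    by (simp add: vec_eq_iff oddz)
  have card_s: "card (s i) = 4" for i
    using V[OF Y(1)] Y(2) by metis
  have Yb: "Y i - b \<in> A.L" for i
    using Y(1) by (simp add: V_def)
  have b_Ints: "x \<bullet> b \<in> \<int>" if "x \<in> A.L" for x
    using B.Lat_frame_Ints that eq by (simp add: b_def)
  have Y_Ints: "x \<bullet> Y i \<in> \<int>" if "x \<in> A.L" for x i
  proof -
    have "x \<bullet> (Y i - b) + x \<bullet> b \<in> \<int>"
      using A.Lat_inner_Ints[OF that Yb] b_Ints[OF that] by (rule Ints_add)
    then show ?thesis by (simp add: inner_diff_right)
  qed
  have dual: "ind (s i) \<in> dual_code C" for i
  proof -
    have "code_inner (ind (s i)) c = 0" if c: "c \<in> C" for c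
    proof -
      obtain x where x: "x \<in> A.L" "\<And>i. x \<bullet> \<alpha> i = of_bool (i \<in> supp c)"
        using A.Lat_word[OF c] by blast
      have "x \<bullet> Y i = of_int (\<Sum>k\<in>UNIV. of_bool (k \<in> supp c) * z i k) / 2"
        unfolding frame_inner_eq[OF A.frame, of x "Y i"] x(2) z(1) by simp
      moreover obtain m where "x \<bullet> Y i = of_int m"
        using Y_Ints[OF x(1)] by (auto elim: Ints_cases)
      ultimately have "real_of_int (\<Sum>k\<in>UNIV. of_bool (k \<in> supp c) * z i k) = of_int (2 * m)"
        by (simp only: of_int_mult)
      then have "even (\<Sum>k\<in>UNIV. of_bool (k \<in> supp c) * z i k)"
        by (simp only: of_int_eq_iff dvd_triv_left)
      then have "code_inner (word (\<lambda>k. of_bool (k \<in> supp c))) (word (z i)) = 0"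
        by (simp only: code_inner_word bit_of_int) simp
      then show ?thesis
        by (simp add: word_of_bool word_z code_inner_commute)
    qed
    then show ?thesis by (simp add: dual_code_def)
  qed
  have add: "ind (s i) + ind (s j) \<in> C" for i j
  proof -
    have "Y i - Y j \<in> A.L"
      using A.Lat_diff[OF Yb[of i] Yb[of j]] by simp
    then obtain w where w: "\<And>k. (Y i - Y j) \<bullet> \<alpha> k = of_int (w k)" "word w \<in> C"
      by (metis LatE)
    have "w k = z i k - z j k" for k
      using w(1)[of k] by (simp add: inner_diff_left z(1) flip: of_int_diff)
    then have "word w = ind (s i) + ind (s j)"
      unfolding word_z[symmetric] word_add[symmetric] word_eq_iff by simp
    then show ?thesis using w(2) by simp
  qed
  define a :: 'n where "a = undefined"
  define yS where "yS = sum (z a) UNIV"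
  have yS_even: "even yS"
  proof -
    have "yS = (\<Sum>k\<in>s a. z a k)"
      unfolding yS_def by (rule sum.mono_neutral_right) (auto simp: z(3))
    moreover have "even (\<Sum>k\<in>s a. z a k) \<longleftrightarrow> even (card (s a))"
      by (simp add: even_sum_iff oddz Int_absorb2 Collect_conj_eq)
    ultimately show ?thesis by (simp add: card_s)
  qed
  \<comment> \<open>\<open>W.switch a - Y a\<close> will have even coordinates, so only its
    coordinate sum modulo 4 matters, and that is the condition on \<open>J\<close>. If
    \<open>yS\<close> is 2 modulo 4, then \<open>J = 0\<close> works. Otherwise
    \<open>ind (s a)\<close> is not in \<open>C\<close>, and a dual word meeting it oddly shifts the
    sign sum by 2 modulo 4.\<close>
  obtain J where J: "J \<in> dual_code C" "4 dvd (\<Sum>k\<in>s a. sg (J $ k)) + yS - (2::int)"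
  proof (cases "4 dvd yS")
    case False
    then have "4 dvd 4 + yS - 2" using yS_even by presburger
    moreover have "(\<Sum>k\<in>s a. sg ((0 :: bit ^ 'n) $ k)) = (4::int)"
      by (simp add: card_s)
    ultimately show thesis
      using that[of 0] by (simp add: dual_code_def)
  next
    case True
    have "ind (s a) \<notin> C"
    proof
      assume "ind (s a) \<in> C"
      then have "Y a \<in> A.L"
        by (intro LatI[of _ _ "z a"]) (use z(1) word_z True in \<open>auto simp: yS_def\<close>)
      then have "b \<in> A.L"
        using Yb[of a] A.Lat_diff[of "Y a" "Y a - b"] by simp
      then show False
        using B.frame_notin_Lat eq by (simp add: b_def)
    qed
    then obtain J where J: "J \<in> dual_code C" "code_inner J (ind (s a)) = 1"
      by (rule dual_separates[OF A.subspace])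
    then have "odd (card (s a \<inter> supp J))"
      by (simp add: code_inner_card Int_commute split: if_splits)
    then have "4 dvd int (card (s a)) - 2 * int (card (s a \<inter> supp J)) + yS - 2"
      unfolding card_s using True by presburger
    then show thesis using that J by (simp add: sum_sg)
  qed
  interpret W: block_system \<alpha> C s J
  proof (unfold_locales)
    show "s j = s i" if "j \<in> s i" for i j
      using disj[OF s(1) s(1)] s(2) that by blast
  qed (use s(2) card_s dual add J(1) in auto)
  have "W.switch a - Y a \<in> A.L"
  proof (rule LatI)
    let ?w = "\<lambda>k. (if k = a then 2 else 0) - sg (J $ a) * (if k \<in> s a then sg (J $ k) else 0) - z a k"
    have odd_sg: "odd (sg c :: int)" for c by (simp add: sg_def)
    show "(W.switch a - Y a) \<bullet> \<alpha> i = of_int (?w i)" for i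
      by (simp add: inner_diff_left W.switch_def z(1) W.glue_inner_frame frame_inner[OF A.frame] sg_def)
    have "word ?w = 0"
      by (rule word_even) (use oddz[of a] odd_sg in auto)
    then show "word ?w \<in> C"
      using code_subspace_0[OF A.subspace] by simp
    have "sum ?w UNIV = 2 - sg (J $ a) * (\<Sum>k\<in>s a. sg (J $ k)) - yS"
      by (simp add: sum_subtractf yS_def flip: sum_distrib_left sum.inter_filter)
    moreover have "sg (J $ a) = (1::int) \<or> sg (J $ a) = (-1::int)" by (simp add: sg_def)
    moreover have "even (\<Sum>k\<in>s a. sg (J $ k) :: int)"
      by (simp add: even_sum_iff odd_sg card_s)
    moreover have "4 dvd 2 - u * e - y" if "u = 1 \<or> u = -1" "even e" "even y" "4 dvd e + y - 2" for u e y :: int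
      using that by (elim disjE) (hypsubst, presburger)+
    ultimately show "4 dvd sum ?w UNIV"
      using J(2) yS_even by metis
  qed
  then have "W.switch a - \<beta> undefined \<in> Lat W.switch C"
    using A.Lat_diff_trans[OF _ Yb] by (simp add: W.Lat_switch b_def)
  then show ?thesis
    using equivalent_of_same_coset[OF W.framed_switch B] eq by (simp add: W.Lat_switch)
qed

section \<open>Words of weight four in codes of length 16\<close>

text \<open>Equivalently, the dual code has no word of weight 2. This removes the cross terms in
  \<open>coset_moment\<close>.\<close>

definition separates :: "(bit ^ 'n) set \<Rightarrow> bool" where
  "separates C \<longleftrightarrow> (\<forall>i j. i \<noteq> j \<longrightarrow> (\<exists>c\<in>C. c $ i + c $ j = 1))"

definition quads :: "(bit ^ 'n) set \<Rightarrow> 'n set set" where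
  "quads X = {B. card B = 4 \<and> ind B \<in> X}"

lemma quadsD: "B \<in> quads X \<Longrightarrow> card B = 4" "B \<in> quads X \<Longrightarrow> ind B \<in> X"
  by (simp_all add: quads_def)

text \<open>A first moment of the weight distribution, weighted by the sign at \<open>i\<close>.
  After interchanging the sums, a term with \<open>j \<noteq> i\<close> is the sum of a nontrivial
  character of \<open>C\<close>; only \<open>j = i\<close> survives.\<close>

lemma coset_moment:
  fixes C :: "(bit ^ 'n::finite) set"
  assumes C: "vec.subspace C" "separates C"
  shows "(\<Sum>c\<in>C. (\<Sum>j\<in>UNIV. sg ((S + c) $ j)) * sg ((S + c) $ i)) = int (card C)"
proof -
  have zero: "(\<Sum>c\<in>C. sg (c $ j + c $ i) :: int) = 0" if ji: "j \<noteq> i" for j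
  proof -
    obtain c0 where c0: "c0 \<in> C" "c0 $ j + c0 $ i = 1"
      using C(2)[unfolded separates_def, rule_format, OF ji] ..
    then show ?thesis
      by (intro char_sum_zero[OF C(1)]) (simp only: vector_add_component ac_simps)
  qed
  have "(\<Sum>c\<in>C. (\<Sum>j\<in>UNIV. sg ((S + c) $ j)) * sg ((S + c) $ i)) =
      (\<Sum>j\<in>UNIV. \<Sum>c\<in>C. sg ((S + c) $ j) * (sg ((S + c) $ i) :: int))"
    unfolding sum_distrib_right by (rule sum.swap)
  also have "\<dots> = (\<Sum>j\<in>UNIV. if j = i then int (card C) else 0)"
  proof (intro sum.cong refl)
    fix j
    have eq: "(\<Sum>c\<in>C. sg ((S + c) $ j) * (sg ((S + c) $ i) :: int)) = sg (S $ j) * sg (S $ i) * (\<Sum>c\<in>C. sg (c $ j + c $ i))"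
      unfolding sum_distrib_left by (intro sum.cong refl) (simp only: vector_add_component sg_add mult_ac)
    show "(\<Sum>c\<in>C. sg ((S + c) $ j) * (sg ((S + c) $ i) :: int)) = (if j = i then int (card C) else 0)"
    proof (cases "j = i")
      case False
      then show ?thesis unfolding eq zero[OF False] by simp
    qed (simp only: sg_mult_self sum_constant mult_1_right simp_thms if_True)
  qed
  finally show ?thesis by simp
qed

lemma sum_sg_weight: "(\<Sum>j\<in>UNIV. sg (c $ j)) = int CARD('n) - 2 * int (weight c)" for c :: "bit ^ 'n::finite"
  by (simp add: sum_sg weight_supp)

lemma weight_compl: "weight (ind UNIV + c) = CARD('n) - weight c" for c :: "bit ^ 'n::finite"
  by (simp add: weight_supp supp_add_one Compl_eq_Diff_UNIV card_Diff_subset)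

lemma weight_le: "weight c \<le> CARD('n)" for c :: "bit ^ 'n::finite"
  by (simp add: weight_supp card_mono)

text \<open>\<open>h\<close> is invariant under complementation, since both factors change sign, and
  vanishes at weight 8. So the weights 0 and 4 count twice: a quad contributes
  \<open>\<plusminus>8\<close> each time and the zero word 16, which explains the constants 16 and
  32.\<close>

lemma coset_quads:
  fixes C :: "(bit ^ 'n::finite) set"
  assumes n: "CARD('n) = 16" and C: "vec.subspace C" "separates C" "ind UNIV \<in> C"
    and X: "X = (+) S ` C" and wt: "\<And>x. x \<in> X \<Longrightarrow> 4 dvd weight x"
  shows "16 * (int (card (quads X)) - 2 * int (card {B \<in> quads X. i \<in> B})) + (if 0 \<in> X then 32 else 0) = int (card C)"
proof -
  define h :: "bit ^ 'n \<Rightarrow> int" where "h x = (16 - 2 * int (weight x)) * sg (x $ i)" for x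
  have "(\<Sum>x\<in>X. h x) = (\<Sum>c\<in>C. h (S + c))"
    unfolding X by (rule sum.reindex[unfolded o_def]) (rule inj_onI, simp)
  also have "\<dots> = int (card C)"
    unfolding coset_moment[OF C(1,2), of S i, symmetric] sum_sg_weight h_def n by simp
  finally have total: "(\<Sum>x\<in>X. h x) = int (card C)" .
  have comp: "ind UNIV + x \<in> X" if x: "x \<in> X" for x
  proof -
    obtain c where "c \<in> C" "x = S + c" using x unfolding X by blast
    then show ?thesis
      unfolding X using code_subspace_add[OF C(1) C(3)]
      by (intro image_eqI[of _ _ "ind UNIV + c"]) (simp_all only: ac_simps)
  qed
  have h_comp: "h (ind UNIV + x) = h x" for x
    using weight_le[of x] by (cases "x $ i") (simp_all add: h_def weight_compl n)
  define lo where "lo = {x \<in> X. weight x < 8}"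
  have "X = lo \<union> {x \<in> X. weight x = 8} \<union> {x \<in> X. 8 < weight x}"
    by (auto simp: lo_def)
  then have "(\<Sum>x\<in>X. h x) = (\<Sum>x\<in>lo \<union> {x \<in> X. weight x = 8} \<union> {x \<in> X. 8 < weight x}. h x)"
    by simp
  also have "\<dots> = (\<Sum>x\<in>lo. h x) + (\<Sum>x | x \<in> X \<and> weight x = 8. h x) + (\<Sum>x | x \<in> X \<and> 8 < weight x. h x)"
    by (subst sum.union_disjoint; (subst sum.union_disjoint)?) (auto simp: lo_def)
  also have "(\<Sum>x | x \<in> X \<and> weight x = 8. h x) = 0"
    by (intro sum.neutral) (auto simp: h_def)
  also have "(\<Sum>x | x \<in> X \<and> 8 < weight x. h x) = (\<Sum>x\<in>lo. h x)"
    by (rule sum.reindex_bij_witness[of _ "(+) (ind UNIV)" "(+) (ind UNIV)"])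
      (auto simp: lo_def h_comp comp weight_compl n intro: bit_vec_add_left)
  finally have "(\<Sum>x\<in>X. h x) = 2 * (\<Sum>x\<in>lo. h x)" by simp
  moreover have "lo = {x \<in> X. weight x = 0} \<union> ind ` quads X"
  proof -
    have "weight x = 0 \<or> weight x = 4" if "x \<in> lo" for x
      using wt[of x] that by (auto simp: lo_def elim!: dvdE)
    moreover have "x \<in> ind ` quads X" if "x \<in> X" "weight x = 4" for x
      using that by (intro image_eqI[of _ _ "supp x"]) (auto simp: quads_def weight_supp)
    ultimately show ?thesis
      by (auto simp: lo_def quads_def)
  qed
  then have "(\<Sum>x\<in>lo. h x) = (\<Sum>x | x \<in> X \<and> weight x = 0. h x) + (\<Sum>x\<in>ind ` quads X. h x)"
    by (simp only:, subst sum.union_disjoint) (auto simp: quads_def)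
  moreover have "{x \<in> X. weight x = 0} = (if 0 \<in> X then {0} else {})"
    by (auto simp: weight_supp) (metis supp_0 supp_inject)+
  then have "(\<Sum>x | x \<in> X \<and> weight x = 0. h x) = (if 0 \<in> X then 16 else 0)"
    by (simp add: h_def weight_supp)
  moreover have "(\<Sum>x\<in>ind ` quads X. h x) = (\<Sum>B\<in>quads X. 8 * (1 - 2 * (if i \<in> B then 1 else 0)))"
    by (subst sum.reindex) (auto simp: inj_on_def h_def quads_def sg_of_bool intro!: sum.cong)
  moreover have "(\<Sum>B\<in>quads X. 8 * (1 - 2 * (if i \<in> B then 1 else 0))) =
      8 * (int (card (quads X)) - 2 * int (card {B \<in> quads X. i \<in> B}))"
    unfolding sum_distrib_left[symmetric] sum_subtractf by (simp flip: sum.inter_filter)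
  ultimately show ?thesis
    using total by simp
qed

lemma sum_card_through:
  fixes Q :: "'n::finite set set"
  assumes "\<And>B. B \<in> Q \<Longrightarrow> card B = k"
  shows "(\<Sum>i\<in>A. card {B \<in> Q. i \<in> B}) = (\<Sum>B\<in>Q. card (B \<inter> A))"
proof -
  have "(\<Sum>i\<in>A. card {B \<in> Q. i \<in> B}) = (\<Sum>i\<in>A. \<Sum>B\<in>Q. if i \<in> B then 1 else 0)"
    by (simp flip: sum.inter_filter)
  also have "\<dots> = (\<Sum>B\<in>Q. \<Sum>i\<in>A. if i \<in> B then 1 else 0)"
    by (rule sum.swap)
  also have "\<dots> = (\<Sum>B\<in>Q. card (B \<inter> A))"
    by (intro sum.cong refl) (simp add: Int_def conj_commute flip: sum.inter_filter)
  finally show ?thesis .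
qed

text \<open>The value \<open>m\<close> is the same for every coordinate. Summing over all 16 of
  them, with four incidences per quad, determines the total, and the number through each point is
  then forced.\<close>

lemma card_quads_const:
  fixes X :: "(bit ^ 'n::finite) set"
  assumes n: "CARD('n) = 16" and m: "\<And>i. 16 * (int (card (quads X)) - 2 * int (card {B \<in> quads X. i \<in> B})) = m"
  shows "8 * int (card (quads X)) = m" "card (quads X) = 4 * card {B \<in> quads X. i \<in> B}"
proof -
  have "(\<Sum>i\<in>UNIV. card {B \<in> quads X. i \<in> B}) = (\<Sum>B\<in>quads X. card (B \<inter> UNIV))"
    by (rule sum_card_through) (rule quadsD)
  also have "\<dots> = (\<Sum>B\<in>quads X. 4)"
    by (intro sum.cong refl) (simp add: quadsD)
  finally have "(\<Sum>i\<in>UNIV. int (card {B \<in> quads X. i \<in> B})) = 4 * int (card (quads X))"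
    by (simp flip: of_nat_sum)
  moreover have "(\<Sum>i\<in>(UNIV :: 'n set). 16 * (int (card (quads X)) - 2 * int (card {B \<in> quads X. i \<in> B}))) = 16 * m"
    unfolding m by (simp add: n)
  ultimately show "8 * int (card (quads X)) = m"
    unfolding sum_distrib_left[symmetric] sum_subtractf by (simp add: n)
  with m[of i] show "card (quads X) = 4 * card {B \<in> quads X. i \<in> B}"
    by simp
qed

text \<open>Members that meet do so in at least two points, so each meets at most
  \<open>2 * (q - 1)\<close> others. Among \<open>4 * q\<close> members there are thus two disjoint
  ones, and a third disjoint from both since \<open>2 + 4 * (q - 1) < 4 * q\<close>. The complement
  is the fourth block.\<close>

lemma partition_of_quads:
  fixes Q :: "'n::finite set set"
  assumes n: "CARD('n) = 16" and card4: "\<And>B. B \<in> Q \<Longrightarrow> card B = 4"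
    and ev: "\<And>B B'. B \<in> Q \<Longrightarrow> B' \<in> Q \<Longrightarrow> even (card (B \<inter> B'))"
    and q: "card Q = 4 * q" "q > 0" "\<And>i. card {B \<in> Q. i \<in> B} = q"
    and compl: "\<And>X Y Z. X \<in> Q \<Longrightarrow> Y \<in> Q \<Longrightarrow> Z \<in> Q \<Longrightarrow> X \<inter> Y = {} \<Longrightarrow> X \<inter> Z = {} \<Longrightarrow> Y \<inter> Z = {} \<Longrightarrow>
      - (X \<union> Y \<union> Z) \<in> Q"
  obtains s where "\<And>i. s i \<in> Q" "\<And>i. i \<in> s i" "\<And>i j. j \<in> s i \<Longrightarrow> s j = s i"
proof -
  define meet where "meet X = {B \<in> Q - {X}. B \<inter> X \<noteq> {}}" for X
  have meet: "card (meet X) \<le> 2 * (q - 1)" if X: "X \<in> Q" for X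
  proof -
    have "2 * card (meet X) = (\<Sum>B\<in>meet X. 2)" by simp
    also have "\<dots> \<le> (\<Sum>B\<in>meet X. card (B \<inter> X))"
    proof (rule sum_mono)
      fix B assume B: "B \<in> meet X"
      then have "card (B \<inter> X) \<noteq> 0" "even (card (B \<inter> X))"
        using X ev by (auto simp: meet_def)
      then show "2 \<le> card (B \<inter> X)" by presburger
    qed
    also have "\<dots> \<le> (\<Sum>B\<in>Q - {X}. card (B \<inter> X))"
      by (rule sum_mono2) (auto simp: meet_def)
    also have "\<dots> = (\<Sum>B\<in>Q. card (B \<inter> X)) - 4"
      using X card4[OF X] by (simp add: sum_diff1_nat)
    also have "(\<Sum>B\<in>Q. card (B \<inter> X)) = (\<Sum>i\<in>X. card {B \<in> Q. i \<in> B})"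
      by (rule sum_card_through[symmetric]) (rule card4)
    also have "\<dots> = 4 * q"
      by (simp add: q(3) card4[OF X])
    finally show ?thesis by simp
  qed
  obtain X where X: "X \<in> Q"
    using q(1,2) by (metis all_not_in_conv card.empty mult_eq_0_iff not_less_zero zero_neq_numeral)
  have "card (insert X (meet X)) < card Q"
    using meet[OF X] q(1,2) card_insert_le_m1[of "Suc (card (meet X))" "meet X" X] by (simp add: card_insert_if)
  then have "\<not> Q \<subseteq> insert X (meet X)"
    by (meson card_mono finite leD)
  then obtain Y where Y: "Y \<in> Q" "Y \<noteq> X" "X \<inter> Y = {}"
    by (auto simp: meet_def)
  have "card (insert X (insert Y (meet X \<union> meet Y))) \<le> 2 + (card (meet X) + card (meet Y))"
    using card_Un_le[of "meet X" "meet Y"] by (simp add: card_insert_if)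
  also have "\<dots> < card Q"
    using meet[OF X] meet[OF Y(1)] q(1,2) by linarith
  finally have "\<not> Q \<subseteq> insert X (insert Y (meet X \<union> meet Y))"
    by (meson card_mono finite leD)
  then obtain Z where Z: "Z \<in> Q" "X \<inter> Z = {}" "Y \<inter> Z = {}"
    by (auto simp: meet_def)
  define s where "s i = (if i \<in> X then X else if i \<in> Y then Y else if i \<in> Z then Z else - (X \<union> Y \<union> Z))" for i
  show thesis
  proof
    show "s i \<in> Q" for i
      using X Y Z compl by (simp add: s_def)
    show "i \<in> s i" for i
      by (simp add: s_def)
    show "s j = s i" if "j \<in> s i" for i j
      using that Y Z by (auto simp: s_def split: if_splits)
  qed
qed

section \<open>Gauss sums over the dual code\<close>

lemma sg_sum: "sg (\<Sum>j\<in>A. f j) = (\<Prod>j\<in>A. sg (f j))"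
  by (induction A rule: infinite_finite_induct) (simp_all only: sum.infinite prod.infinite sum.empty prod.empty
      sum.insert prod.insert sg_simps sg_add not_False_eq_True)

lemma code_inner_ind_sum: "code_inner (ind A) c = (\<Sum>j\<in>A. c $ j)"
proof -
  have "code_inner (ind A) c = (\<Sum>j\<in>UNIV. if j \<in> A then c $ j else 0)"
    unfolding code_inner_def by (intro sum.cong) auto
  then show ?thesis by (simp flip: sum.inter_filter)
qed

text \<open>The sum factors over the coordinates into \<open>1 - \<i>\<close> on the support of
  \<open>c\<close> and \<open>1 + \<i>\<close> off it. Both have fourth power -4, so the value is
  \<open>(-4) ^ 4\<close>, whatever \<open>c\<close> is.\<close>

lemma gauss_sum_word:
  fixes c :: "bit ^ 'n::finite"
  assumes n: "CARD('n) = 16" and c: "4 dvd weight c"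
  shows "(\<Sum>x\<in>UNIV. \<i> ^ weight x * sg (code_inner x c)) = 256"
proof -
  have "(\<Sum>x\<in>UNIV. \<i> ^ weight x * sg (code_inner x c)) = (\<Sum>A\<in>UNIV. \<i> ^ weight (ind A) * sg (code_inner (ind A) c))"
    using bij_ind by (rule sum.reindex_bij_betw[symmetric])
  also have "\<dots> = (\<Sum>A\<in>Pow UNIV. (\<Prod>j\<in>A. \<i> * sg (c $ j)) * (\<Prod>j\<in>UNIV - A. 1))"
    by (intro sum.cong) (simp_all add: code_inner_ind_sum sg_sum prod.distrib)
  also have "\<dots> = (\<Prod>j\<in>UNIV. \<i> * sg (c $ j) + 1)"
    by (rule prod_add[symmetric]) simp
  also have "\<dots> = (\<Prod>j\<in>UNIV. if j \<in> supp c then 1 - \<i> else 1 + \<i>)"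
    by (intro prod.cong refl) (auto simp: sg_of_bool mem_supp)
  also have "\<dots> = (1 - \<i>) ^ weight c * (1 + \<i>) ^ (16 - weight c)"
    by (simp add: prod.If_cases weight_supp Compl_eq_Diff_UNIV card_Diff_subset flip: n)
  also have "\<dots> = 256"
  proof -
    obtain k where k: "weight c = 4 * k" using c by auto
    have "(1 - \<i>) ^ 4 = -4" "(1 + \<i>) ^ 4 = -4"
      by (simp_all add: complex_eq_iff power4_eq_xxxx)
    moreover have "16 - weight c = 4 * (4 - k)" "k \<le> 4"
      using k weight_le[of c] n by simp_all
    ultimately have "(1 - \<i>) ^ weight c * (1 + \<i>) ^ (16 - weight c) = (-4) ^ k * (-4) ^ (4 - k)"
      by (simp only: k power_mult)
    also have "\<dots> = (-4) ^ 4"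
      using \<open>k \<le> 4\<close> by (simp flip: power_add)
    finally show ?thesis by simp
  qed
  finally show ?thesis .
qed

text \<open>Poisson summation: averaging the sums for the words of \<open>C\<close> cancels every
  \<open>x\<close> outside the dual code.\<close>

lemma gauss_sum_dual:
  fixes C :: "(bit ^ 'n::finite) set"
  assumes n: "CARD('n) = 16" and C: "vec.subspace C" "doubly_even C"
  shows "(\<Sum>x\<in>dual_code C. \<i> ^ weight x) = 256"
proof -
  have "(\<Sum>x\<in>UNIV. \<Sum>c\<in>C. \<i> ^ weight x * sg (code_inner x c)) = (\<Sum>x\<in>UNIV. if x \<in> dual_code C then of_nat (card C) * \<i> ^ weight x else 0)"
    unfolding sum_distrib_left[symmetric] char_sum_code[OF C(1)] by (intro sum.cong) auto
  also have "\<dots> = of_nat (card C) * (\<Sum>x\<in>dual_code C. \<i> ^ weight x)"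
    by (simp add: sum_distrib_left flip: sum.inter_filter)
  finally have "of_nat (card C) * (\<Sum>x\<in>dual_code C. \<i> ^ weight x) = (\<Sum>x\<in>UNIV. \<Sum>c\<in>C. \<i> ^ weight x * sg (code_inner x c))" ..
  also have "\<dots> = (\<Sum>c\<in>C. \<Sum>x\<in>UNIV. \<i> ^ weight x * sg (code_inner x c))"
    by (rule sum.swap)
  also have "\<dots> = (\<Sum>c\<in>C. 256)"
    using C(2) by (intro sum.cong refl gauss_sum_word n) (simp add: doubly_even_def)
  finally show ?thesis
    using code_subspace_0[OF C(1)] by (auto simp: card_gt_0_iff)
qed

lemma i_power_4: "4 dvd k \<Longrightarrow> \<i> ^ k = 1"
  by (auto elim!: dvdE simp: power_mult)

lemma i_power_2: "even k \<Longrightarrow> \<not> 4 dvd k \<Longrightarrow> \<i> ^ k = -1"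
proof -
  assume "even k" "\<not> 4 dvd k"
  then obtain m where "k = 2 * m" "odd m" by (auto elim!: evenE)
  then show ?thesis by (simp add: power_mult)
qed

lemma card_self_dual:
  fixes C :: "(bit ^ 'n::finite) set"
  assumes n: "CARD('n) = 16" and C: "vec.subspace C" "doubly_even C" "self_dual C"
  shows "card C = 256"
proof -
  have "(\<Sum>x\<in>C. \<i> ^ weight x) = (\<Sum>x\<in>C. 1)"
    using C(2) by (intro sum.cong refl i_power_4) (simp add: doubly_even_def)
  then have "of_nat (card C) = (256 :: complex)"
    using gauss_sum_dual[OF n C(1,2)] C(3) by (simp add: self_dual_def)
  then show ?thesis
    by (metis of_nat_eq_iff of_nat_numeral)
qed

text \<open>Without such a word every dual word outside \<open>C\<close> contributes -1 to the Gauss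
  sum, so \<open>card C\<close> exceeds the number of these words by 256. But they include a whole
  coset of \<open>C\<close>, so the excess cannot be positive.\<close>

lemma ex_doubly_even_dual:
  fixes C :: "(bit ^ 'n::finite) set"
  assumes n: "CARD('n) = 16" and C: "vec.subspace C" "doubly_even C" "ind UNIV \<in> C" "\<not> self_dual C"
  obtains S where "S \<in> dual_code C" "S \<notin> C" "4 dvd weight S"
proof (rule ccontr)
  assume no: "\<not> thesis"
  have sub: "C \<subseteq> dual_code C"
    by (rule doubly_even_subset_dual[OF C(1,2)])
  then obtain y where y: "y \<in> dual_code C" "y \<notin> C"
    using C(4) by (auto simp: self_dual_def)
  have ev: "even (weight x)" if "x \<in> dual_code C" for x
    using dual_codeD[OF that C(3)] by (simp add: code_inner_card weight_supp split: if_splits)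
  have "(\<Sum>x\<in>dual_code C. \<i> ^ weight x) = (\<Sum>x\<in>dual_code C - C. \<i> ^ weight x) + (\<Sum>x\<in>C. \<i> ^ weight x)"
    using sub by (rule sum.subset_diff) simp
  also have "(\<Sum>x\<in>C. \<i> ^ weight x) = (\<Sum>x\<in>C. 1)"
    using C(2) by (intro sum.cong refl i_power_4) (simp add: doubly_even_def)
  also have "(\<Sum>x\<in>dual_code C - C. \<i> ^ weight x) = (\<Sum>x\<in>dual_code C - C. -1)"
    using no that ev by (intro sum.cong refl i_power_2) blast+
  finally have "complex_of_int (int (card C) - int (card (dual_code C - C))) = of_int 256"
    using gauss_sum_dual[OF n C(1,2)] by simp
  then have "int (card C) - int (card (dual_code C - C)) = 256"
    by (simp only: of_int_eq_iff)
  moreover have "(+) y ` C \<subseteq> dual_code C - C"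
  proof
    fix x assume "x \<in> (+) y ` C"
    then obtain c where c: "c \<in> C" "x = c + y" by (auto simp: add.commute)
    then show "x \<in> dual_code C - C"
      using y sub code_subspace_add[OF subspace_dual_code, of c C y] code_subspace_add_iff[OF C(1) c(1), of y]
      by blast
  qed
  then have "card ((+) y ` C) \<le> card (dual_code C - C)"
    by (intro card_mono) auto
  then have "card C \<le> card (dual_code C - C)"
    by (simp add: card_image)
  ultimately show False by simp
qed

section \<open>Frames with half-integral inner products\<close>

lemma weight_add: "weight (c + d) + 2 * card (supp c \<inter> supp d) = weight c + weight d"
  for c :: "bit ^ 'n::finite"
proof -
  have "weight (c + d) = card (supp c - supp d) + card (supp d - supp c)"
    unfolding weight_supp supp_add by (rule card_Un_disjoint) auto
  moreover have "card (supp c) = card (supp c - supp d) + card (supp c \<inter> supp d)"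
    "card (supp d) = card (supp d - supp c) + card (supp c \<inter> supp d)"
    by (metis card_Diff_subset_Int card_mono finite Int_lower1 le_add_diff_inverse2 Int_commute)+
  ultimately show ?thesis by (simp add: weight_supp)
qed

lemma (in framed_code) LatD:
  assumes "x \<in> L" "\<And>i. x \<bullet> \<alpha> i = of_int (z i)"
  shows "word z \<in> C" "4 dvd sum z UNIV"
proof -
  obtain w where w: "\<And>i. x \<bullet> \<alpha> i = of_int (w i)" "word w \<in> C" "4 dvd sum w UNIV"
    using assms(1) by (metis LatE)
  have "z = w"
    using w(1) assms(2) by (metis ext of_int_eq_iff)
  then show "word z \<in> C" "4 dvd sum z UNIV" using w by simp_all
qed

text \<open>The reflection in the difference of two vectors of equal norm exchanges them. Here the
  difference \<open>g\<close> has norm \<open>2 + 2 - 3 = 1\<close>, its double lies in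
  \<open>L\<close> and its products with \<open>L\<close> are integral, so this reflection preserves
  \<open>L\<close>.\<close>

lemma equivalent_of_three_halves:
  fixes \<alpha> \<beta> :: "'n::finite \<Rightarrow> real ^ 'n"
  assumes A: "framed_code \<alpha> C" and B: "framed_code \<beta> D" and eq: "Lat \<alpha> C = Lat \<beta> D"
    and "\<bar>\<alpha> i \<bullet> \<beta> j\<bar> = 3/2"
  shows "equivalent_codes C D"
proof -
  interpret A: framed_code \<alpha> C by fact
  interpret B: framed_code \<beta> D by fact
  obtain e :: real where e: "e = 1 \<or> e = -1" "\<alpha> i \<bullet> \<beta> j = e * (3/2)"
    using assms(4) by (metis abs_if minus_minus mult_1 mult_minus1)
  define g where "g = \<alpha> i - e *\<^sub>R \<beta> j"
  have ii: "\<alpha> i \<bullet> \<alpha> i = 2" "\<beta> j \<bullet> \<beta> j = 2"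
    by (simp_all add: frame_inner[OF A.frame] frame_inner[OF B.frame])
  have \<alpha>g: "\<alpha> i \<bullet> g = 1/2"
    using e ii by (auto simp: g_def inner_diff_right)
  have gg: "g \<bullet> g = 1"
    using e ii by (auto simp: g_def inner_diff_left inner_diff_right inner_commute)
  have "2 *\<^sub>R \<beta> j \<in> A.L"
    using B.Lat_frame_double eq by simp
  then have "e *\<^sub>R (2 *\<^sub>R \<beta> j) \<in> A.L"
    by (rule A.Lat_scale_Ints) (use e(1) in auto)
  then have "2 *\<^sub>R \<alpha> i - e *\<^sub>R (2 *\<^sub>R \<beta> j) \<in> A.L"
    using A.Lat_diff[OF A.Lat_frame_double] by blast
  then have g2: "2 *\<^sub>R g \<in> A.L"
    by (simp add: g_def scaleR_diff_right mult.commute)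
  have inv: "(2 * (x \<bullet> g) / (g \<bullet> g)) *\<^sub>R g \<in> A.L" if x: "x \<in> A.L" for x
  proof -
    have "x \<bullet> \<beta> j \<in> \<int>" "x \<bullet> \<alpha> i \<in> \<int>"
      using x A.Lat_frame_Ints B.Lat_frame_Ints eq by auto
    then have "x \<bullet> g \<in> \<int>"
      using e(1) by (auto simp: g_def inner_diff_right inner_add_right)
    then have "(x \<bullet> g) *\<^sub>R (2 *\<^sub>R g) \<in> A.L"
      by (rule A.Lat_scale_Ints[OF g2])
    then show ?thesis by (simp add: gg mult.commute)
  qed
  note new = A.reflection_Lat[OF _ inv]
  have "reflection g (\<alpha> i) = e *\<^sub>R \<beta> j"
    by (simp add: reflection_def \<alpha>g gg) (simp add: g_def)
  then have "reflection g (\<alpha> i) - \<beta> j \<in> A.L"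
    using e(1) A.Lat_uminus_iff[of "2 *\<^sub>R \<beta> j"] \<open>2 *\<^sub>R \<beta> j \<in> A.L\<close> by (auto simp: scaleR_2)
  then show ?thesis
    using equivalent_of_same_coset[OF new(1) B, of i j] new(2) gg eq by simp
qed

text \<open>All mutual inner products are \<open>\<plusminus>1/2\<close>, so they form a Hadamard matrix of order 16. A word
  \<open>S\<close> in the dual code, but not in \<open>C\<close>, with weight divisible by 4 yields a partition into
  words of weight 4 from the coset of \<open>S\<close>; switching along it makes all inner products integral.\<close>

lemma equivalent_of_halves:
  fixes \<alpha> \<beta> :: "'n::finite \<Rightarrow> real ^ 'n"
  assumes A: "framed_code \<alpha> C" and B: "framed_code \<beta> D" and eq: "Lat \<alpha> C = Lat \<beta> D"
    and half: "\<And>i j. \<bar>\<alpha> i \<bullet> \<beta> j\<bar> = 1/2"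
    and n: "CARD('n) = 16" and nsd: "\<not> self_dual C"
  shows "equivalent_codes C D"
proof -
  interpret A: framed_code \<alpha> C by fact
  interpret B: framed_code \<beta> D by fact
  define b where "b = \<beta> undefined"
  have pm: "\<alpha> i \<bullet> \<beta> j = 1/2 \<or> \<alpha> i \<bullet> \<beta> j = -1/2" for i j
    using half[of i j] by linarith
  have b: "\<alpha> i \<bullet> b = 1/2 \<or> \<alpha> i \<bullet> b = -1/2" for i
    unfolding b_def by (rule pm)
  define Js :: "bit ^ 'n" where "Js = (\<chi> k. of_bool (\<alpha> k \<bullet> b < 0))"
  have Js: "\<alpha> k \<bullet> b = sg (Js $ k) / 2" for k
    using b[of k] by (auto simp: Js_def)
  \<comment> \<open>\<open>2 *\<^sub>R b\<close> is a lattice vector all of whose coordinates are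
    odd.\<close>
  have ones: "ind UNIV \<in> C"
  proof -
    have "2 *\<^sub>R b \<in> A.L"
      unfolding b_def using B.Lat_frame_double eq by simp
    moreover have "(2 *\<^sub>R b) \<bullet> \<alpha> i = of_int (sg (Js $ i))" for i
      using Js[of i] by (cases "Js $ i") (auto simp: inner_commute)
    ultimately have "word (\<lambda>i. sg (Js $ i)) \<in> C"
      by (rule A.LatD)
    moreover have "word (\<lambda>i. sg (Js $ i)) = ind UNIV"
      by (simp add: vec_eq_iff sg_def)
    ultimately show ?thesis by simp
  qed
  \<comment> \<open>Differences of columns of the Hadamard matrix give words of \<open>C\<close>. If
    none of them separated \<open>i\<close> and \<open>j\<close>, the entrywise product of the rows
    \<open>i\<close> and \<open>j\<close> would be constant and the rows could not be
    orthogonal.\<close>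
  have sep: "separates C"
    unfolding separates_def
  proof (intro allI impI, rule ccontr)
    fix i j :: 'n assume "i \<noteq> j" and no: "\<not> (\<exists>c\<in>C. c $ i + c $ j = 1)"
    have same: "(\<alpha> i \<bullet> \<beta> l) * (\<alpha> j \<bullet> \<beta> l) = (\<alpha> i \<bullet> b) * (\<alpha> j \<bullet> b)" for l
    proof -
      define m :: "'n \<Rightarrow> int" where "m k = (if \<alpha> k \<bullet> \<beta> l = \<alpha> k \<bullet> b then 0 else if \<alpha> k \<bullet> b < 0 then 1 else -1)" for k
      have "(\<beta> l - b) \<bullet> \<alpha> k = of_int (m k)" for k
      proof -
        have "(\<beta> l - b) \<bullet> \<alpha> k = \<alpha> k \<bullet> \<beta> l - \<alpha> k \<bullet> b"
          by (simp only: inner_diff_left inner_commute[of "\<alpha> k"])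
        then show ?thesis
          using pm[of k l] b[of k] by (auto simp: m_def)
      qed
      moreover have "\<beta> l - b \<in> A.L"
        unfolding b_def eq by (rule B.Lat_frame_diff)
      ultimately have "word m \<in> C"
        by (intro A.LatD)
      then have "word m $ i + word m $ j \<noteq> 1"
        using no by blast
      then have "even (m i) = even (m j)"
        by (auto split: if_splits)
      then have "(\<alpha> i \<bullet> \<beta> l = \<alpha> i \<bullet> b) = (\<alpha> j \<bullet> \<beta> l = \<alpha> j \<bullet> b)"
        by (auto simp: m_def split: if_splits)
      then have "\<alpha> i \<bullet> \<beta> l = \<alpha> i \<bullet> b \<and> \<alpha> j \<bullet> \<beta> l = \<alpha> j \<bullet> b \<or>
          \<alpha> i \<bullet> \<beta> l = - (\<alpha> i \<bullet> b) \<and> \<alpha> j \<bullet> \<beta> l = - (\<alpha> j \<bullet> b)"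
        using pm[of i l] pm[of j l] b[of i] b[of j] by linarith
      then show ?thesis by auto
    qed
    have "\<alpha> i \<bullet> \<alpha> j = 8 * ((\<alpha> i \<bullet> b) * (\<alpha> j \<bullet> b))"
      unfolding frame_inner_eq[OF B.frame, of "\<alpha> i" "\<alpha> j"] same by (simp add: n)
    then show False
      using \<open>i \<noteq> j\<close> b[of i] b[of j] by (auto simp: frame_inner[OF A.frame])
  qed
  have Js_dual: "Js \<in> dual_code C"
  proof -
    have "code_inner Js c = 0" if c: "c \<in> C" for c
    proof -
      have "(1/2) *\<^sub>R (\<Sum>i\<in>supp c. \<alpha> i) \<in> A.L"
        by (rule A.half_in_Lat) (simp add: c)
      then have "((1/2) *\<^sub>R (\<Sum>i\<in>supp c. \<alpha> i)) \<bullet> b \<in> \<int>"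
        unfolding b_def eq by (rule B.Lat_frame_Ints)
      then obtain m where m: "((1/2) *\<^sub>R (\<Sum>i\<in>supp c. \<alpha> i)) \<bullet> b = of_int m"
        by (auto elim: Ints_cases)
      have "((1/2) *\<^sub>R (\<Sum>i\<in>supp c. \<alpha> i)) \<bullet> b = (\<Sum>k\<in>supp c. sg (Js $ k)) / 4"
        by (simp add: inner_sum_left Js sum_divide_distrib)
      also have "(\<Sum>k\<in>supp c. sg (Js $ k)) = real_of_int (\<Sum>k\<in>supp c. sg (Js $ k))"
        unfolding of_int_sum by (intro sum.cong) (auto simp: sg_def)
      finally have "real_of_int (\<Sum>k\<in>supp c. sg (Js $ k)) = of_int (4 * m)"
        using m by simp
      then have "(\<Sum>k\<in>supp c. sg (Js $ k)) = 4 * m"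
        by (simp only: of_int_eq_iff)
      moreover have "4 dvd weight c"
        using A.doubly_even c by (simp add: doubly_even_def)
      ultimately have "even (card (supp c \<inter> supp Js))"
        unfolding sum_sg weight_supp by presburger
      then show ?thesis
        by (simp add: code_inner_card Int_commute)
    qed
    then show ?thesis by (simp add: dual_code_def)
  qed
  obtain S where S: "S \<in> dual_code C" "S \<notin> C" "4 dvd weight S"
    by (rule ex_doubly_even_dual[OF n A.subspace A.doubly_even ones nsd])
  obtain J1 where J1: "J1 \<in> dual_code C" "code_inner J1 S = 1"
    by (rule dual_separates[OF A.subspace S(2)])
  define X where "X = (+) S ` C"
  have memX: "x \<in> X \<longleftrightarrow> S + x \<in> C" for x
  proof
    show "x \<in> X" if "S + x \<in> C"
      unfolding X_def by (rule image_eqI[OF _ that]) simp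
  qed (auto simp: X_def)
  have addX: "x + y \<in> C" if "x \<in> X" "y \<in> X" for x y
    using code_subspace_add[OF A.subspace, of "S + x" "S + y"] that
    by (simp add: memX vec_eq_iff add_ac)
  have wtC: "4 dvd weight c" if "c \<in> C" for c
    using A.doubly_even that by (simp add: doubly_even_def)
  have wtX: "4 dvd weight x" if x: "x \<in> X" for x
  proof -
    obtain c where c: "c \<in> C" "x = S + c" using x unfolding X_def by (rule imageE)
    have "even (card (supp S \<inter> supp c))"
      using dual_codeD[OF S(1) c(1)] by (simp add: code_inner_card split: if_splits)
    then show ?thesis
      using weight_add[of S c] S(3) wtC[OF c(1)] c(2) by presburger
  qed
  have X0: "0 \<notin> X"
    using S(2) by (simp add: memX)
  have m: "16 * (int (card (quads X)) - 2 * int (card {B \<in> quads X. i \<in> B})) = int (card C)" for i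
    using coset_quads[OF n A.subspace sep ones X_def wtX, of i] X0 by simp
  define q where "q = card {B \<in> quads X. undefined \<in> B}"
  have q: "card (quads X) = 4 * q" "card {B \<in> quads X. i \<in> B} = q" for i
    using card_quads_const(2)[OF n m, of i] card_quads_const(2)[OF n m, of undefined]
    by (simp_all add: q_def)
  have q0: "q > 0"
    using card_quads_const(1)[OF n m] q(1) code_subspace_0[OF A.subspace]
    by (auto simp: card_gt_0_iff intro!: Nat.gr0I)
  obtain s where s: "\<And>i. s i \<in> quads X" "\<And>i. i \<in> s i" "\<And>i j. j \<in> s i \<Longrightarrow> s j = s i"
  proof (rule partition_of_quads[OF n _ _ q(1) q0 q(2)])
    show "card Y = 4" if "Y \<in> quads X" for Y
      using that by (rule quadsD)
    show "even (card (Y \<inter> Z))" if "Y \<in> quads X" "Z \<in> quads X" for Y Z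
      using weight_add[of "ind Y" "ind Z"] wtC[OF addX[of "ind Y" "ind Z"]] that
      by (simp add: quads_def) presburger
    show "- (Y \<union> Z \<union> W) \<in> quads X" if Q: "Y \<in> quads X" "Z \<in> quads X" "W \<in> quads X"
      and disj: "Y \<inter> Z = {}" "Y \<inter> W = {}" "Z \<inter> W = {}" for Y Z W
    proof -
      have "card (Y \<union> Z \<union> W) = 12"
        using Q disj by (simp add: quads_def card_Un_disjoint Int_Un_distrib2)
      then have "card (- (Y \<union> Z \<union> W)) = 4"
        by (simp add: Compl_eq_Diff_UNIV card_Diff_subset n)
      moreover have "ind (- (Y \<union> Z \<union> W)) = ind UNIV + (ind Y + ind Z) + ind W"
        unfolding supp_inject[symmetric] supp_add supp_ind using disj by auto
      moreover have "S + (ind UNIV + (ind Y + ind Z) + ind W) = ind UNIV + ((ind Y + ind Z) + (S + ind W))"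
        by (simp only: ac_simps)
      moreover have "\<dots> \<in> C"
      proof -
        have "ind Y + ind Z \<in> C" "S + ind W \<in> C"
          using Q addX by (simp_all add: quads_def memX)
        then show ?thesis
          using code_subspace_add[OF A.subspace] ones by blast
      qed
      ultimately show ?thesis
        unfolding quads_def memX mem_Collect_eq by (simp only: simp_thms)
    qed
  qed (rule that)
  have s_eq: "\<exists>c\<in>C. ind (s i) = S + c" for i
    using s(1)[of i] by (auto simp: quads_def X_def)
  \<comment> \<open>In the product of a glue vector with \<open>b\<close> the signs from
    \<open>Js\<close> cancel and those of \<open>J1\<close> remain. Every block lies in the coset of
    \<open>S\<close>, so \<open>J1\<close> meets it in one or three points and the product is
    \<open>\<plusminus>1/2\<close>: just what makes the products of the switched frame with
    \<open>b\<close> integral.\<close>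
  interpret W: block_system \<alpha> C s "Js + J1"
  proof
    show "ind (s i) \<in> dual_code C" for i
      using s_eq[of i] S(1) doubly_even_subset_dual[OF A.subspace A.doubly_even]
        code_subspace_add[OF subspace_dual_code] by fastforce
    show "ind (s i) + ind (s j) \<in> C" for i j
      using addX s(1) by (simp add: quads_def)
    show "Js + J1 \<in> dual_code C"
      by (rule code_subspace_add[OF subspace_dual_code Js_dual J1(1)])
    show "card (s i) = 4" for i
      using s(1) by (rule quadsD)
  qed (use s in auto)
  have gb: "W.glue i \<bullet> b = 1/2 \<or> W.glue i \<bullet> b = -1/2" for i
  proof -
    have "W.glue i \<bullet> b = (\<Sum>k\<in>s i. sg ((Js + J1) $ k) / 2 * (sg (Js $ k) / 2))"
      by (simp only: W.glue_def inner_sum_left inner_scaleR_left Js)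
    also have "\<dots> = (\<Sum>k\<in>s i. real_of_int (sg (J1 $ k)) / 4)"
      by (intro sum.cong refl) (simp only: vector_add_component sg_add, simp add: sg_def)
    also have "\<dots> = real_of_int (\<Sum>k\<in>s i. sg (J1 $ k)) / 4"
      by (simp add: sum_divide_distrib)
    finally have gl: "W.glue i \<bullet> b = real_of_int (4 - 2 * int (card (s i \<inter> supp J1))) / 4"
      by (simp add: sum_sg W.block_card)
    obtain c where c: "c \<in> C" "ind (s i) = S + c" using s_eq by blast
    have "code_inner J1 (ind (s i)) = 1"
      using J1(2) dual_codeD[OF J1(1) c(1)] unfolding c(2) code_inner_add_right by simp
    then have "odd (card (s i \<inter> supp J1))"
      by (simp add: code_inner_card Int_commute split: if_splits)
    moreover have "card (s i \<inter> supp J1) \<le> 4"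
      using W.block_card[of i] card_mono[of "s i" "s i \<inter> supp J1"] by auto
    ultimately have "card (s i \<inter> supp J1) = 1 \<or> card (s i \<inter> supp J1) = 3"
      by presburger
    then show ?thesis using gl by auto
  qed
  have "W.switch i \<bullet> \<beta> j \<in> \<int>" for i j
  proof -
    have "W.switch i \<bullet> b = \<alpha> i \<bullet> b - sg ((Js + J1) $ i) * (W.glue i \<bullet> b)"
      by (simp only: W.switch_def inner_diff_left inner_scaleR_left)
    moreover have "sg ((Js + J1) $ i) * (W.glue i \<bullet> b) = W.glue i \<bullet> b \<or>
        sg ((Js + J1) $ i) * (W.glue i \<bullet> b) = - (W.glue i \<bullet> b)"
      by (simp add: sg_def)
    ultimately have "W.switch i \<bullet> b = 0 \<or> W.switch i \<bullet> b = 1 \<or> W.switch i \<bullet> b = -1"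
      using gb[of i] b[of i] by linarith
    then have "W.switch i \<bullet> b \<in> \<int>"
      by auto
    moreover have "(\<beta> j - b) \<bullet> W.switch i \<in> \<int>"
    proof -
      interpret S: framed_code W.switch C by (rule W.framed_switch)
      have "\<beta> j - b \<in> Lat W.switch C"
        unfolding W.Lat_switch b_def eq by (rule B.Lat_frame_diff)
      then show ?thesis by (rule S.Lat_frame_Ints)
    qed
    ultimately have "W.switch i \<bullet> b + (\<beta> j - b) \<bullet> W.switch i \<in> \<int>"
      by (rule Ints_add)
    then show ?thesis
      by (simp add: inner_diff_left inner_commute[of "W.switch i"])
  qed
  then show ?thesis
    using equivalent_of_integral[OF W.framed_switch B] eq by (simp add: W.Lat_switch)
qed

text \<open>Sums of two vectors of one frame have integral products with the other frame, so one
  integral product forces all. Otherwise the doubled products \<open>w i j\<close> are odd integers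
  with square sum 16 over \<open>i\<close>, as \<open>\<beta> j\<close> has norm 2. Either a
  \<open>\<plusminus>3\<close> occurs, or all are \<open>\<plusminus>1\<close> and there are 16
  coordinates.\<close>

lemma equivalent_or_self_dual:
  fixes \<alpha> \<beta> :: "'n::finite \<Rightarrow> real ^ 'n"
  assumes A: "framed_code \<alpha> C" and B: "framed_code \<beta> D" and eq: "Lat \<alpha> C = Lat \<beta> D"
  shows "equivalent_codes C D \<or> CARD('n) = 16 \<and> self_dual C \<and> self_dual D"
proof -
  interpret A: framed_code \<alpha> C by fact
  interpret B: framed_code \<beta> D by fact
  have r: "(\<alpha> i + \<alpha> k) \<bullet> \<beta> j \<in> \<int>" for i j k
    using B.Lat_frame_Ints A.Lat_frame_add eq by blast
  have c: "(\<beta> j + \<beta> l) \<bullet> \<alpha> i \<in> \<int>" for i j l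
    using A.Lat_frame_Ints B.Lat_frame_add eq by blast
  consider (int) "\<And>i j. \<alpha> i \<bullet> \<beta> j \<in> \<int>" | (half) "\<And>i j. \<alpha> i \<bullet> \<beta> j \<notin> \<int>"
  proof (cases "\<exists>i j. \<alpha> i \<bullet> \<beta> j \<in> \<int>")
    case True
    then obtain i j where ij: "\<alpha> i \<bullet> \<beta> j \<in> \<int>" by blast
    have "\<alpha> k \<bullet> \<beta> l \<in> \<int>" for k l
    proof -
      have "(\<alpha> i + \<alpha> k) \<bullet> \<beta> j - \<alpha> i \<bullet> \<beta> j \<in> \<int>"
        using r ij by (rule Ints_diff)
      then have "\<alpha> k \<bullet> \<beta> j \<in> \<int>" by (simp add: inner_add_left)
      then have "(\<beta> j + \<beta> l) \<bullet> \<alpha> k - \<alpha> k \<bullet> \<beta> j \<in> \<int>"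
        using c by (intro Ints_diff)
      then show ?thesis by (simp add: inner_add_left inner_commute[of "\<alpha> k"])
    qed
    then show ?thesis by (rule int)
  qed (use half in blast)
  then show ?thesis
  proof cases
    case int
    then show ?thesis using equivalent_of_integral[OF A B eq] by blast
  next
    case half
    have "\<exists>w. 2 * (\<alpha> i \<bullet> \<beta> j) = of_int w \<and> odd w" for i j
    proof -
      have "\<alpha> i \<bullet> \<beta> j + \<alpha> i \<bullet> \<beta> j \<in> \<int>"
        using r[of i i j] by (simp only: inner_add_left)
      then obtain w where "\<alpha> i \<bullet> \<beta> j + \<alpha> i \<bullet> \<beta> j = of_int w"
        by (rule Ints_cases)
      then have w: "2 * (\<alpha> i \<bullet> \<beta> j) = of_int w"
        by simp
      have "odd w"
      proof
        assume "even w"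
        then obtain v where "w = 2 * v" ..
        then have "\<alpha> i \<bullet> \<beta> j = of_int v" using w by simp
        then show False using half[of i j] by simp
      qed
      then show ?thesis using w by blast
    qed
    then obtain w where w: "\<And>i j. 2 * (\<alpha> i \<bullet> \<beta> j) = of_int (w i j)" "\<And>i j. odd (w i j)"
      by metis
    have sum16: "(\<Sum>i\<in>UNIV. (w i j)\<^sup>2) = 16" for j
    proof -
      have "(\<Sum>i\<in>UNIV. (\<alpha> i \<bullet> \<beta> j)\<^sup>2) = 4"
        using frame_inner_eq[OF A.frame, of "\<beta> j" "\<beta> j"]
        by (simp add: frame_inner[OF B.frame] power2_eq_square inner_commute[of "\<beta> j"])
      moreover have "of_int ((w i j)\<^sup>2) = 4 * (\<alpha> i \<bullet> \<beta> j)\<^sup>2" for i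
        by (simp flip: w(1) add: power_mult_distrib)
      then have "real_of_int (\<Sum>i\<in>UNIV. (w i j)\<^sup>2) = 4 * (\<Sum>i\<in>UNIV. (\<alpha> i \<bullet> \<beta> j)\<^sup>2)"
        unfolding of_int_sum sum_distrib_left by (intro sum.cong refl)
      ultimately have "real_of_int (\<Sum>i\<in>UNIV. (w i j)\<^sup>2) = real_of_int 16"
        by simp
      then show ?thesis by (simp only: of_int_eq_iff)
    qed
    have w13: "\<bar>w i j\<bar> = 1 \<or> \<bar>w i j\<bar> = 3" for i j
    proof -
      have "(w i j)\<^sup>2 \<le> 4\<^sup>2"
        using member_le_sum[of i UNIV "\<lambda>i. (w i j)\<^sup>2"] sum16[of j] by simp
      then have "\<bar>w i j\<bar> \<le> 4"
        using abs_le_square_iff[of "w i j" 4] by simp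
      then show ?thesis using w(2)[of i j] by presburger
    qed
    show ?thesis
    proof (cases "\<exists>i j. \<bar>w i j\<bar> = 3")
      case True
      then obtain i j where "\<bar>w i j\<bar> = 3" by blast
      then have "\<bar>\<alpha> i \<bullet> \<beta> j\<bar> = 3/2"
        using w(1)[of i j] by linarith
      then show ?thesis using equivalent_of_three_halves[OF A B eq] by blast
    next
      case False
      then have w1: "\<bar>w i j\<bar> = 1" for i j
        using w13 by blast
      then have "(w i j)\<^sup>2 = 1" for i j
        by (metis one_power2 power2_abs)
      then have n: "CARD('n) = 16"
        using sum16 by simp
      have h: "\<bar>\<alpha> i \<bullet> \<beta> j\<bar> = 1/2" for i j
        using w(1)[of i j] w1[of i j] by linarith
      have h': "\<bar>\<beta> i \<bullet> \<alpha> j\<bar> = 1/2" for i j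
        using h[of j i] by (simp add: inner_commute)
      \<comment> \<open>Used in both directions, so that failure of self-duality on either side
        gives equivalence.\<close>
      show ?thesis
        using equivalent_of_halves[OF A B eq h n] equivalent_of_halves[OF B A eq[symmetric] h' n]
          equivalent_codes_sym n by blast
    qed
  qed
qed

section \<open>Self-dual codes of length 16\<close>

definition octads :: "(real ^ 'n) set \<Rightarrow> (real ^ 'n) set \<Rightarrow> bool" where
  "octads E F \<longleftrightarrow> card E = 8 \<and> card F = 8 \<and> E \<inter> F = {} \<and>
    (\<forall>e\<in>E \<union> F. \<forall>f\<in>E \<union> F. e \<bullet> f = (if e = f then 1 else 0))"

text \<open>With \<open>h = 0\<close> the even sums describe \<open>D\<^sub>8\<close> on each half.
  With \<open>h = 1/2\<close> one gets the coset of the vector with all coordinates 1/2, whose half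
  sums are 4.\<close>

definition glued :: "(real ^ 'n) set \<Rightarrow> (real ^ 'n) set \<Rightarrow> (real ^ 'n) set" where
  "glued E F = {x. (\<exists>h\<in>{0, 1/2}. \<forall>e\<in>E \<union> F. x \<bullet> e - h \<in> \<int>) \<and>
    (\<exists>k::int. (\<Sum>e\<in>E. x \<bullet> e) = 2 * of_int k) \<and> (\<exists>k::int. (\<Sum>e\<in>F. x \<bullet> e) = 2 * of_int k)}"

text \<open>\<open>glued\<close> refers to the two orthonormal halves only through inner products
  and sums, so any bijection respecting the halves extends to the required isometry.\<close>

lemma octads_iso:
  fixes E F E' F' :: "(real ^ 'n::finite) set"
  assumes n: "CARD('n) = 16" and o: "octads E F" and o': "octads E' F'"
  shows "lattice_iso (glued E F) (glued E' F')"
proof -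
  have fin: "finite E" "finite F" "finite E'" "finite F'"
    using o o' by (auto simp: octads_def card_ge_0_finite)
  obtain g1 g2 where g1: "bij_betw g1 E E'" and g2: "bij_betw g2 F F'"
    using finite_same_card_bij fin o o' by (metis octads_def)
  define g where "g e = (if e \<in> E then g1 e else g2 e)" for e
  have gE: "bij_betw g E E'"
    using g1 by (rule bij_betw_cong[THEN iffD1, rotated]) (simp add: g_def)
  have gF: "bij_betw g F F'"
    using g2 by (rule bij_betw_cong[THEN iffD1, rotated]) (use o in \<open>auto simp: g_def octads_def\<close>)
  have g: "bij_betw g (E \<union> F) (E' \<union> F')"
    using gE gF by (rule bij_betw_combine) (use o' in \<open>simp add: octads_def\<close>)
  have expand: "(\<Sum>e\<in>E \<union> F. (x \<bullet> e) *\<^sub>R e) = x" if "octads E F" for x and E F :: "(real ^ 'n) set"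
  proof (rule orthonormal_basis_expand)
    have ip: "e \<bullet> f = (if e = f then 1 else 0)" if "e \<in> E \<union> F" "f \<in> E \<union> F" for e f
      using \<open>octads E F\<close> that unfolding octads_def by blast
    show orth: "pairwise orthogonal (E \<union> F)"
      using ip by (simp add: pairwise_def orthogonal_def)
    show "norm e = 1" if "e \<in> E \<union> F" for e
      using ip[OF that that] by (simp add: norm_eq_1)
    show fin: "finite (E \<union> F)"
      using that by (auto simp: octads_def card_ge_0_finite)
    have "0 \<notin> E \<union> F"
      using ip[of 0 0] by auto
    then have "independent (E \<union> F)"
      using orth by (rule pairwise_orthogonal_independent[rotated])
    moreover have "card (E \<union> F) = DIM(real ^ 'n)"
      using that fin by (simp add: octads_def card_Un_disjoint n)
    ultimately show "x \<in> span (E \<union> F)"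
      by (metis card_ge_dim_independent dim_UNIV order_refl subset_UNIV subsetD UNIV_I)
  qed
  define f where "f x = (\<Sum>e\<in>E \<union> F. (x \<bullet> e) *\<^sub>R g e)" for x
  have fg: "f x \<bullet> g e = x \<bullet> e" if e: "e \<in> E \<union> F" for x e
  proof -
    have gg: "g d \<bullet> g e = (if d = e then 1 else 0)" if "d \<in> E \<union> F" for d
    proof -
      have "g d \<in> E' \<union> F'" "g e \<in> E' \<union> F'"
        using g that e by (auto dest: bij_betwE)
      then have "g d \<bullet> g e = (if g d = g e then 1 else 0)"
        using o' unfolding octads_def by blast
      then show ?thesis
        using g that e by (metis bij_betw_imp_inj_on inj_on_eq_iff)
    qed
    have "f x \<bullet> g e = (\<Sum>d\<in>E \<union> F. if d = e then x \<bullet> e else 0)"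
      unfolding f_def inner_sum_left by (intro sum.cong) (auto simp: gg)
    then show ?thesis using e fin by simp
  qed
  have "linear f"
    by (rule linearI)
      (simp_all add: f_def inner_add_left scaleR_add_left sum.distrib scaleR_sum_right)
  moreover have "f v \<bullet> f w = v \<bullet> w" for v w
  proof -
    have "f v \<bullet> f w = (\<Sum>e\<in>E \<union> F. (v \<bullet> e) * (w \<bullet> e))"
      unfolding f_def[of v] inner_sum_left by (intro sum.cong refl) (simp add: fg inner_commute[of "g _"])
    also have "\<dots> = (\<Sum>e\<in>E \<union> F. (v \<bullet> e) *\<^sub>R e) \<bullet> w"
      unfolding inner_sum_left by (intro sum.cong refl) (simp add: inner_commute)
    finally show ?thesis by (simp add: expand[OF o])
  qed
  ultimately have f: "orthogonal_transformation f"
    by (simp add: orthogonal_transformation_def)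
  have "(f x \<in> glued E' F') = (x \<in> glued E F)" for x
  proof -
    have all: "(\<forall>e\<in>E' \<union> F'. f x \<bullet> e - h \<in> \<int>) = (\<forall>e\<in>E \<union> F. x \<bullet> e - h \<in> \<int>)" for h
      unfolding bij_betw_imp_surj_on[OF g, symmetric] ball_simps by (simp add: fg ball_Un)
    have sE: "(\<Sum>e\<in>E'. f x \<bullet> e) = (\<Sum>e\<in>E. x \<bullet> e)"
      unfolding sum.reindex_bij_betw[OF gE, symmetric] by (intro sum.cong) (simp_all add: fg)
    have sF: "(\<Sum>e\<in>F'. f x \<bullet> e) = (\<Sum>e\<in>F. x \<bullet> e)"
      unfolding sum.reindex_bij_betw[OF gF, symmetric] by (intro sum.cong) (simp_all add: fg)
    show ?thesis
      unfolding glued_def mem_Collect_eq all sE sF ..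
  qed
  then have "f -` glued E' F' = glued E F"
    by auto
  then have "f ` glued E F = glued E' F'"
    using surj_image_vimage_eq[OF orthogonal_transformation_surj[OF f]] by metis
  then show ?thesis
    using f by (auto simp: lattice_iso_def)
qed

section \<open>Weight-four words of a self-dual code\<close>

locale self_dual_code = framed_code \<alpha> C
  for \<alpha> :: "'n::finite \<Rightarrow> real ^ 'n" and C :: "(bit ^ 'n) set" +
  assumes n16: "CARD('n) = 16" and self_dual: "self_dual C"
begin

lemma mem_dual: "x \<in> C \<longleftrightarrow> (\<forall>c\<in>C. code_inner x c = 0)"
  using self_dual by (auto simp: self_dual_def dual_code_def)

lemma code_even: "c \<in> C \<Longrightarrow> word z \<in> C \<Longrightarrow> even (sum z (supp c))"
  using dual_code_even[of "supp c" C z] self_dual by (simp add: self_dual_def)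

lemma code_inter_even: "c \<in> C \<Longrightarrow> d \<in> C \<Longrightarrow> even (card (supp c \<inter> supp d))"
  using mem_dual[of c] by (auto simp: code_inner_card split: if_splits)

lemma weight_4: "c \<in> C \<Longrightarrow> 4 dvd weight c"
  using doubly_even by (simp add: doubly_even_def)

lemma ones: "ind UNIV \<in> C"
  unfolding mem_dual
proof
  fix c assume "c \<in> C"
  then have "even (card (supp c))"
    using weight_4[of c] by (simp add: weight_supp) presburger
  then show "code_inner (ind UNIV) c = 0"
    by (simp add: code_inner_card)
qed

lemma compl_in: "c \<in> C \<Longrightarrow> ind UNIV + c \<in> C"
  by (rule code_subspace_add[OF subspace ones])

lemma sep: "separates C"
  unfolding separates_def
proof (intro allI impI, rule ccontr)
  fix i j :: 'n assume ij: "i \<noteq> j" and no: "\<not> (\<exists>c\<in>C. c $ i + c $ j = 1)"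
  have "code_inner (ind {i, j}) c = 0" if "c \<in> C" for c
  proof -
    have "c $ i + c $ j \<noteq> 1" using no that by blast
    then show ?thesis using ij by (simp add: code_inner_ind_sum)
  qed
  then have "ind {i, j} \<in> C" using mem_dual by blast
  then have "4 dvd card {i, j}" using weight_4 by fastforce
  moreover have "card {i, j} = 2" using ij by simp
  ultimately show False by simp
qed

lemma card_C: "card C = 256"
  by (rule card_self_dual[OF n16 subspace doubly_even self_dual])

text \<open>The zero word accounts for 32 of the 256, leaving 224, which is 8 times the number of
  quads; a quarter of them pass through each point.\<close>

lemma quads_count: "card (quads C) = 28" "card {B \<in> quads C. i \<in> B} = 7"
proof -
  have C: "C = (+) 0 ` C" by simp
  have "16 * (int (card (quads C)) - 2 * int (card {B \<in> quads C. i \<in> B})) = 224" for i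
    using coset_quads[OF n16 subspace sep ones C weight_4, of i] code_subspace_0[OF subspace]
    by (simp add: card_C)
  note * = card_quads_const[OF n16 this]
  show "card (quads C) = 28" using *(1) by simp
  then show "card {B \<in> quads C. i \<in> B} = 7" using *(2)[of i] by simp
qed

lemma quads_inter:
  assumes "A \<in> quads C" "B \<in> quads C" "A \<noteq> B" "A \<inter> B \<noteq> {}"
  shows "card (A \<inter> B) = 2"
proof -
  have "even (card (A \<inter> B))"
    using code_inter_even[of "ind A" "ind B"] assms by (simp add: quads_def)
  moreover have "A \<inter> B \<subset> A"
    using assms by (metis card_subset_eq finite inf.absorb_iff2 inf.order_iff inf_le1 psubsetI quadsD(1))
  then have "card (A \<inter> B) < 4"
    using assms(1) psubset_card_mono[of A] by (simp add: quads_def)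
  moreover have "card (A \<inter> B) \<noteq> 0"
    using assms(4) by simp
  ultimately show ?thesis by presburger
qed


section \<open>Codes whose coordinates split into pairs\<close>

lemma code_inner_word_supp: "code_inner (word z) d = of_bool (odd (sum z (supp d)))"
  using code_inner_ind_word[of "supp d" z] by (simp add: code_inner_commute)

text \<open>If some pair \<open>{i, j}\<close> lies in all seven quads through \<open>i\<close>, the code is of type \<open>d\<^sub>1\<^sub>6\<close>:
  the coordinates split into pairs any two of which form a quad.\<close>

lemma glued_of_pairs:
  assumes \<P>: "\<Union>\<P> = UNIV" "disjoint \<P>" "\<And>p. p \<in> \<P> \<Longrightarrow> card p = 2"
    and pq: "\<And>p q. p \<in> \<P> \<Longrightarrow> q \<in> \<P> \<Longrightarrow> p \<noteq> q \<Longrightarrow> ind (p \<union> q) \<in> C"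
    and t: "t \<in> C" "\<And>p. p \<in> \<P> \<Longrightarrow> card (p \<inter> supp t) = 1"
  shows "\<exists>E F. octads E F \<and> L = glued E F"
proof -
  have fin: "finite p" for p :: "'n set" by simp
  have sum_pairs: "(\<Sum>i\<in>UNIV. f i) = (\<Sum>p\<in>\<P>. sum f p)" for f :: "'n \<Rightarrow> 'b::comm_monoid_add"
    unfolding \<P>(1)[symmetric] using \<P>(2) by (subst sum.Union_disjoint) (auto simp: disjoint_def)
  have disj: "p \<inter> q = {}" if "p \<in> \<P>" "q \<in> \<P>" "p \<noteq> q" for p q
    using \<P>(2) that by (auto simp: disjoint_def)
  have "card \<P> = 8"
  proof -
    have "(\<Sum>i\<in>(UNIV :: 'n set). 1 :: nat) = (\<Sum>p\<in>\<P>. sum (\<lambda>_. 1) p)" by (rule sum_pairs)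
    then show ?thesis using \<P>(3) by (simp add: n16)
  qed
  \<comment> \<open>\<open>ep\<close> and \<open>em\<close> are half the sum and, up to sign, half
    the difference of the two frame vectors of a pair; \<open>t\<close> meets each pair once and
    orients the differences.\<close>
  define ep where "ep p = (\<Sum>a\<in>p. (1/2) *\<^sub>R \<alpha> a)" for p
  define em where "em p = (\<Sum>a\<in>p. (sg (t $ a) / 2) *\<^sub>R \<alpha> a)" for p
  have ep\<alpha>: "ep p \<bullet> \<alpha> i = of_bool (i \<in> p)" for p i
    unfolding ep_def frame_sum_inner[OF frame] by simp
  have em\<alpha>: "em p \<bullet> \<alpha> i = of_bool (i \<in> p) * sg (t $ i)" for p i
    unfolding em_def frame_sum_inner[OF frame] by simp
  have x_ep: "x \<bullet> ep p = (\<Sum>a\<in>p. x \<bullet> \<alpha> a) / 2" for x p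
    by (simp add: ep_def inner_sum_right sum_divide_distrib)
  have x_em: "x \<bullet> em p = (\<Sum>a\<in>p. sg (t $ a) * (x \<bullet> \<alpha> a)) / 2" for x p
    by (simp add: em_def inner_sum_right sum_divide_distrib)
  have sum_t: "(\<Sum>a\<in>p. sg (t $ a)) = (0::real)" if "p \<in> \<P>" for p
  proof -
    have "(\<Sum>a\<in>p. sg (t $ a)) = real_of_int (\<Sum>a\<in>p. sg (t $ a))"
      unfolding of_int_sum by (intro sum.cong) (auto simp: sg_def)
    then show ?thesis
      using that by (simp add: sum_sg \<P>(3) t(2))
  qed
  have pp: "ep p \<bullet> ep q = (if p = q then 1 else 0)" if "p \<in> \<P>" "q \<in> \<P>" for p q
  proof -
    have "ep p \<bullet> ep q = (\<Sum>a\<in>q. if p = q then 1 else 0) / 2"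
      unfolding x_ep ep\<alpha> using disj[OF that]
      by (intro arg_cong[where f = "\<lambda>x. x / 2"] sum.cong) auto
    then show ?thesis using \<P>(3)[OF that(2)] by simp
  qed
  have mm: "em p \<bullet> em q = (if p = q then 1 else 0)" if "p \<in> \<P>" "q \<in> \<P>" for p q
  proof -
    have "em p \<bullet> em q = (\<Sum>a\<in>q. if p = q then 1 else 0) / 2"
      unfolding x_em em\<alpha> using disj[OF that]
      by (intro arg_cong[where f = "\<lambda>x. x / 2"] sum.cong) (auto simp: mult.left_commute)
    then show ?thesis using \<P>(3)[OF that(2)] by simp
  qed
  have pm: "ep p \<bullet> em q = 0" if "p \<in> \<P>" "q \<in> \<P>" for p q
  proof (cases "p = q")
    case True
    then show ?thesis
      using sum_t[OF that(2)] by (simp add: x_em ep\<alpha>)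
  next
    case False
    then show ?thesis
      using disj[OF that False] by (auto simp: x_em ep\<alpha> intro!: sum.neutral)
  qed
  have inj: "inj_on ep \<P>" "inj_on em \<P>"
    using pp mm by (auto intro!: inj_onI) (metis zero_neq_one)+
  have oct: "octads (ep ` \<P>) (em ` \<P>)"
  proof -
    have "ep ` \<P> \<inter> em ` \<P> = {}"
    proof (rule ccontr)
      assume "ep ` \<P> \<inter> em ` \<P> \<noteq> {}"
      then obtain p q where "p \<in> \<P>" "q \<in> \<P>" "ep p = em q" by blast
      then show False using pm[of p q] pp[of p p] by simp
    qed
    moreover have "e \<bullet> f = (if e = f then 1 else 0)" if "e \<in> ep ` \<P>" "f \<in> ep ` \<P>" for e f
      using that pp inj(1) by (auto simp: inj_on_eq_iff)
    moreover have "e \<bullet> f = (if e = f then 1 else 0)" if "e \<in> em ` \<P>" "f \<in> em ` \<P>" for e f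
      using that mm inj(2) by (auto simp: inj_on_eq_iff)
    moreover have "e \<bullet> f = 0" "f \<bullet> e = 0" if "e \<in> ep ` \<P>" "f \<in> em ` \<P>" for e f
      using that pm by (auto simp: inner_commute)
    ultimately show ?thesis
      unfolding octads_def by (auto simp: card_image inj \<open>card \<P> = 8\<close>)
  qed
  have other: "\<alpha> a = ep p + sg (t $ a) *\<^sub>R em p" if p: "p \<in> \<P>" "a \<in> p" for p a
  proof (rule frame_eqI[OF frame])
    fix i
    obtain b where b: "p = {a, b}" "a \<noteq> b"
      using \<P>(3)[OF p(1)] p(2) by (auto simp: card_2_iff)
    have "sg (t $ a) + sg (t $ b) = (0::real)"
      using sum_t[OF p(1)] b by simp
    moreover have "sg (t $ a) * sg (t $ a) = (1::real)" by simp
    ultimately have "sg (t $ b) = - (sg (t $ a) :: real)" "sg (t $ a) * sg (t $ b) = (-1::real)"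
      by (simp_all add: add_eq_0_iff)
    then show "\<alpha> a \<bullet> \<alpha> i = (ep p + sg (t $ a) *\<^sub>R em p) \<bullet> \<alpha> i"
      using b by (auto simp: inner_add_left ep\<alpha> em\<alpha> frame_inner[OF frame])
  qed
  \<comment> \<open>The common parity of the pair sums decides between integral and half-integral
    coordinates.\<close>
  have parity: "even (sum z p) = even (sum z q)" if z: "word z \<in> C" "p \<in> \<P>" "q \<in> \<P>" for z p q
  proof (cases "p = q")
    case False
    have "even (sum z (p \<union> q))"
      using code_even[OF pq[OF z(2,3) False] z(1)] by simp
    then show ?thesis
      using disj[OF z(2,3) False] by (simp add: sum.union_disjoint)
  qed simp
  have "L = glued (ep ` \<P>) (em ` \<P>)"
  proof (intro equalityI subsetI)
    fix x assume x: "x \<in> L"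
    then obtain z where z: "\<And>i. x \<bullet> \<alpha> i = of_int (z i)" "word z \<in> C" "4 dvd sum z UNIV"
      by (metis LatE)
    obtain p0 where p0: "p0 \<in> \<P>" using \<open>card \<P> = 8\<close> by fastforce
    define H :: int where "H = (if even (sum z p0) then 0 else 1)"
    define N M where "N p = sum z p" and "M p = (\<Sum>a\<in>p. sg (t $ a) * z a)" for p
    have N: "even (N p - H)" if "p \<in> \<P>" for p
      using parity[OF z(2) that p0] by (simp add: N_def H_def)
    have MN: "even (M p - N p)" for p
      unfolding M_def N_def sum_subtractf[symmetric] by (intro dvd_sum) (auto simp: sg_def)
    have M: "even (M p - H)" if "p \<in> \<P>" for p
      using N[OF that] MN[of p] by presburger
    have xp: "x \<bullet> ep p = of_int (N p) / 2" for p
      by (simp add: x_ep z(1) N_def)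
    have xm: "x \<bullet> em p = of_int (M p) / 2" for p
    proof -
      have "(\<Sum>a\<in>p. sg (t $ a) * (x \<bullet> \<alpha> a)) = of_int (M p)"
        unfolding M_def of_int_sum z(1) by (intro sum.cong) (auto simp: sg_def)
      then show ?thesis by (simp add: x_em)
    qed
    have half: "of_int k / 2 - of_int H / 2 \<in> (\<int> :: real set)" if k: "even (k - H)" for k
    proof -
      obtain m where "k - H = 2 * m" using k ..
      then have "k = 2 * m + H" by simp
      then have "of_int k / 2 - of_int H / 2 = (of_int m :: real)"
        by (simp add: field_simps)
      then show ?thesis by simp
    qed
    have int: "x \<bullet> e - of_int H / 2 \<in> \<int>" if "e \<in> ep ` \<P> \<union> em ` \<P>" for e
      using that half[OF N] half[OF M] by (auto simp: xp xm)
    have sum_t_z: "(\<Sum>a\<in>UNIV. sg (t $ a) * z a) = sum z UNIV - 2 * sum z (supp t)"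
    proof -
      have "(\<Sum>a\<in>UNIV. sg (t $ a) * z a) = (\<Sum>a\<in>UNIV. z a - 2 * (if a \<in> supp t then z a else 0))"
        by (intro sum.cong) (auto simp: sg_def mem_supp)
      then show ?thesis
        by (simp add: sum_subtractf flip: sum_distrib_left sum.inter_filter)
    qed
    obtain k where k: "sum z UNIV = 4 * k"
      using z(3) by (rule dvdE)
    \<comment> \<open>The signs of \<open>t\<close> change the total by twice a sum over a word of
      \<open>C\<close>, hence by a multiple of 4.\<close>
    obtain l where l: "sum z UNIV - 2 * sum z (supp t) = 4 * l"
    proof (rule dvdE)
      show "4 dvd sum z UNIV - 2 * sum z (supp t)"
        using z(3) code_even[OF t(1) z(2)] by presburger
    qed
    have "(\<Sum>e\<in>ep ` \<P>. x \<bullet> e) = of_int (sum z UNIV) / 2"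
      unfolding sum_pairs sum.reindex[OF inj(1)] by (simp add: xp N_def sum_divide_distrib)
    then have p_sum: "(\<Sum>e\<in>ep ` \<P>. x \<bullet> e) = 2 * of_int k"
      unfolding k by simp
    have "(\<Sum>e\<in>em ` \<P>. x \<bullet> e) = of_int (\<Sum>a\<in>UNIV. sg (t $ a) * z a) / 2"
      unfolding sum_pairs sum.reindex[OF inj(2)] by (simp add: xm M_def sum_divide_distrib)
    then have m_sum: "(\<Sum>e\<in>em ` \<P>. x \<bullet> e) = 2 * of_int l"
      unfolding sum_t_z l by simp
    show "x \<in> glued (ep ` \<P>) (em ` \<P>)"
      unfolding glued_def mem_Collect_eq
    proof (intro conjI)
      show "\<exists>h\<in>{0, 1/2}. \<forall>e\<in>ep ` \<P> \<union> em ` \<P>. x \<bullet> e - h \<in> \<int>"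
        using int by (intro bexI[of _ "of_int H / 2"] ballI) (simp_all add: H_def)
    qed (use p_sum m_sum in blast)+
  next
    fix x assume "x \<in> glued (ep ` \<P>) (em ` \<P>)"
    then obtain h k l where h: "h \<in> {0, 1/2}" "\<And>e. e \<in> ep ` \<P> \<union> em ` \<P> \<Longrightarrow> x \<bullet> e - h \<in> \<int>"
      and k: "(\<Sum>e\<in>ep ` \<P>. x \<bullet> e) = 2 * of_int k" and l: "(\<Sum>e\<in>em ` \<P>. x \<bullet> e) = 2 * of_int l"
      unfolding glued_def by blast
    have kp: "(\<Sum>p\<in>\<P>. x \<bullet> ep p) = 2 * of_int k" and lp: "(\<Sum>p\<in>\<P>. x \<bullet> em p) = 2 * of_int l"
      using k l by (simp_all add: sum.reindex inj)
    obtain H :: int where H: "2 * h = of_int H" using h(1) by fastforce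
    have "x \<bullet> \<alpha> a \<in> \<int>" for a
    proof -
      have "a \<in> \<Union>\<P>" unfolding \<P>(1) by (rule UNIV_I)
      then obtain p where p: "p \<in> \<P>" "a \<in> p" by (auto elim: UnionE)
      have i: "x \<bullet> ep p - h \<in> \<int>" "x \<bullet> em p - h \<in> \<int>" using h(2) p(1) by auto
      have eq: "x \<bullet> \<alpha> a = x \<bullet> ep p + sg (t $ a) * (x \<bullet> em p)"
        by (subst other[OF p]) (simp add: inner_add_right)
      show ?thesis
      proof (cases "t $ a = 0")
        case True
        have "(x \<bullet> ep p - h) + (x \<bullet> em p - h) + of_int H \<in> \<int>"
          using i by (intro Ints_add) auto
        then show ?thesis using H by (simp add: eq True algebra_simps)
      next
        case False
        have "(x \<bullet> ep p - h) - (x \<bullet> em p - h) \<in> \<int>"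
          using i by (rule Ints_diff)
        then show ?thesis using False by (simp add: eq sg_def)
      qed
    qed
    then obtain z where z: "\<And>i. x \<bullet> \<alpha> i = of_int (z i)"
      using Ints_coords by blast
    have N: "real_of_int (sum z p) = 2 * (x \<bullet> ep p)" for p
      by (simp add: x_ep z)
    have Nk: "sum z UNIV = 4 * k"
    proof -
      have "real_of_int (sum z UNIV) = real_of_int (4 * k)"
        unfolding sum_pairs[of z] of_int_sum[of "sum z"] N sum_distrib_left[symmetric] kp by simp
      then show ?thesis by (simp only: of_int_eq_iff)
    qed
    have ev: "even (sum z p - H)" if p: "p \<in> \<P>" for p
    proof -
      obtain m where "x \<bullet> ep p - h = of_int m" using h(2)[of "ep p"] p by (auto elim: Ints_cases)
      then have "real_of_int (sum z p) = of_int (2 * m + H)"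
        using H unfolding N by simp
      then have "sum z p = 2 * m + H" by (simp only: of_int_eq_iff)
      then show ?thesis by simp
    qed
    have tz: "even (sum z (supp t))"
    proof -
      have "(\<Sum>a\<in>UNIV. sg (t $ a) * (x \<bullet> \<alpha> a)) = (\<Sum>p\<in>\<P>. 2 * (x \<bullet> em p))"
        unfolding sum_pairs by (simp add: x_em)
      also have "\<dots> = 4 * of_int l"
        unfolding sum_distrib_left[symmetric] lp by simp
      finally have "(\<Sum>a\<in>UNIV. sg (t $ a) * (x \<bullet> \<alpha> a)) = of_int (4 * l)" by simp
      moreover have "(\<Sum>a\<in>UNIV. sg (t $ a) * (x \<bullet> \<alpha> a)) = (\<Sum>a\<in>UNIV. of_int (z a) - 2 * (if a \<in> supp t then of_int (z a) else 0))"
        by (intro sum.cong) (auto simp: sg_def mem_supp z)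
      then have "(\<Sum>a\<in>UNIV. sg (t $ a) * (x \<bullet> \<alpha> a)) = of_int (sum z UNIV - 2 * sum z (supp t))"
        by (simp add: sum_subtractf flip: sum_distrib_left sum.inter_filter)
      ultimately have "sum z UNIV - 2 * sum z (supp t) = 4 * l"
        by (simp only: of_int_eq_iff)
      then show ?thesis using Nk by presburger
    qed
    \<comment> \<open>Such a \<open>d\<close> is a union of pairs, and their number is even because
      the weight is divisible by 4. All pair sums of \<open>z\<close> have the parity of
      \<open>H\<close>, so the total over \<open>supp d\<close> is even.\<close>
    have evd: "code_inner (word z) d = 0" if d: "d \<in> C" "\<And>p. p \<in> \<P> \<Longrightarrow> even (card (p \<inter> supp d))" for d
    proof -
      define R where "R = {p \<in> \<P>. p \<subseteq> supp d}"
      have R: "p \<inter> supp d = (if p \<in> R then p else {})" if p: "p \<in> \<P>" for p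
      proof -
        have "card (p \<inter> supp d) \<le> 2" using \<P>(3)[OF p] by (metis card_mono fin inf_le1)
        then have "card (p \<inter> supp d) = 0 \<or> card (p \<inter> supp d) = 2" using d(2)[OF p] by presburger
        then have "p \<inter> supp d = {} \<or> p \<inter> supp d = p"
          using \<P>(3)[OF p] by (metis card_0_eq card_subset_eq fin inf_le1)
        moreover have "p \<noteq> {}" using \<P>(3)[OF p] by auto
        ultimately show ?thesis using p by (auto simp: R_def)
      qed
      have sumd: "sum f (supp d) = (\<Sum>p\<in>R. sum f p)" for f :: "'n \<Rightarrow> int"
      proof -
        have "sum f (supp d) = (\<Sum>a\<in>UNIV. if a \<in> supp d then f a else 0)"
          by (simp flip: sum.inter_filter)
        also have "\<dots> = (\<Sum>p\<in>\<P>. sum f (p \<inter> supp d))"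
          unfolding sum_pairs by (simp add: Int_def flip: sum.inter_filter)
        also have "\<dots> = (\<Sum>p\<in>\<P>. if p \<in> R then sum f p else 0)"
          by (intro sum.cong refl) (simp add: R)
        also have "\<dots> = (\<Sum>p\<in>R. sum f p)"
          by (simp add: R_def flip: sum.inter_filter)
        finally show ?thesis .
      qed
      have "int (weight d) = (\<Sum>p\<in>R. 2)"
        using sumd[of "\<lambda>_. 1"] \<P>(3) by (simp add: weight_supp R_def)
      then have "even (card R)"
        using weight_4[OF d(1)] by simp presburger
      moreover have "even ((\<Sum>p\<in>R. sum z p) - (\<Sum>p\<in>R. H))"
        unfolding sum_subtractf[symmetric] using ev by (intro dvd_sum) (auto simp: R_def)
      ultimately have "even (sum z (supp d))"
        by (simp add: sumd)
      then show ?thesis by (simp add: code_inner_word_supp)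
    qed
    have "word z \<in> C"
      unfolding mem_dual
    proof
      fix d assume d: "d \<in> C"
      obtain p0 where p0: "p0 \<in> \<P>" using \<open>card \<P> = 8\<close> by fastforce
      have par: "even (card (p \<inter> supp d)) = even (card (p0 \<inter> supp d))" if d: "d \<in> C" and "p \<in> \<P>" for d p
        using parity[of "\<lambda>i. of_bool (i \<in> supp d)" p p0] that p0 d
        by (simp add: word_of_bool Int_def flip: sum.inter_filter)
      show "code_inner (word z) d = 0"
      proof (cases "even (card (p0 \<inter> supp d))")
        case True
        then show ?thesis using evd d par by blast
      next
        \<comment> \<open>A word meeting one pair oddly meets all pairs oddly, and adding
          \<open>t\<close> makes it even on every pair.\<close>
        case False
        have "even (card (p \<inter> supp (d + t)))" if p: "p \<in> \<P>" for p
        proof -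
          have "code_inner (ind p) (d + t) = 0"
            unfolding code_inner_add_right using par[OF d p] False t(2)[OF p]
            by (simp add: code_inner_card)
          then show ?thesis by (simp add: code_inner_card split: if_splits)
        qed
        then have "code_inner (word z) (d + t) = 0"
          using code_subspace_add[OF subspace d t(1)] by (intro evd)
        moreover have "code_inner (word z) t = 0"
          using tz by (simp add: code_inner_word_supp)
        ultimately show ?thesis
          unfolding code_inner_add_right by (simp only: add_0_right)
      qed
    qed
    then show "x \<in> L"
      using z Nk by (intro LatI) auto
  qed
  then show ?thesis using oct by blast
qed

end

section \<open>Octads\<close>

locale octad = self_dual_code \<alpha> C
  for \<alpha> :: "'n::finite \<Rightarrow> real ^ 'n" and C :: "(bit ^ 'n) set" +
  fixes U :: "'n set" and i0 :: 'n
  assumes card_U: "card U = 8" and U_in: "ind U \<in> C" and i0: "i0 \<in> U"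
    and card_half: "card {c \<in> C. supp c \<subseteq> U \<and> c $ i0 = 0} = 8"
begin

text \<open>One word from each complementary pair in the subcode on \<open>U\<close>, which is the
  extended Hamming code of length 8.\<close>

definition B0 :: "(bit ^ 'n) set" where
  "B0 = {c \<in> C. supp c \<subseteq> U \<and> c $ i0 = 0}"

text \<open>A signed sum of eight vectors of norm 2 has norm 16, so the coefficient 1/4 gives norm
  1. The words of \<open>B0\<close> provide the rows of a Hadamard matrix of order 8.\<close>

definition sign_vec :: "bit ^ 'n \<Rightarrow> real ^ 'n" where
  "sign_vec c = (\<Sum>i\<in>U. (sg (c $ i) / 4) *\<^sub>R \<alpha> i)"

lemma card_B0: "card B0 = 8"
  using card_half by (simp add: B0_def)

lemma supp_add_subset: "supp c \<subseteq> A \<Longrightarrow> supp d \<subseteq> A \<Longrightarrow> supp (c + d) \<subseteq> A"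
  by (auto simp: supp_add)

lemma subspace_B0: "vec.subspace B0"
proof (rule subspace_codeI)
  show "0 \<in> B0" by (simp add: B0_def code_subspace_0[OF subspace])
  show "c + d \<in> B0" if "c \<in> B0" "d \<in> B0" for c d
    using that code_subspace_add[OF subspace, of c d] supp_add_subset[of c U d] by (simp add: B0_def)
qed

lemma B0_0: "0 \<in> B0"
  by (rule code_subspace_0[OF subspace_B0])

lemma weight_B0:
  assumes "c \<in> B0" "c \<noteq> 0"
  shows "weight c = 4"
proof -
  have "supp c \<subset> U"
    using assms(1) i0 by (auto simp: B0_def mem_supp)
  then have "weight c < 8"
    using psubset_card_mono[of U "supp c"] card_U by (simp add: weight_supp)
  moreover have "weight c \<noteq> 0"
    using assms(2) supp_inject[of c 0] by (simp add: weight_supp)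
  ultimately show ?thesis
    using weight_4[of c] assms(1) by (auto simp: B0_def elim!: dvdE)
qed

lemma sign_vec_inner: "sign_vec c \<bullet> \<alpha> i = (if i \<in> U then sg (c $ i) / 2 else 0)"
  unfolding sign_vec_def frame_sum_inner[OF frame] by simp

lemma inner_sign_vec: "x \<bullet> sign_vec c = (\<Sum>i\<in>U. sg (c $ i) * (x \<bullet> \<alpha> i)) / 4"
  by (simp add: sign_vec_def inner_sum_right sum_divide_distrib)

lemma sum_sg_real: "(\<Sum>i\<in>A. sg (c $ i)) = real_of_int (\<Sum>i\<in>A. sg (c $ i))" for c :: "bit ^ 'n"
  unfolding of_int_sum by (intro sum.cong) (auto simp: sg_def)

lemma sum_sg_B0: "c \<in> B0 \<Longrightarrow> (\<Sum>i\<in>U. sg (c $ i)) = (if c = 0 then 8 else (0::int))"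
  using weight_B0[of c] by (auto simp: sum_sg card_U B0_def weight_supp Int_absorb1)

lemma sign_vec_orth:
  assumes "c \<in> B0" "d \<in> B0"
  shows "sign_vec c \<bullet> sign_vec d = (if c = d then 1 else 0)"
proof -
  have "sign_vec c \<bullet> sign_vec d = (\<Sum>i\<in>U. sg ((c + d) $ i) / 2) / 4"
    unfolding inner_sign_vec sign_vec_inner
    by (intro arg_cong[where f = "\<lambda>x. x / 4"] sum.cong refl) (simp only: vector_add_component sg_add, simp)
  also have "\<dots> = real_of_int (\<Sum>i\<in>U. sg ((c + d) $ i)) / 8"
    unfolding sum_divide_distrib[symmetric] sum_sg_real by simp
  also have "(\<Sum>i\<in>U. sg ((c + d) $ i)) = (if c + d = 0 then 8 else (0::int))"
    by (rule sum_sg_B0) (rule code_subspace_add[OF subspace_B0 assms])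
  finally show ?thesis by (simp only: bit_vec_add_eq_0_iff) simp
qed

lemma inj_sign_vec: "inj_on sign_vec B0"
  using sign_vec_orth by (intro inj_onI) (metis zero_neq_one)

text \<open>The rows of the \<open>8 \<times> 8\<close> sign matrix are orthogonal because nonzero words of \<open>B0\<close> have
  weight 4; the columns are orthogonal because each off-diagonal column product is \<open>0\<close> or \<open>8\<close> by
  character orthogonality, and these products sum to zero.\<close>

lemma column_orth:
  assumes "i \<in> U" "j \<in> U"
  shows "(\<Sum>c\<in>B0. sg (c $ i) * sg (c $ j)) = (if i = j then 8 else (0::int))"
proof -
  define T :: "'n \<Rightarrow> int" where "T j = (\<Sum>c\<in>B0. sg (c $ i) * sg (c $ j))" for j
  have T0: "T j \<ge> 0" for j
  proof (cases "\<exists>c\<in>B0. c $ i + c $ j = 1")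
    case True
    then obtain c where c: "c \<in> B0" "c $ i + c $ j = 1" by blast
    have "(\<Sum>c\<in>B0. sg (c $ i + c $ j)) = (0::int)"
      by (rule char_sum_zero[where g = "\<lambda>c. c $ i + c $ j", OF subspace_B0 _ c]) (simp only: vector_add_component ac_simps)
    then show ?thesis by (simp only: T_def sg_add)
  next
    case False
    have "sg (c $ i) * sg (c $ j) = (1::int)" if "c \<in> B0" for c
    proof -
      have "c $ i + c $ j = 0" using False that by (metis bit_not_one_iff)
      then show ?thesis by (metis sg_add sg_simps(1))
    qed
    then show ?thesis by (simp add: T_def)
  qed
  have "(\<Sum>j\<in>U. T j) = (\<Sum>c\<in>B0. sg (c $ i) * (\<Sum>j\<in>U. sg (c $ j)))"
    unfolding T_def sum_distrib_left by (rule sum.swap)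
  also have "\<dots> = (\<Sum>c\<in>B0. if c = 0 then 8 else 0)"
    by (intro sum.cong refl) (auto simp: sum_sg_B0)
  also have "\<dots> = 8" using B0_0 by simp
  finally have "(\<Sum>j\<in>U. T j) = 8" .
  moreover have Ti: "T i = 8" by (simp add: T_def card_B0)
  ultimately have "(\<Sum>j\<in>U - {i}. T j) = 0"
    using assms(1) by (simp add: sum_diff1)
  then have "\<forall>j\<in>U - {i}. T j = 0"
    using T0 by (subst (asm) sum_nonneg_eq_0_iff) auto
  then show ?thesis using Ti assms(2) unfolding T_def by auto
qed

lemma column_orth_real:
  "i \<in> U \<Longrightarrow> j \<in> U \<Longrightarrow> (\<Sum>c\<in>B0. sg (c $ i) * sg (c $ j)) = (if i = j then 8 else (0::real))"
proof -
  assume ij: "i \<in> U" "j \<in> U"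
  have "(\<Sum>c\<in>B0. sg (c $ i) * sg (c $ j)) = real_of_int (\<Sum>c\<in>B0. sg (c $ i) * sg (c $ j))"
    unfolding of_int_sum by (intro sum.cong) (auto simp: sg_def)
  then show ?thesis
    unfolding column_orth[OF ij] by simp
qed

lemma frame_eq_sum_sign_vec:
  assumes "i \<in> U"
  shows "\<alpha> i = (\<Sum>c\<in>B0. (sg (c $ i) / 2) *\<^sub>R sign_vec c)"
proof (rule frame_eqI[OF frame])
  fix j
  have "(\<Sum>c\<in>B0. (sg (c $ i) / 2) *\<^sub>R sign_vec c) \<bullet> \<alpha> j = (if j \<in> U then (\<Sum>c\<in>B0. sg (c $ i) * sg (c $ j)) / 4 else 0)"
    by (auto simp: inner_sum_left sign_vec_inner sum_divide_distrib)
  then show "\<alpha> i \<bullet> \<alpha> j = (\<Sum>c\<in>B0. (sg (c $ i) / 2) *\<^sub>R sign_vec c) \<bullet> \<alpha> j"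
    using assms by (auto simp: column_orth_real frame_inner[OF frame])
qed

lemma coord_sum: "i \<in> U \<Longrightarrow> x \<bullet> \<alpha> i = (\<Sum>c\<in>B0. sg (c $ i) * (x \<bullet> sign_vec c)) / 2"
  by (subst frame_eq_sum_sign_vec) (simp_all add: inner_sum_right sum_divide_distrib)

lemma sum_sg_mult: "(\<Sum>i\<in>U. sg (c $ i) * f i) = sum f U - 2 * sum f (supp c)"
  if "supp c \<subseteq> U" for f :: "'n \<Rightarrow> real"
proof -
  have "(\<Sum>i\<in>U. sg (c $ i) * f i) = (\<Sum>i\<in>U. f i - 2 * (if i \<in> supp c then f i else 0))"
    by (intro sum.cong) (auto simp: sg_def mem_supp)
  also have "\<dots> = sum f U - 2 * (\<Sum>i\<in>{i \<in> U. i \<in> supp c}. f i)"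
    unfolding sum_subtractf sum_distrib_left[symmetric] by (simp flip: sum.inter_filter)
  also have "{i \<in> U. i \<in> supp c} = supp c" using that by blast
  finally show ?thesis .
qed

lemma inner_sign_vec_supp: "c \<in> B0 \<Longrightarrow> x \<bullet> sign_vec c = (\<Sum>i\<in>U. x \<bullet> \<alpha> i) / 4 - (\<Sum>i\<in>supp c. x \<bullet> \<alpha> i) / 2"
  unfolding inner_sign_vec by (subst sum_sg_mult) (simp_all add: B0_def field_simps)

lemma Lat_inner_sign_vec:
  assumes "\<And>i. x \<bullet> \<alpha> i = of_int (z i)" "word z \<in> C" "c \<in> B0"
  shows "x \<bullet> sign_vec c - of_int (sum z U) / 4 \<in> \<int>"
proof -
  have "even (sum z (supp c))"
    using assms(2,3) code_even by (simp add: B0_def)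
  then obtain k where "sum z (supp c) = 2 * k" ..
  then have "x \<bullet> sign_vec c - of_int (sum z U) / 4 = - of_int k"
    unfolding inner_sign_vec_supp[OF assms(3)] assms(1) by (simp flip: of_int_sum)
  then show ?thesis by simp
qed

text \<open>All words of \<open>B0\<close> vanish at \<open>i0\<close>, so every sign there is
  positive. Thus evenness of the sums in \<open>glued\<close> matches integrality of the coordinate
  at \<open>i0\<close>.\<close>

lemma sum_inner_sign_vec: "(\<Sum>c\<in>B0. x \<bullet> sign_vec c) = 2 * (x \<bullet> \<alpha> i0)"
proof -
  have "x \<bullet> \<alpha> i0 = (\<Sum>c\<in>B0. sg (c $ i0) * (x \<bullet> sign_vec c)) / 2"
    by (rule coord_sum[OF i0])
  also have "(\<Sum>c\<in>B0. sg (c $ i0) * (x \<bullet> sign_vec c)) = (\<Sum>c\<in>B0. x \<bullet> sign_vec c)"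
    by (intro sum.cong) (auto simp: B0_def)
  finally show ?thesis by simp
qed

lemma sum_coords: "(\<Sum>i\<in>U. x \<bullet> \<alpha> i) = 4 * (x \<bullet> sign_vec 0)"
  by (simp add: inner_sign_vec)

text \<open>The coordinate at \<open>i\<close> is \<open>k\<close> minus the sum of the products
  with those words that are 1 at \<open>i\<close>. Orthogonality with the column of
  \<open>i0\<close> makes the number of these words even, so the shifts \<open>h\<close> add up to
  an integer.\<close>

lemma coord_Ints:
  assumes h: "\<And>c. c \<in> B0 \<Longrightarrow> x \<bullet> sign_vec c - h \<in> \<int>" "2 * h \<in> \<int>"
    and k: "(\<Sum>c\<in>B0. x \<bullet> sign_vec c) = 2 * of_int k" and i: "i \<in> U"
  shows "x \<bullet> \<alpha> i \<in> \<int>"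
proof -
  let ?N = "{c \<in> B0. c $ i = 1}"
  have "(\<Sum>c\<in>B0. sg (c $ i) * (x \<bullet> sign_vec c)) = (\<Sum>c\<in>B0. x \<bullet> sign_vec c - 2 * (if c $ i = 1 then x \<bullet> sign_vec c else 0))"
    by (intro sum.cong) (auto simp: sg_def)
  also have "\<dots> = 2 * of_int k - 2 * (\<Sum>c\<in>?N. x \<bullet> sign_vec c)"
    unfolding sum_subtractf sum_distrib_left[symmetric] k by (simp flip: sum.inter_filter)
  finally have 1: "x \<bullet> \<alpha> i = of_int k - (\<Sum>c\<in>?N. x \<bullet> sign_vec c)"
    unfolding coord_sum[OF i] by simp
  have "even (card ?N)"
  proof -
    have "(\<Sum>c\<in>B0. sg (c $ i) * sg (c $ i0)) = (\<Sum>c\<in>B0. 1 - 2 * (if c $ i = 1 then 1 else 0) :: int)"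
      by (intro sum.cong) (auto simp: B0_def sg_def)
    also have "\<dots> = 8 - 2 * int (card ?N)"
      unfolding sum_subtractf sum_distrib_left[symmetric] by (simp add: card_B0 flip: sum.inter_filter)
    finally have "8 - 2 * int (card ?N) = (if i = i0 then 8 else 0)"
      unfolding column_orth[OF i i0] ..
    moreover have "even n" if "8 - 2 * int n = (if P then 8 else 0)" for n P
      using that by (cases P; simp only: if_True if_False; presburger)
    ultimately show ?thesis by blast
  qed
  then obtain m where m: "card ?N = 2 * m" ..
  have "(\<Sum>c\<in>?N. x \<bullet> sign_vec c) = (\<Sum>c\<in>?N. x \<bullet> sign_vec c - h) + of_nat m * (2 * h)"
    by (simp add: sum_subtractf m)
  also have "\<dots> \<in> \<int>"
    by (intro Ints_add Ints_sum Ints_mult[OF Ints_of_nat h(2)] h(1)) auto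
  finally show ?thesis using 1 by simp
qed

lemma code_in_octad:
  assumes "b \<in> C" "supp b \<subseteq> U"
  shows "b \<in> B0 \<or> ind U + b \<in> B0"
proof (cases "b $ i0 = 0")
  case False
  then have "(ind U + b) $ i0 = 0" using i0 by simp
  moreover have "ind U + b \<in> C" by (rule code_subspace_add[OF subspace U_in assms(1)])
  moreover have "supp (ind U + b) \<subseteq> U" using assms(2) by (intro supp_add_subset) auto
  ultimately show ?thesis unfolding B0_def by blast
qed (use assms in \<open>simp add: B0_def\<close>)

text \<open>For \<open>c\<close> in \<open>B0\<close> the shift \<open>h\<close> cancels in the
  difference of the products with \<open>sign_vec 0\<close> and \<open>sign_vec c\<close>. That
  difference is half the coordinate sum over \<open>supp c\<close>, which is therefore even.\<close>

lemma word_orth: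
  assumes h: "\<And>c. c \<in> B0 \<Longrightarrow> x \<bullet> sign_vec c - h \<in> \<int>" "2 * h \<in> \<int>"
    and z: "\<And>i. x \<bullet> \<alpha> i = of_int (z i)" and b: "b \<in> C" "supp b \<subseteq> U"
  shows "code_inner (word z) b = 0"
proof -
  have B0: "code_inner (word z) c = 0" if c: "c \<in> B0" for c
  proof -
    have "x \<bullet> sign_vec 0 - x \<bullet> sign_vec c = (\<Sum>i\<in>supp c. x \<bullet> \<alpha> i) / 2"
      unfolding inner_sign_vec_supp[OF c] inner_sign_vec_supp[OF B0_0] by simp
    moreover have "x \<bullet> sign_vec 0 - x \<bullet> sign_vec c \<in> \<int>"
      using Ints_diff[OF h(1)[OF B0_0] h(1)[OF c]] by simp
    ultimately have "(\<Sum>i\<in>supp c. x \<bullet> \<alpha> i) / 2 \<in> \<int>"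
      by (simp only:)
    then obtain k where "(\<Sum>i\<in>supp c. x \<bullet> \<alpha> i) / 2 = of_int k"
      by (rule Ints_cases)
    then have "real_of_int (sum z (supp c)) = of_int (2 * k)"
      by (simp add: z)
    then have "sum z (supp c) = 2 * k" by (simp only: of_int_eq_iff)
    then show ?thesis by (simp add: code_inner_word_supp)
  qed
  have U: "code_inner (word z) (ind U) = 0"
  proof -
    have "2 * (x \<bullet> sign_vec 0 - h) + 2 * h \<in> \<int>"
      by (rule Ints_add[OF Ints_mult[OF _ h(1)[OF B0_0]] h(2)]) simp
    then obtain k where "2 * (x \<bullet> sign_vec 0) = of_int k"
      by (auto elim: Ints_cases)
    then have "real_of_int (sum z U) = of_int (2 * k)"
      using sum_coords[of x] by (simp add: z)
    then have "sum z U = 2 * k" by (simp only: of_int_eq_iff)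
    then show ?thesis by (simp add: code_inner_word_supp)
  qed
  from code_in_octad[OF b] show ?thesis
  proof
    assume "ind U + b \<in> B0"
    from B0[OF this] show ?thesis
      unfolding code_inner_add_right U by (simp only: add_0_left)
  qed (rule B0)
qed

lemma card_in_octad:
  assumes "i \<in> U"
  shows "card {c \<in> C. supp c \<subseteq> U \<and> c $ i = 1} = 8" "card {c \<in> C. supp c \<subseteq> U} = 16"
proof -
  let ?B = "{c \<in> C. supp c \<subseteq> U}"
  have shift: "card {c \<in> ?B. c $ j = 1} = card {c \<in> ?B. c $ j = 0}" if j: "j \<in> U" for j
  proof (rule bij_betw_same_card[of "(+) (ind U)"], rule bij_betw_byWitness[where f' = "(+) (ind U)"])
    have "ind U + c \<in> ?B" if "c \<in> ?B" for c
      using that code_subspace_add[OF subspace U_in] supp_add_subset[of "ind U" U c] by auto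
    then show "(+) (ind U) ` {c \<in> ?B. c $ j = 1} \<subseteq> {c \<in> ?B. c $ j = 0}"
      "(+) (ind U) ` {c \<in> ?B. c $ j = 0} \<subseteq> {c \<in> ?B. c $ j = 1}"
      using j by auto
  qed simp_all
  have split: "card ?B = card {c \<in> ?B. c $ j = 1} + card {c \<in> ?B. c $ j = 0}" for j
  proof -
    have "?B = {c \<in> ?B. c $ j = 1} \<union> {c \<in> ?B. c $ j = 0}" by auto
    moreover have "{c \<in> ?B. c $ j = 1} \<inter> {c \<in> ?B. c $ j = 0} = {}" by auto
    ultimately show ?thesis by (metis (no_types, lifting) card_Un_disjoint finite_code)
  qed
  have "{c \<in> ?B. c $ i0 = 0} = B0" by (auto simp: B0_def)
  then show 16: "card ?B = 16"
    using split[of i0] shift[OF i0] card_B0 by simp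
  have "{c \<in> ?B. c $ i = 1} = {c \<in> C. supp c \<subseteq> U \<and> c $ i = 1}" by auto
  then show "card {c \<in> C. supp c \<subseteq> U \<and> c $ i = 1} = 8"
    using 16 split[of i] shift[OF assms] by simp
qed

text \<open>Eight words on \<open>U\<close> contain \<open>i\<close>. One is \<open>ind U\<close>,
  and the other seven are quads, which already exhausts the seven quads through
  \<open>i\<close>.\<close>

lemma quads_in_octad:
  assumes i: "i \<in> U" and Q: "Q \<in> quads C" "i \<in> Q"
  shows "Q \<subseteq> U"
proof -
  let ?Q = "{Q \<in> quads C. i \<in> Q \<and> Q \<subseteq> U}"
  have "{c \<in> C. supp c \<subseteq> U \<and> c $ i = 1} \<subseteq> insert (ind U) (ind ` ?Q)"
  proof
    fix c assume c: "c \<in> {c \<in> C. supp c \<subseteq> U \<and> c $ i = 1}"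
    have "weight c \<le> 8"
      using c card_mono[of U "supp c"] card_U by (simp add: weight_supp)
    moreover have "weight c \<noteq> 0"
      using c by (auto simp: weight_supp mem_supp[symmetric])
    ultimately have "weight c = 4 \<or> weight c = 8"
      using weight_4[of c] c by (auto elim!: dvdE)
    then show "c \<in> insert (ind U) (ind ` ?Q)"
    proof
      assume "weight c = 8"
      then have "supp c = U"
        using c card_U by (intro card_subset_eq) (auto simp: weight_supp)
      then have "c = ind U" using ind_supp[of c] by simp
      then show ?thesis by simp
    next
      assume "weight c = 4"
      then have "supp c \<in> ?Q"
        using c by (simp add: quads_def weight_supp mem_supp)
      then show ?thesis using ind_supp[of c] by (metis imageI insertI2)
    qed
  qed
  then have "card {c \<in> C. supp c \<subseteq> U \<and> c $ i = 1} \<le> card (insert (ind U) (ind ` ?Q))"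
    by (intro card_mono) auto
  also have "\<dots> \<le> Suc (card (ind ` ?Q))"
    by (rule card_insert_le_m1) simp_all
  also have "\<dots> \<le> Suc (card ?Q)"
    using card_image_le[of ?Q ind] by simp
  finally have "card {Q \<in> quads C. i \<in> Q} \<le> card ?Q"
    using card_in_octad(1)[OF i] quads_count(2)[of i] by simp
  then have "?Q = {Q \<in> quads C. i \<in> Q}"
    by (intro card_seteq) auto
  then show ?thesis using Q by blast
qed

end

context self_dual_code
begin

text \<open>The seven quads through \<open>i\<close> and \<open>U\<close> itself are eight words;
  adding \<open>ind U\<close> to them gives the words on \<open>U\<close> that vanish at
  \<open>i\<close>.\<close>

lemma octadI:
  assumes U: "card U = 8" "ind U \<in> C" "i \<in> U" and Q: "\<And>Q. Q \<in> quads C \<Longrightarrow> i \<in> Q \<Longrightarrow> Q \<subseteq> U"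
  shows "octad \<alpha> C U i"
proof
  let ?Q = "{Q \<in> quads C. i \<in> Q}"
  let ?B = "insert (ind U) (ind ` ?Q)"
  have "ind U \<notin> ind ` ?Q" using U(1) by (auto simp: quads_def)
  then have card: "card ?B = 8"
    by (simp add: card_image inj_on_def quads_count)
  have "(+) (ind U) ` ?B \<subseteq> {c \<in> C. supp c \<subseteq> U \<and> c $ i = 0}"
    using U Q code_subspace_add[OF subspace U(2)] code_subspace_0[OF subspace]
    by (auto simp: supp_add quadsD dest: Q[THEN subsetD])
  then have "8 \<le> card {c \<in> C. supp c \<subseteq> U \<and> c $ i = 0}"
    using card card_mono[of _ "(+) (ind U) ` ?B"] by (metis (no_types, lifting) add_left_imp_eq card_image finite_code inj_onI)
  moreover have "(+) (ind U) ` {c \<in> C. supp c \<subseteq> U \<and> c $ i = 0} \<subseteq> ?B"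
  proof
    fix d assume "d \<in> (+) (ind U) ` {c \<in> C. supp c \<subseteq> U \<and> c $ i = 0}"
    then obtain c where c: "c \<in> C" "supp c \<subseteq> U" "c $ i = 0" "d = ind U + c" by blast
    then have d: "d \<in> C" "supp d \<subseteq> U" "i \<in> supp d"
      using code_subspace_add[OF subspace U(2)] U(3) by (auto simp: supp_add mem_supp)
    show "d \<in> ?B"
    proof (cases "supp d = U")
      case True
      then show ?thesis using ind_supp[of d] by simp
    next
      case False
      then have "card (supp d) < 8"
        using d(2) U(1) psubset_card_mono[of U "supp d"] by (simp add: psubsetI)
      moreover have "card (supp d) \<noteq> 0" using d(3) by auto
      ultimately have "card (supp d) = 4"
        using weight_4[OF d(1)] unfolding weight_supp by presburger
      then have "supp d \<in> ?Q" using d by (simp add: quads_def)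
      then show ?thesis using ind_supp[of d] by (metis imageI insertI2)
    qed
  qed
  then have "card {c \<in> C. supp c \<subseteq> U \<and> c $ i = 0} \<le> 8"
    using card card_mono[of ?B] by (metis (no_types, lifting) add_left_imp_eq card_image finite_code inj_onI)
  ultimately show "card {c \<in> C. supp c \<subseteq> U \<and> c $ i = 0} = 8" by simp
qed (use U in auto)

text \<open>If the seven quads through a point span only eight points \<open>U\<close>, the code is of type
  \<open>e\<^sub>8\<close> on \<open>U\<close> and on its complement.\<close>

lemma glued_of_octad:
  assumes "octad \<alpha> C U i"
  shows "\<exists>E F. octads E F \<and> L = glued E F"
proof -
  interpret X: octad \<alpha> C U i by fact
  have card_compl: "card (- U) = 8"
    by (simp add: Compl_eq_Diff_UNIV card_Diff_subset n16 X.card_U)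
  then have "- U \<noteq> {}" by (metis card.empty zero_neq_numeral)
  then obtain j where j: "j \<in> - U" by blast
  have "ind (- U) = ind UNIV + ind U"
    unfolding supp_inject[symmetric] supp_add_one by simp
  then have compl: "ind (- U) \<in> C"
    using compl_in[OF X.U_in] by simp
  interpret Y: octad \<alpha> C "- U" j
  proof (rule octadI[OF card_compl compl j])
    show "Q \<subseteq> - U" if "Q \<in> quads C" "j \<in> Q" for Q
      using X.quads_in_octad[of _ Q] that j by blast
  qed
  \<comment> \<open>Both subcodes have 16 words and \<open>16 * 16\<close> is \<open>card C\<close>,
    so \<open>C\<close> is their direct sum.\<close>
  have decomp: "\<exists>b b'. b \<in> C \<and> supp b \<subseteq> U \<and> b' \<in> C \<and> supp b' \<subseteq> - U \<and> d = b + b'" if d: "d \<in> C" for d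
  proof -
    let ?P = "{c \<in> C. supp c \<subseteq> U} \<times> {c \<in> C. supp c \<subseteq> - U}"
    have res: "supp b = supp (b + b') \<inter> U" "supp b' = supp (b + b') \<inter> - U"
      if "supp b \<subseteq> U" "supp b' \<subseteq> - U" for b b' :: "bit ^ 'n"
      using that by (auto simp: supp_add)
    have inj: "inj_on (\<lambda>(b, b'). b + b') ?P"
    proof (rule inj_onI, clarsimp)
      fix b b' c c' :: "bit ^ 'n"
      assume "b + b' = c + c'" "supp b \<subseteq> U" "supp b' \<subseteq> - U" "supp c \<subseteq> U" "supp c' \<subseteq> - U"
      then show "b = c \<and> b' = c'"
        using res[of b b'] res[of c c'] supp_inject by metis
    qed
    have "(\<lambda>(b, b'). b + b') ` ?P \<subseteq> C"
      using code_subspace_add[OF subspace] by auto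
    moreover have "card ((\<lambda>(b, b'). b + b') ` ?P) = card C"
      using X.card_in_octad(2)[OF X.i0] Y.card_in_octad(2)[OF Y.i0]
      by (simp add: card_image[OF inj] card_cartesian_product card_C)
    ultimately have "(\<lambda>(b, b'). b + b') ` ?P = C"
      by (intro card_subset_eq) auto
    then show ?thesis using d by force
  qed
  have orthXY: "X.sign_vec c \<bullet> Y.sign_vec d = 0" for c d
    unfolding Y.inner_sign_vec X.sign_vec_inner by (auto intro: sum.neutral)
  have oct: "octads (X.sign_vec ` X.B0) (Y.sign_vec ` Y.B0)"
  proof -
    have "X.sign_vec ` X.B0 \<inter> Y.sign_vec ` Y.B0 = {}"
    proof (rule ccontr)
      assume "X.sign_vec ` X.B0 \<inter> Y.sign_vec ` Y.B0 \<noteq> {}"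
      then obtain c d where "c \<in> X.B0" "d \<in> Y.B0" "X.sign_vec c = Y.sign_vec d" by blast
      then show False using orthXY[of c d] X.sign_vec_orth[of c c] by simp
    qed
    moreover have "e \<bullet> f = (if e = f then 1 else 0)" if "e \<in> X.sign_vec ` X.B0" "f \<in> X.sign_vec ` X.B0" for e f
      using that X.sign_vec_orth X.inj_sign_vec by (auto simp: inj_on_eq_iff)
    moreover have "e \<bullet> f = (if e = f then 1 else 0)" if "e \<in> Y.sign_vec ` Y.B0" "f \<in> Y.sign_vec ` Y.B0" for e f
      using that Y.sign_vec_orth Y.inj_sign_vec by (auto simp: inj_on_eq_iff)
    moreover have "e \<bullet> f = 0" "f \<bullet> e = 0" if "e \<in> X.sign_vec ` X.B0" "f \<in> Y.sign_vec ` Y.B0" for e f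
      using that orthXY by (auto simp: inner_commute)
    ultimately show ?thesis
      unfolding octads_def by (auto simp: card_image X.inj_sign_vec Y.inj_sign_vec X.card_B0 Y.card_B0)
  qed
  have split: "(\<Sum>k\<in>UNIV. f k) = sum f U + sum f (- U)" for f :: "'n \<Rightarrow> 'b::comm_monoid_add"
    by (metis Compl_disjoint Compl_partition finite sum.union_disjoint)
  have "L = glued (X.sign_vec ` X.B0) (Y.sign_vec ` Y.B0)"
  proof (intro equalityI subsetI)
    fix x assume "x \<in> L"
    then obtain z where z: "\<And>i. x \<bullet> \<alpha> i = of_int (z i)" "word z \<in> C" "4 dvd sum z UNIV"
      by (metis LatE)
    define s s' where "s = sum z U" and "s' = sum z (- U)"
    have "even s"
      using code_even[OF X.U_in z(2)] by (simp add: s_def)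
    moreover have "4 dvd s + s'"
      using z(3) by (simp add: split s_def s'_def)
    \<comment> \<open>This alternative decides \<open>h\<close>: modulo integers, the products with
      the sign vectors of the two halves are \<open>s / 4\<close> and \<open>s' / 4\<close>.\<close>
    ultimately have "(4 dvd s \<and> 4 dvd s') \<or> (4 dvd s - 2 \<and> 4 dvd s' - 2)"
      by presburger
    then obtain h :: real where h: "h \<in> {0, 1/2}" "of_int s / 4 - h \<in> \<int>" "of_int s' / 4 - h \<in> \<int>"
    proof
      assume "4 dvd s \<and> 4 dvd s'"
      then have "of_int s / 4 - 0 \<in> (\<int> :: real set)" "of_int s' / 4 - 0 \<in> (\<int> :: real set)"
        by (auto elim!: dvdE)
      then show thesis using that[of 0] by blast
    next
      assume "4 dvd s - 2 \<and> 4 dvd s' - 2"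
      then obtain k l where "s - 2 = 4 * k" "s' - 2 = 4 * l" by (auto elim!: dvdE)
      then have "s = 4 * k + 2" "s' = 4 * l + 2" by simp_all
      then have "of_int s / 4 - 1/2 = (of_int k :: real)" "of_int s' / 4 - 1/2 = (of_int l :: real)"
        by (simp_all add: field_simps)
      then show thesis using that[of "1/2"] by simp
    qed
    have "x \<bullet> X.sign_vec c - h \<in> \<int>" if "c \<in> X.B0" for c
      using Ints_add[OF X.Lat_inner_sign_vec[OF z(1,2) that] h(2)] by (simp add: s_def)
    moreover have "x \<bullet> Y.sign_vec c - h \<in> \<int>" if "c \<in> Y.B0" for c
      using Ints_add[OF Y.Lat_inner_sign_vec[OF z(1,2) that] h(3)] by (simp add: s'_def)
    ultimately have hh: "\<forall>e\<in>X.sign_vec ` X.B0 \<union> Y.sign_vec ` Y.B0. x \<bullet> e - h \<in> \<int>"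
      by blast
    have "(\<Sum>e\<in>X.sign_vec ` X.B0. x \<bullet> e) = 2 * of_int (z i)" "(\<Sum>e\<in>Y.sign_vec ` Y.B0. x \<bullet> e) = 2 * of_int (z j)"
      by (simp_all add: sum.reindex X.inj_sign_vec Y.inj_sign_vec X.sum_inner_sign_vec Y.sum_inner_sign_vec z(1))
    then show "x \<in> glued (X.sign_vec ` X.B0) (Y.sign_vec ` Y.B0)"
      unfolding glued_def using h(1) hh by blast
  next
    fix x assume "x \<in> glued (X.sign_vec ` X.B0) (Y.sign_vec ` Y.B0)"
    then obtain h k l where h: "h \<in> {0, 1/2}" "\<And>e. e \<in> X.sign_vec ` X.B0 \<union> Y.sign_vec ` Y.B0 \<Longrightarrow> x \<bullet> e - h \<in> \<int>"
      and k: "(\<Sum>e\<in>X.sign_vec ` X.B0. x \<bullet> e) = 2 * of_int k" and l: "(\<Sum>e\<in>Y.sign_vec ` Y.B0. x \<bullet> e) = 2 * of_int l"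
      unfolding glued_def by blast
    have h2: "2 * h \<in> \<int>" using h(1) by (elim insertE emptyE; hypsubst; simp)
    have hX: "x \<bullet> X.sign_vec c - h \<in> \<int>" if "c \<in> X.B0" for c using h(2) that by blast
    have hY: "x \<bullet> Y.sign_vec c - h \<in> \<int>" if "c \<in> Y.B0" for c using h(2) that by blast
    have kX: "(\<Sum>c\<in>X.B0. x \<bullet> X.sign_vec c) = 2 * of_int k" using k by (simp add: sum.reindex X.inj_sign_vec)
    have lY: "(\<Sum>c\<in>Y.B0. x \<bullet> Y.sign_vec c) = 2 * of_int l" using l by (simp add: sum.reindex Y.inj_sign_vec)
    have "x \<bullet> \<alpha> a \<in> \<int>" for a
      using X.coord_Ints[OF hX h2 kX, of a] Y.coord_Ints[OF hY h2 lY, of a] by (cases "a \<in> U") auto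
    then obtain z where z: "\<And>i. x \<bullet> \<alpha> i = of_int (z i)"
      using Ints_coords by blast
    have "4 dvd sum z UNIV"
    proof -
      have "(x \<bullet> X.sign_vec 0 - h) + (x \<bullet> Y.sign_vec 0 - h) + 2 * h \<in> \<int>"
        by (intro Ints_add hX hY h2 X.B0_0 Y.B0_0)
      then obtain m where m: "x \<bullet> X.sign_vec 0 + x \<bullet> Y.sign_vec 0 = of_int m"
        by (auto elim: Ints_cases)
      have "real_of_int (sum z UNIV) = (\<Sum>i\<in>U. x \<bullet> \<alpha> i) + (\<Sum>i\<in>- U. x \<bullet> \<alpha> i)"
        unfolding split[of z] by (simp add: z)
      also have "\<dots> = of_int (4 * m)"
        unfolding X.sum_coords Y.sum_coords using m by simp
      finally have "sum z UNIV = 4 * m" by (simp only: of_int_eq_iff)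
      then show ?thesis by simp
    qed
    moreover have "word z \<in> C"
      unfolding mem_dual
    proof
      fix d assume "d \<in> C"
      then obtain b b' where b: "b \<in> C" "supp b \<subseteq> U" "b' \<in> C" "supp b' \<subseteq> - U" "d = b + b'"
        using decomp by blast
      have "code_inner (word z) b = 0" "code_inner (word z) b' = 0"
        using X.word_orth[OF hX h2 z b(1,2)] Y.word_orth[OF hY h2 z b(3,4)] by auto
      then show "code_inner (word z) d = 0"
        unfolding b(5) code_inner_add_right by (simp only: add_0_right)
    qed
    ultimately show "x \<in> L"
      using z by (intro LatI)
  qed
  then show ?thesis using oct by blast
qed

end

section \<open>The seven quads through a point\<close>

lemma (in self_dual_code) glued:
  "\<exists>E F. octads E F \<and> L = glued E F"
proof -
  define i :: 'n where "i = undefined"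
  define Q where "Q = {B \<in> quads C. i \<in> B}"
  have card_Q: "card Q = 7"
    unfolding Q_def by (rule quads_count)
  have Q: "card B = 4" "ind B \<in> C" "i \<in> B" if "B \<in> Q" for B
    using that by (auto simp: Q_def quads_def)
  have inter: "card (A \<inter> B) = 2" if "A \<in> Q" "B \<in> Q" "A \<noteq> B" for A B
    using that by (intro quads_inter) (auto simp: Q_def)
  have two: "A \<inter> B = {i, j}" if "A \<in> Q" "B \<in> Q" "A \<noteq> B" "j \<in> A" "j \<in> B" "j \<noteq> i" for A B j
  proof (rule card_seteq[symmetric])
    show "{i, j} \<subseteq> A \<inter> B" using that Q(3) by auto
    show "card (A \<inter> B) \<le> card {i, j}" using inter[OF that(1-3)] that(6) by simp
  qed simp
  define deg where "deg j = card {B \<in> Q. j \<in> B}" for j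
  have deg_sum: "(\<Sum>j\<in>A. deg j) = (\<Sum>B\<in>Q. card (B \<inter> A))" for A
    unfolding deg_def by (rule sum_card_through[where k = 4]) (rule Q(1))
  have minus_i: "card (B - {i}) = 3" if "B \<in> Q" for B
    using Q(1,3)[OF that] by simp
  show ?thesis
  proof (cases "\<exists>j. j \<noteq> i \<and> (\<forall>B\<in>Q. j \<in> B)")
    case True
    then obtain j where j: "j \<noteq> i" "\<And>B. B \<in> Q \<Longrightarrow> j \<in> B" by blast
    \<comment> \<open>Two quads through \<open>i\<close> meet in exactly two points, so removing the
      common pair leaves seven disjoint pairs; with \<open>{i, j}\<close> they fill all 16
      coordinates.\<close>
    define rest where "rest B = B - {i, j}" for B
    define \<P> where "\<P> = insert {i, j} (rest ` Q)"
    have B_eq: "B = rest B \<union> {i, j}" if "B \<in> Q" for B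
      using that Q(3) j(2) by (auto simp: rest_def)
    have card_rest: "card (rest B) = 2" if "B \<in> Q" for B
      using Q(1,3)[OF that] j that by (simp add: rest_def card_Diff_subset)
    have disj_rest: "rest A \<inter> rest B = {}" if "A \<in> Q" "B \<in> Q" "A \<noteq> B" for A B
      using two[OF that j(2)[OF that(1)] j(2)[OF that(2)] j(1)] by (auto simp: rest_def)
    have inj: "inj_on rest Q"
    proof (rule inj_onI)
      fix A B assume "A \<in> Q" "B \<in> Q" "rest A = rest B"
      then show "A = B" using B_eq by metis
    qed
    have card2: "card p = 2" if "p \<in> \<P>" for p
      using that card_rest j(1) by (auto simp: \<P>_def)
    have disj: "disjoint \<P>"
      unfolding disjoint_def
    proof (intro ballI impI)
      fix p q assume "p \<in> \<P>" "q \<in> \<P>" "p \<noteq> q"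
      then show "p \<inter> q = {}"
        using disj_rest by (auto simp: \<P>_def) (auto simp: rest_def)
    qed
    have "{i, j} \<notin> rest ` Q" by (auto simp: rest_def)
    then have "card \<P> = 8"
      by (simp add: \<P>_def card_image[OF inj] card_Q)
    have "card (\<Union>\<P>) = sum card \<P>"
      using disj by (intro card_Union_disjoint) (auto simp: disjoint_def pairwise_def disjnt_def)
    also have "\<dots> = 16" using card2 \<open>card \<P> = 8\<close> by simp
    finally have cover: "\<Union>\<P> = UNIV"
      using n16 by (intro card_subset_eq) auto
    have pq: "ind (p \<union> q) \<in> C" if pq: "p \<in> \<P>" "q \<in> \<P>" "p \<noteq> q" for p q
    proof -
      have 1: "ind (rest B \<union> {i, j}) \<in> C" if "B \<in> Q" for B
        using Q(2)[OF that] B_eq[OF that] by simp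
      have 2: "ind (rest A \<union> rest B) \<in> C" if AB: "A \<in> Q" "B \<in> Q" "A \<noteq> B" for A B
      proof -
        have "ind (rest A \<union> rest B) = ind A + ind B"
          unfolding supp_inject[symmetric] supp_add supp_ind
          using two[OF AB j(2)[OF AB(1)] j(2)[OF AB(2)] j(1)] by (auto simp: rest_def)
        then show ?thesis
          using code_subspace_add[OF subspace Q(2)[OF AB(1)] Q(2)[OF AB(2)]] by simp
      qed
      show ?thesis
        using pq 1 2 unfolding \<P>_def by (elim insertE imageE) (auto simp: Un_commute)
    qed
    have ij: "{i, j} \<in> \<P>" by (simp add: \<P>_def)
    \<comment> \<open>A word separating \<open>i\<close> and \<open>j\<close> meets every pair
      \<open>p\<close> exactly once, because \<open>p \<union> {i, j}\<close> is a word and the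
      intersection with it is even.\<close>
    obtain t where t: "t \<in> C" "t $ i + t $ j = 1"
      using sep[unfolded separates_def, rule_format, of i j] j(1) by blast
    have tp: "card (p \<inter> supp t) = 1" if p: "p \<in> \<P>" for p
    proof -
      have tij: "odd (card ({i, j} \<inter> supp t))"
      proof -
        have "code_inner (ind {i, j}) t = 1"
          unfolding code_inner_ind_sum using t(2) j(1) by simp
        then show ?thesis by (simp add: code_inner_card split: if_splits)
      qed
      have "odd (card (p \<inter> supp t))"
      proof (cases "p = {i, j}")
        case False
        have "even (card ((p \<union> {i, j}) \<inter> supp t))"
          using code_inter_even[OF pq[OF p ij False] t(1)] by simp
        moreover have "p \<inter> {i, j} = {}"
          using disj p ij False by (auto simp: disjoint_def)
        then have "card ((p \<union> {i, j}) \<inter> supp t) = card (p \<inter> supp t) + card ({i, j} \<inter> supp t)"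
          unfolding Int_Un_distrib2 by (intro card_Un_disjoint) auto
        ultimately show ?thesis using tij by simp
      qed (use tij in simp)
      moreover have "card (p \<inter> supp t) \<le> 2"
        using card2[OF p] by (metis card_mono finite inf_le1)
      ultimately show ?thesis by presburger
    qed
    show ?thesis
      by (rule glued_of_pairs[OF cover disj card2 pq t(1) tp])
  next
    case False
    \<comment> \<open>Some quad \<open>W\<close> of \<open>Q\<close> avoids \<open>j\<close>. Each
      quad through \<open>i\<close> and \<open>j\<close> meets \<open>W\<close> in \<open>i\<close>
      and one further point, and different quads give different points, so there are at most
      three.\<close>
    have deg3: "deg j \<le> 3" if j: "j \<noteq> i" for j
    proof -
      obtain W where W: "W \<in> Q" "j \<notin> W" using False j by blast
      have "\<exists>k. k \<in> B \<inter> (W - {i})" if "B \<in> {B \<in> Q. j \<in> B}" for B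
      proof -
        have "card (B \<inter> W) = 2" using inter[of B W] that W by auto
        then have "\<not> B \<inter> W \<subseteq> {i}"
          by (metis card.empty card.insert card_mono empty_iff finite.emptyI finite.insertI not_less_eq_eq numeral_2_eq_2 order_refl)
        then show ?thesis by blast
      qed
      then obtain f where f: "\<And>B. B \<in> {B \<in> Q. j \<in> B} \<Longrightarrow> f B \<in> B \<inter> (W - {i})" by metis
      have "inj_on f {B \<in> Q. j \<in> B}"
      proof (rule inj_onI, rule ccontr)
        fix A B assume AB: "A \<in> {B \<in> Q. j \<in> B}" "B \<in> {B \<in> Q. j \<in> B}" "f A = f B" "A \<noteq> B"
        then have "f A \<in> A \<inter> B" "f A \<noteq> i" "f A \<noteq> j" using f[OF AB(1)] f[OF AB(2)] W by auto
        then show False using two[of A B j] AB j by auto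
      qed
      moreover have "f ` {B \<in> Q. j \<in> B} \<subseteq> W - {i}" using f by blast
      ultimately have "card {B \<in> Q. j \<in> B} \<le> card (W - {i})"
        by (rule card_inj_on_le) simp
      then show ?thesis using minus_i[OF W(1)] by (simp add: deg_def)
    qed
    \<comment> \<open>Over the three points of \<open>W\<close> other than \<open>i\<close> the
      degrees sum to \<open>3 + 6 = 9\<close>, so the bound 3 is attained at each.\<close>
    have deg_eq: "deg j = 3" if W: "W \<in> Q" and j: "j \<in> W" "j \<noteq> i" for W j
    proof -
      have "(\<Sum>k\<in>W - {i}. deg k) = (\<Sum>B\<in>Q. card (B \<inter> (W - {i})))" by (rule deg_sum)
      also have "\<dots> = (\<Sum>B\<in>Q. if B = W then 3 else 1)"
      proof (intro sum.cong refl)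
        fix B assume B: "B \<in> Q"
        show "card (B \<inter> (W - {i})) = (if B = W then 3 else 1)"
        proof (cases "B = W")
          case True
          then have "B \<inter> (W - {i}) = W - {i}" by blast
          then show ?thesis using minus_i[OF W] True by simp
        next
          case False
          have "B \<inter> (W - {i}) = B \<inter> W - {i}" by blast
          then show ?thesis
            using inter[OF B W False] Q(3)[OF B] Q(3)[OF W] False by simp
        qed
      qed
      also have "\<dots> = 3 + (\<Sum>B\<in>Q - {W}. if B = W then 3 else 1)"
        by (subst sum.remove[of Q W]) (use W in auto)
      also have "(\<Sum>B\<in>Q - {W}. if B = W then 3 else 1) = (\<Sum>B\<in>Q - {W}. 1 :: nat)"
        by (intro sum.cong) auto
      also have "3 + \<dots> = 9"
        using W card_Q by simp
      finally have 9: "(\<Sum>k\<in>W - {i}. deg k) = 9" .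
      show ?thesis
      proof (rule ccontr)
        assume "deg j \<noteq> 3"
        then have "deg j < 3" using deg3 j(2) by (simp add: le_neq_implies_less)
        then have "(\<Sum>k\<in>W - {i}. deg k) < (\<Sum>k\<in>W - {i}. 3)"
          using deg3 j by (intro sum_strict_mono_ex1) auto
        then show False using 9 minus_i[OF W] by simp
      qed
    qed
    \<comment> \<open>Away from \<open>i\<close>, seven quads with three points each and degree 3 at
      every point leave seven points, so \<open>U\<close> has eight.\<close>
    define U where "U = \<Union>Q"
    have "(\<Sum>j\<in>U - {i}. deg j) = (\<Sum>B\<in>Q. card (B \<inter> (U - {i})))" by (rule deg_sum)
    also have "\<dots> = (\<Sum>B\<in>Q. 3)"
    proof (intro sum.cong refl)
      fix B assume "B \<in> Q"
      then have "B \<inter> (U - {i}) = B - {i}" by (auto simp: U_def)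
      then show "card (B \<inter> (U - {i})) = 3" using minus_i[OF \<open>B \<in> Q\<close>] by simp
    qed
    also have "(\<Sum>j\<in>U - {i}. deg j) = (\<Sum>j\<in>U - {i}. 3)"
      by (intro sum.cong refl) (auto simp: U_def deg_eq)
    finally have "card (U - {i}) = 7" by (simp add: card_Q)
    moreover obtain W where W: "W \<in> Q" using card_Q by (metis card.empty ex_in_conv zero_neq_numeral)
    then have iU: "i \<in> U" using Q(3) by (auto simp: U_def)
    ultimately have U8: "card U = 8" by simp
    have "W - {i} \<noteq> {}" using minus_i[OF W] by (metis card.empty zero_neq_numeral)
    then obtain a where a: "a \<in> W" "a \<noteq> i" by blast
    have "card {B \<in> Q. a \<in> B} = 3"
      using deg_eq[OF W a] by (simp add: deg_def)
    \<comment> \<open>These quads meet pairwise in exactly \<open>{i, a}\<close>, so their union has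
      \<open>2 + 3 * 2\<close> points and is \<open>U\<close>. As \<open>i\<close> and
      \<open>a\<close> are covered three times and the others once, the sum of the three words is
      \<open>ind U\<close>.\<close>
    then obtain X Y Z where XYZ: "{B \<in> Q. a \<in> B} = {X, Y, Z}" "X \<noteq> Y" "X \<noteq> Z" "Y \<noteq> Z"
      by (auto simp: card_3_iff)
    then have in_Q: "X \<in> Q" "Y \<in> Q" "Z \<in> Q" and in_a: "a \<in> X" "a \<in> Y" "a \<in> Z" by blast+
    have ints: "X \<inter> Y = {i, a}" "X \<inter> Z = {i, a}" "Y \<inter> Z = {i, a}"
      using two in_Q in_a XYZ a(2) by auto
    have "card (X \<union> Y) = 6"
      using card_Un_Int[of X Y] ints Q(1)[OF in_Q(1)] Q(1)[OF in_Q(2)] a(2) by simp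
    moreover have "(X \<union> Y) \<inter> Z = {i, a}"
      using ints by blast
    ultimately have "card (X \<union> Y \<union> Z) = 8"
      using card_Un_Int[of "X \<union> Y" Z] Q(1)[OF in_Q(3)] a(2) by simp
    then have "X \<union> Y \<union> Z = U"
      using U8 in_Q by (intro card_subset_eq) (auto simp: U_def)
    moreover have "ind (X \<union> Y \<union> Z) = (ind X + ind Y) + ind Z"
      unfolding supp_inject[symmetric] supp_add supp_ind using ints by blast
    moreover have "(ind X + ind Y) + ind Z \<in> C"
      by (intro code_subspace_add[OF subspace] Q(2) in_Q)
    ultimately have "ind U \<in> C" by metis
    then have "octad \<alpha> C U i"
      using U8 iU by (intro octadI) (auto simp: U_def Q_def)
    then show ?thesis by (rule glued_of_octad)
  qed
qed

theorem theorem2p7: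
  fixes \<alpha> :: "'n::finite \<Rightarrow> real ^ 'n"
    and C D :: "(bit ^ 'n) set"
  assumes "orthogonal_basis_norm2 \<alpha>"
    and "vec.subspace C" and "doubly_even C"
    and "vec.subspace D" and "doubly_even D"
  shows "lattice_iso (Lplus \<alpha> C) (Lplus \<alpha> D) \<longleftrightarrow>
    equivalent_codes C D \<or>
    (CARD('n) = 16 \<and> doubly_even C \<and> self_dual C \<and> doubly_even D \<and> self_dual D)"
proof -
  interpret A: framed_code \<alpha> C
    using assms frame_of_basis by unfold_locales
  interpret B: framed_code \<alpha> D
    using assms frame_of_basis by unfold_locales
  show ?thesis
    unfolding A.Lplus_eq_Lat B.Lplus_eq_Lat
  proof
    assume "lattice_iso A.L B.L"
    then obtain f where f: "orthogonal_transformation f" "f ` A.L = B.L"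
      by (auto simp: lattice_iso_def)
    have "framed_code (\<lambda>i. f (\<alpha> i)) C"
      by (rule framed_code_orthogonal_transformation[OF A.framed_code_axioms f(1)])
    moreover have "Lat (\<lambda>i. f (\<alpha> i)) C = B.L"
      using Lat_orthogonal_transformation[OF f(1)] f(2) by metis
    ultimately show "equivalent_codes C D \<or>
        (CARD('n) = 16 \<and> doubly_even C \<and> self_dual C \<and> doubly_even D \<and> self_dual D)"
      using equivalent_or_self_dual[OF _ B.framed_code_axioms] assms by blast
  next
    assume "equivalent_codes C D \<or>
        (CARD('n) = 16 \<and> doubly_even C \<and> self_dual C \<and> doubly_even D \<and> self_dual D)"
    then show "lattice_iso A.L B.L"
    proof
      assume "equivalent_codes C D"
      then show ?thesis by (rule Lat_iso_of_equivalent[OF A.frame])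
    next
      assume sd: "CARD('n) = 16 \<and> doubly_even C \<and> self_dual C \<and> doubly_even D \<and> self_dual D"
      interpret A: self_dual_code \<alpha> C using sd by unfold_locales auto
      interpret B: self_dual_code \<alpha> D using sd by unfold_locales auto
      show ?thesis
        using A.glued B.glued octads_iso sd by metis
    qed
  qed
qed

end
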